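(* Let $(a_k)_{k\in\mathbb{Z}}$ be a finitely supported real mask whose symbol $a(z)=\sum_k a_k z^k$ satisfies $a(-1)=0$, $a(1)=2$ and factorizes as $a(z)=2^{-r}(1+z)^{r+1}b(z)$ for some integer $r\ge 0$ and some Laurent polynomial $b(z)=\sum_{k=-p}^{p} b_kz^k$ with $p\ge 1$, $b_p\ne 0$ and $b_{-k}=b_k$ for all $k$. Let $B(\xi)=b(e^{-i\xi})=b_0+2\sum_{k=1}^p b_k\cos(k\xi)$, let $M=(b_{k-2\ell})_{k,\ell=-p+1,\ldots,p-1}$ (with $b_k=0$ for $|k|>p$), and let $\rho$ be the spectral radius of $M$, where $\rho\ge 1/2$. If $B(\xi)>0$ for all $\xi\in[-\pi,\pi]$, then the lower bound $r-\log_2(\rho)$ for the Hölder regularity of the subdivision scheme $f_{j+1,k}=\sum_\ell a_{k-2\ell}f_{j,\ell}$ is optimal. That is, for every real $\beta$ with $0\le \beta<r-\log_2(\rho)$ the limit function $f$ belongs to $C^\beta$ for all finitely supported initial data, while for every real $\beta\ge0$ with $\beta>r-\log_2(\rho)$ there are finitely supported initial data for which $f\notin C^\beta$.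
   Context: Subdivision scheme: given a finitely supported mask $(a_k)$ and real initial data $(f_{0,k})_{k\in\mathbb{Z}}$ with only finitely many non-zero terms, define $f_{j+1,k}=\sum_\ell a_{k-2\ell}f_{j,\ell}$ for $j\ge0$. Let $f_j$ be the piecewise linear function with value $f_{j,k}$ at $2^{-j}k$. The limit function is the pointwise limit $f=\lim_{j\to\infty}f_j$ (the scheme is convergent if this limit exists); "$f\in C^\beta$" includes that the limit exists. Hölder classes: for $0<\alpha<1$, $f\in C^\alpha$ means $|f(x)-f(y)|\le C|x-y|^\alpha$ for all $x,y\in\mathbb{R}$ and some constant $C$. For $q\in\mathbb{N}_0$, $f\in C^q$ means $f$ is $q$ times continuously differentiable, and $f\in C^{q+\alpha}$ means $f\in C^q$ and $f^{(q)}\in C^\alpha$. *)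

theory Defs
  imports "HOL-Analysis.Analysis" "Jordan_Normal_Form.Spectral_Radius"
begin

definition finsupp :: "(int \<Rightarrow> real) \<Rightarrow> bool" where
  "finsupp c \<longleftrightarrow> finite {k. c k \<noteq> 0}"

(* A Laurent polynomial is represented by its finitely supported coefficient sequence;
   only the values at z \<noteq> 0 are meaningful. *)
definition symbol :: "(int \<Rightarrow> real) \<Rightarrow> complex \<Rightarrow> complex" where
  "symbol c z = (\<Sum>k | c k \<noteq> 0. of_real (c k) * z powi k)"

(* For fixed k the index set contains every l that contributes, and it is finite if a is
   finitely supported. *)
primrec subdiv :: "(int \<Rightarrow> real) \<Rightarrow> (int \<Rightarrow> real) \<Rightarrow> nat \<Rightarrow> int \<Rightarrow> real" where
  "subdiv a f0 0 = f0"
| "subdiv a f0 (Suc j) = (\<lambda>k. \<Sum>l | a (k - 2 * l) \<noteq> 0. a (k - 2 * l) * subdiv a f0 j l)"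

(* On [2^(-j) k, 2^(-j) (k+1)] one has k = floor (2^j x) and weight t = frac (2^j x);
   see pl_interp_affine below. *)
definition pl_interp :: "nat \<Rightarrow> (int \<Rightarrow> real) \<Rightarrow> real \<Rightarrow> real" where
  "pl_interp j g x =
     (let k = \<lfloor>2 ^ j * x\<rfloor>; t = frac (2 ^ j * x) in (1 - t) * g k + t * g (k + 1))"

definition is_limit_function :: "(int \<Rightarrow> real) \<Rightarrow> (int \<Rightarrow> real) \<Rightarrow> (real \<Rightarrow> real) \<Rightarrow> bool" where
  "is_limit_function a f0 f \<longleftrightarrow>
     (\<forall>x. (\<lambda>j. pl_interp j (subdiv a f0 j) x) \<longlonglongrightarrow> f x)"

definition cont_diff :: "nat \<Rightarrow> (real \<Rightarrow> real) set" where
  "cont_diff q = {f. (\<forall>i<q. (deriv ^^ i) f differentiable_on UNIV) \<and>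
                     continuous_on UNIV ((deriv ^^ q) f)}"

definition holder_frac :: "real \<Rightarrow> (real \<Rightarrow> real) set" where
  "holder_frac \<alpha> = {f. \<exists>C. \<forall>x y. \<bar>f x - f y\<bar> \<le> C * \<bar>x - y\<bar> powr \<alpha>}"

(* C^\<beta> for real \<beta> \<ge> 0, writing \<beta> = q + \<alpha> with q integral and 0 \<le> \<alpha> < 1; for \<alpha> = 0 there is no
   Hoelder condition. *)
definition holder_class :: "real \<Rightarrow> (real \<Rightarrow> real) set" where
  "holder_class \<beta> =
     (let q = nat \<lfloor>\<beta>\<rfloor>; \<alpha> = frac \<beta> in
        {f. f \<in> cont_diff q \<and> (\<alpha> > 0 \<longrightarrow> (deriv ^^ q) f \<in> holder_frac \<alpha>)})"

(* B(\<xi>) = b(exp(-i \<xi>)) for symmetric b supported in [-p,p]; see of_real_trig_symbol below. *)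
definition trig_symbol :: "nat \<Rightarrow> (int \<Rightarrow> real) \<Rightarrow> real \<Rightarrow> real" where
  "trig_symbol p b \<xi> = b 0 + 2 * (\<Sum>k = 1..p. b (int k) * cos (real k * \<xi>))"

(* Matrix indices 0,...,2p-2 stand for -p+1,...,p-1; the entries are complex so that
   non-real eigenvalues enter the spectral radius. *)
definition subdiv_matrix :: "nat \<Rightarrow> (int \<Rightarrow> real) \<Rightarrow> complex mat" where
  "subdiv_matrix p b =
     mat (2 * p - 1) (2 * p - 1)
       (\<lambda>(i, j). of_real (b ((int i - int p + 1) - 2 * (int j - int p + 1))))"

lemma pl_interp_affine:
  assumes "0 \<le> t" "t \<le> 1"
  shows "pl_interp j g ((of_int k + t) / 2 ^ j) = (1 - t) * g k + t * g (k + 1)"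
proof (cases "t = 1")
  case True
  have "\<lfloor>of_int k + t\<rfloor> = k + 1" "frac (of_int k + t) = 0"
    using True by (simp_all add: frac_def)
  then show ?thesis using True by (simp add: pl_interp_def)
next
  case False
  then have "\<lfloor>of_int k + t\<rfloor> = k" using assms by (simp add: floor_eq_iff)
  then show ?thesis by (simp add: pl_interp_def frac_def)
qed

lemma holder_class_of_nat: "holder_class (real q) = cont_diff q"
  by (simp add: holder_class_def)

lemma holder_class_add:
  assumes "0 < \<alpha>" "\<alpha> < 1"
  shows "f \<in> holder_class (real q + \<alpha>) \<longleftrightarrow> f \<in> cont_diff q \<and> (deriv ^^ q) f \<in> holder_frac \<alpha>"
proof -
  have "\<lfloor>real q + \<alpha>\<rfloor> = int q" using assms by (simp add: floor_eq_iff)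
  then show ?thesis using assms by (simp add: holder_class_def frac_def)
qed

lemma of_real_trig_symbol:
  assumes supp: "\<And>k. \<bar>k\<bar> > int p \<Longrightarrow> b k = 0" and sym: "\<And>k. b (- k) = b k"
  shows "of_real (trig_symbol p b \<xi>) = symbol b (exp (- \<i> * of_real \<xi>))"
proof -
  let ?z = "exp (- \<i> * of_real \<xi>)"
  let ?t = "\<lambda>k::int. of_real (b k) * ?z powi k"
  have sub: "{k. b k \<noteq> 0} \<subseteq> {- int p..int p}"
  proof
    fix k assume "k \<in> {k. b k \<noteq> 0}"
    then have "\<not> \<bar>k\<bar> > int p" using supp[of k] by blast
    then have "- int p \<le> k \<and> k \<le> int p" by linarith
    then show "k \<in> {- int p..int p}" by simp
  qed
  let ?P = "int ` {1..p}" and ?N = "(\<lambda>k. - int k) ` {1..p}"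
  have "symbol b ?z = sum ?t {- int p..int p}"
    unfolding symbol_def
  proof (rule sum.mono_neutral_left)
    show "finite {- int p..int p}" by simp
    show "{k. b k \<noteq> 0} \<subseteq> {- int p..int p}" by (rule sub)
    show "\<forall>k\<in>{- int p..int p} - {k. b k \<noteq> 0}. ?t k = 0" by simp
  qed
  also have "{- int p..int p} = {0} \<union> (?P \<union> ?N)"
  proof (intro equalityI subsetI)
    fix x assume x: "x \<in> {- int p..int p}"
    consider "x = 0" | "x > 0" | "x < 0" by linarith
    then show "x \<in> {0} \<union> (?P \<union> ?N)"
    proof cases
      case 1 then show ?thesis by blast
    next
      case 2 then have "x = int (nat x)" "nat x \<in> {1..p}" using x by auto
      then have "x \<in> ?P" by (rule image_eqI)
      then show ?thesis by blast
    next
      case 3 then have "x = - int (nat (- x))" "nat (- x) \<in> {1..p}" using x by auto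
      then have "x \<in> ?N" by (rule image_eqI)
      then show ?thesis by blast
    qed
  qed auto
  also have "sum ?t \<dots> = sum ?t {0} + sum ?t (?P \<union> ?N)"
    by (rule sum.union_disjoint) auto
  also have "sum ?t (?P \<union> ?N) = sum ?t ?P + sum ?t ?N"
    by (rule sum.union_disjoint) auto
  also have "sum ?t (int ` {1..p}) = (\<Sum>k=1..p. ?t (int k))"
    by (subst sum.reindex) (auto simp: inj_on_def)
  also have "sum ?t ((\<lambda>k. - int k) ` {1..p}) = (\<Sum>k=1..p. ?t (- int k))"
    by (subst sum.reindex) (auto simp: inj_on_def)
  also have "(\<Sum>k=1..p. ?t (int k)) + (\<Sum>k=1..p. ?t (- int k))
           = (\<Sum>k=1..p. of_real (2 * (b (int k) * cos (real k * \<xi>))))"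
    unfolding sum.distrib [symmetric]
  proof (rule sum.cong [OF refl])
    fix k :: nat
    let ?x = "of_real (real k * \<xi>) :: complex"
    have 1: "?z powi int k = exp (- (\<i> * ?x))"
      by (simp add: exp_of_nat_mult [symmetric] mult_ac)
    have 2: "?z powi (- int k) = exp (\<i> * ?x)"
      unfolding power_int_minus 1 exp_minus [symmetric] by simp
    have "cos ?x = (exp (\<i> * ?x) + exp (- (\<i> * ?x))) / 2"
      by (rule cos_exp_eq)
    then have 3: "?z powi int k + ?z powi (- int k) = 2 * cos ?x"
      unfolding 1 2 by (simp add: algebra_simps)
    have "?t (int k) + ?t (- int k) = of_real (b (int k)) * (?z powi int k + ?z powi (- int k))"
      unfolding sym by (rule distrib_left [symmetric])
    also have "\<dots> = of_real (2 * (b (int k) * cos (real k * \<xi>)))"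
      unfolding 3 cos_of_real by simp
    finally show "?t (int k) + ?t (- int k) = of_real (2 * (b (int k) * cos (real k * \<xi>)))" .
  qed
  finally show ?thesis
    by (simp add: trig_symbol_def sum_distrib_left)
qed

end

theory Submission
  imports Defs
begin

text \<open>Write \<open>b\<^sub>m\<close> for the coefficients of \<open>b(z) b(z\<^sup>2) \<dots> b(z ^ 2 ^ (m - 1))\<close>. The scaled differences of order
  \<open>r + 1\<close> of the data follow the scheme with mask \<open>b\<close>, so they grow like \<open>b\<^sub>m\<close>. Because
  \<open>B > 0\<close>, the central coefficient \<open>b\<^sub>m(0)\<close> is the largest one; the entries of \<open>M\<^sup>m\<close> are
  coefficients of \<open>b\<^sub>m\<close> and \<open>b\<^sub>m(0)\<close> is among them, hence \<open>b\<^sub>m(0)\<close> grows exactly at the rate \<open>\<rho>\<close>.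
  The lower bound follows by passing from order \<open>r + 1\<close> down to lower orders of differences.

  For optimality, pair the differences of order \<open>r + 3\<close> with step \<open>2 ^ (- m)\<close> of a limit function
  with the samples \<open>\<theta>\<close> of the basic limit function on the grid \<open>2 ^ (- J) \<int>\<close>. On the Fourier side
  the pairing is a mean of \<open>\<bar>\<Theta>(\<xi>)\<bar>\<^sup>2 (1 - cos \<eta>) B(\<eta>) B(2 \<eta>) \<dots> B(2 ^ (m - 1) \<eta>)\<close> with
  \<open>\<eta> = 2 ^ J \<xi>\<close>; everything is nonnegative, and for large \<open>J\<close> the factor \<open>\<Theta>\<close> does not vanish
  for \<open>\<bar>\<eta>\<bar> \<le> \<pi>\<close>. So the pairing is at least a constant times \<open>\<rho> ^ m\<close>, whereas Hoelder regularity
  forces it to be small. The two differences beyond order \<open>r + 1\<close> give the factor \<open>1 - cos \<eta>\<close>, which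
  makes the argument work up to and including \<open>C\<^bsup>r+1\<^esup>\<close>.\<close>

section \<open>Trigonometric polynomials\<close>

text \<open>The growth of the coefficients at 0 does not by itself limit the regularity: large
  differences of the data at level m could cancel in the limit function. The nonvanishing of
  \<Theta> excludes this, and positivity turns it into an inequality for every single m. The basic
  limit function enters only through its samples, so all Fourier analysis concerns trigonometric
  polynomials and finite sums. The number of extra differences is dictated by \<rho> = 1/2, where
  the critical exponent is r + 1. There the guaranteed size of the differences of order r + 1 is
  only a constant times 2^(-(r + 1) m), which a bounded derivative of order r + 1 permits. One more
  difference measures the oscillation of that derivative, which has to tend to 0 by continuity. A
  second one makes the total of extra factors, once centred, a real even function of one
  sign.\<close>

definition supp_in :: "nat \<Rightarrow> (int \<Rightarrow> real) \<Rightarrow> bool" where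
  "supp_in K c \<longleftrightarrow> {k. c k \<noteq> 0} \<subseteq> {- int K..int K}"

lemma supp_inI: "(\<And>k. c k \<noteq> 0 \<Longrightarrow> \<bar>k\<bar> \<le> int K) \<Longrightarrow> supp_in K c"
  by (fastforce simp: supp_in_def abs_le_iff)

lemma supp_inD: "supp_in K c \<Longrightarrow> c k \<noteq> 0 \<Longrightarrow> \<bar>k\<bar> \<le> int K"
  by (fastforce simp: supp_in_def abs_le_iff)

lemma supp_in_finsupp: "supp_in K c \<Longrightarrow> finsupp c"
  unfolding finsupp_def supp_in_def by (rule finite_subset) auto

lemma finsupp_supp_in:
  assumes "finsupp c"
  obtains K where "supp_in K c"
proof -
  let ?M = "Max (insert 0 ((\<lambda>k. nat \<bar>k\<bar>) ` {k. c k \<noteq> 0}))"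
  have "\<bar>k\<bar> \<le> int ?M" if "c k \<noteq> 0" for k
  proof -
    have "nat \<bar>k\<bar> \<le> ?M"
      using assms that by (intro Max_ge) (auto simp: finsupp_def)
    then show ?thesis by linarith
  qed
  then show thesis by (intro that supp_inI)
qed

definition trig :: "(int \<Rightarrow> real) \<Rightarrow> real \<Rightarrow> complex" where
  "trig c \<xi> = (\<Sum>k | c k \<noteq> 0. of_real (c k) * cis (of_int k * \<xi>))"

lemma cis_powi: "cis x powi k = cis (of_int k * x)"
proof (cases k rule: int_cases2)
  case (nonneg n)
  then show ?thesis by (simp add: Complex.DeMoivre)
next
  case (nonpos n)
  then show ?thesis by (simp add: Complex.DeMoivre power_int_minus)
qed

lemma symbol_cis: "symbol c (cis \<xi>) = trig c \<xi>"
  by (simp add: symbol_def trig_def cis_powi)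

lemma trig_superset:
  assumes "finite A" "{k. c k \<noteq> 0} \<subseteq> A"
  shows "trig c \<xi> = (\<Sum>k\<in>A. of_real (c k) * cis (of_int k * \<xi>))"
  unfolding trig_def using assms by (intro sum.mono_neutral_left) auto

lemma trig_box:
  assumes "supp_in K c"
  shows "trig c \<xi> = (\<Sum>k\<in>{- int K..int K}. of_real (c k) * cis (of_int k * \<xi>))"
  using assms by (intro trig_superset) (auto simp: supp_in_def)

lemma continuous_trig [continuous_intros]: "continuous_on S (trig c)"
  unfolding trig_def cis_conv_exp by (intro continuous_intros)

text \<open>The average over \<open>2n\<close> equidistant frequencies replaces the integral over a period: on
  trigonometric polynomials of degree less than \<open>2n\<close> the two agree.\<close>

definition mean :: "nat \<Rightarrow> (real \<Rightarrow> complex) \<Rightarrow> complex" where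
  "mean n F = (\<Sum>t\<in>{- int n..<int n}. F (pi * of_int t / of_nat n)) / of_nat (2 * n)"

lemma mean_cmult: "mean n (\<lambda>\<xi>. c * F \<xi>) = c * mean n F"
  by (simp add: mean_def sum_distrib_left)

lemma mean_sum: "mean n (\<lambda>\<xi>. \<Sum>k\<in>A. F k \<xi>) = (\<Sum>k\<in>A. mean n (F k))"
  unfolding mean_def sum_divide_distrib[symmetric] by (subst sum.swap) simp

lemma mean_diff: "mean n (\<lambda>\<xi>. F \<xi> - G \<xi>) = mean n F - mean n G"
  by (simp add: mean_def sum_subtractf diff_divide_distrib)

text \<open>Discrete orthogonality: multiplying the sum by the ratio \<open>x\<close> shifts it by
  one index, and by periodicity the shifted sum is the same, so it vanishes unless
  \<open>x = 1\<close>. The bound on \<open>k\<close> excludes aliasing.\<close>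

lemma mean_cis:
  assumes "n > 0" "\<bar>k\<bar> < 2 * int n"
  shows "mean n (\<lambda>\<xi>. cis (of_int k * \<xi>)) = (if k = 0 then 1 else 0)"
proof (cases "k = 0")
  case True
  then show ?thesis using assms by (simp add: mean_def)
next
  case False
  define f where "f t = cis (of_int k * (pi * of_int t / of_nat n))" for t :: int
  define x where "x = cis (of_int k * pi / of_nat n)"
  have step: "f (t + 1) = x * f t" for t
    unfolding f_def x_def cis_mult using assms(1)
    by (intro arg_cong[of _ _ cis]) (simp add: field_simps)
  have "x \<noteq> 1"
  proof
    assume "x = 1"
    then have "cos (of_int k * pi / of_nat n) = 1"
      unfolding x_def by (metis cis.sel(1) one_complex.sel(1))
    then obtain j :: int where "of_int k * pi / of_nat n = of_int j * 2 * pi"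
      using cos_one_2pi_int by blast
    then have "real_of_int k = real_of_int (2 * j * int n)"
      using assms(1) by (simp add: field_simps)
    then have k: "k = 2 * j * int n" by (simp only: of_int_eq_iff)
    then have "j \<noteq> 0" using False by auto
    then have "\<bar>k\<bar> \<ge> 2 * int n" unfolding k abs_mult
      using mult_right_mono[of 1 "\<bar>j\<bar>" "2 * int n"] by simp
    then show False using assms(2) by simp
  qed
  have per: "f (int n) = f (- int n)"
  proof -
    have "f (int n) = f (- int n) * cis (2 * pi * of_int k)"
      unfolding f_def cis_mult using assms(1) by (simp add: field_simps)
    also have "cis (2 * pi * of_int k) = 1" by (rule cis_multiple_2pi) simp
    finally show ?thesis by simp
  qed
  let ?S = "sum f {- int n..<int n}"
  have "x * ?S = (\<Sum>t\<in>{- int n..<int n}. f (t + 1))"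
    by (simp add: step sum_distrib_left)
  also have "\<dots> = sum f {- int n + 1..<int n + 1}"
    by (rule sum.reindex_bij_witness[of _ "\<lambda>t. t - 1" "\<lambda>t. t + 1"]) auto
  also have "{- int n + 1..<int n + 1} = insert (int n) {- int n + 1..<int n}"
    using assms(1) by auto
  also have "sum f \<dots> = f (- int n) + sum f {- int n + 1..<int n}"
    by (simp add: per)
  also have "\<dots> = sum f (insert (- int n) {- int n + 1..<int n})"
    by simp
  also have "insert (- int n) {- int n + 1..<int n} = {- int n..<int n}"
    using assms(1) by auto
  finally have "(x - 1) * ?S = 0" by (simp add: algebra_simps)
  then have "?S = 0" using \<open>x \<noteq> 1\<close> by simp
  then show ?thesis using False by (simp add: mean_def f_def)
qed

lemma mean_coeff:
  assumes supp: "supp_in K c" and n: "int K + \<bar>j\<bar> < 2 * int n"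
  shows "mean n (\<lambda>\<xi>. cis (of_int j * \<xi>) * trig c \<xi>) = of_real (c (- j))"
proof -
  let ?A = "{- int K..int K}"
  have n0: "n > 0" using n by linarith
  have "mean n (\<lambda>\<xi>. cis (of_int j * \<xi>) * trig c \<xi>)
      = mean n (\<lambda>\<xi>. \<Sum>k\<in>?A. of_real (c k) * cis (of_int (j + k) * \<xi>))"
    by (simp add: trig_box[OF supp] sum_distrib_left distrib_left distrib_right mult_ac flip: cis_mult)
  also have "\<dots> = (\<Sum>k\<in>?A. of_real (c k) * (if j + k = 0 then 1 else 0))"
    unfolding mean_sum mean_cmult using n
    by (intro sum.cong refl arg_cong2[where f="(*)"] mean_cis[OF n0]) auto
  also have "\<dots> = (\<Sum>k\<in>?A. if k = - j then of_real (c k) else 0)"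
    by (intro sum.cong) auto
  also have "\<dots> = of_real (c (- j))"
    using supp_inD[OF supp, of "- j"] by (auto simp: abs_le_iff)
  finally show ?thesis .
qed

text \<open>Identities between sequences are later verified on symbols, where differencing,
  averaging and subdivision become multiplications (for subdivision together with a dilation of the
  frequency).\<close>

lemma trig_inject:
  assumes "finsupp c" "finsupp d" "\<And>\<xi>. trig c \<xi> = trig d \<xi>"
  shows "c = d"
proof
  fix k
  obtain K where K: "supp_in K c" using finsupp_supp_in assms(1) by metis
  obtain L where L: "supp_in L d" using finsupp_supp_in assms(2) by metis
  define n where "n = K + L + nat \<bar>k\<bar> + 1"
  have "of_real (c k) = mean n (\<lambda>\<xi>. cis (of_int (- k) * \<xi>) * trig c \<xi>)"
    by (subst mean_coeff[OF K]) (simp_all add: n_def)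
  also have "\<dots> = of_real (d k)"
    unfolding assms(3) by (subst mean_coeff[OF L]) (simp_all add: n_def)
  finally show "c k = d k" by (simp only: of_real_eq_iff)
qed

text \<open>Each coefficient is a mean of \<open>trig c\<close> against a unimodular factor, hence
  at most the mean of \<open>P\<close>, which is the coefficient at 0.\<close>

lemma nonneg_trig_coeff_le:
  assumes "finsupp c" and pos: "\<And>\<xi>. trig c \<xi> = of_real (P \<xi>)" "\<And>\<xi>. P \<xi> \<ge> 0"
  shows "\<bar>c k\<bar> \<le> c 0"
proof -
  obtain K where K: "supp_in K c" using finsupp_supp_in assms(1) by metis
  define n where "n = K + nat \<bar>k\<bar> + 1"
  define T where "T = {- int n..<int n}"
  define x where "x t = pi * of_int t / of_nat n" for t :: int
  have "of_real (c 0) = mean n (\<lambda>\<xi>. cis (of_int 0 * \<xi>) * trig c \<xi>)"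
    by (subst mean_coeff[OF K]) (simp_all add: n_def)
  also have "\<dots> = of_real ((\<Sum>t\<in>T. P (x t)) / of_nat (2 * n))"
    by (simp add: mean_def pos(1) x_def T_def)
  finally have c0: "c 0 = (\<Sum>t\<in>T. P (x t)) / of_nat (2 * n)"
    by (simp only: of_real_eq_iff)
  have "of_real (c k) = mean n (\<lambda>\<xi>. cis (of_int (- k) * \<xi>) * trig c \<xi>)"
    by (subst mean_coeff[OF K]) (simp_all add: n_def)
  then have "\<bar>c k\<bar> = norm (mean n (\<lambda>\<xi>. cis (of_int (- k) * \<xi>) * trig c \<xi>))"
    by (metis norm_of_real real_norm_def)
  also have "\<dots> \<le> (\<Sum>t\<in>T. norm (cis (of_int (- k) * x t) * trig c (x t))) / of_nat (2 * n)"
    unfolding mean_def norm_divide T_def x_def norm_of_nat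
    by (intro divide_right_mono norm_sum) simp
  also have "\<dots> = c 0" unfolding c0 by (simp add: norm_mult pos)
  finally show ?thesis .
qed

lemma mean_parseval:
  assumes c: "supp_in K c" and d: "supp_in L d"
    and n: "K + L < 2 * n"
  shows "mean n (\<lambda>\<xi>. cnj (trig c \<xi>) * trig d \<xi>) = of_real (\<Sum>k\<in>{- int K..int K}. c k * d k)"
proof -
  have "cnj (trig c \<xi>) * trig d \<xi>
      = (\<Sum>k\<in>{- int K..int K}. of_real (c k) * (cis (of_int (- k) * \<xi>) * trig d \<xi>))" for \<xi>
    unfolding trig_box[OF c] cnj_sum sum_distrib_right
    by (intro sum.cong) (simp_all add: cis_cnj mult_ac)
  then have "mean n (\<lambda>\<xi>. cnj (trig c \<xi>) * trig d \<xi>)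
     = (\<Sum>k\<in>{- int K..int K}. of_real (c k) * mean n (\<lambda>\<xi>. cis (of_int (- k) * \<xi>) * trig d \<xi>))"
    by (simp only: mean_sum mean_cmult)
  also have "\<dots> = (\<Sum>k\<in>{- int K..int K}. of_real (c k * d k))"
  proof (intro sum.cong refl)
    fix k assume "k \<in> {- int K..int K}"
    then have "int L + \<bar>- k\<bar> < 2 * int n" using n by auto
    then show "of_real (c k) * mean n (\<lambda>\<xi>. cis (of_int (- k) * \<xi>) * trig d \<xi>) = of_real (c k * d k)"
      using mean_coeff[OF d, of "- k" n] by simp
  qed
  finally show ?thesis by simp
qed

section \<open>The subdivision operator\<close>

text \<open>Upsampling by \<open>N\<close> followed by convolution with \<open>c\<close>. It covers
  one subdivision step (N = 2), n steps at once (N = 2^n) and the evaluation of a limit function on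
  a finer dyadic grid (N = 2^J). Summing over the support of \<open>u\<close> keeps the index set
  independent of \<open>k\<close>.\<close>

definition upconv :: "int \<Rightarrow> (int \<Rightarrow> real) \<Rightarrow> (int \<Rightarrow> real) \<Rightarrow> int \<Rightarrow> real" where
  "upconv N c u k = (\<Sum>l | u l \<noteq> 0. c (k - N * l) * u l)"

lemma supp_in_upconv:
  assumes c: "supp_in K c" and u: "supp_in M u"
  shows "supp_in (K + nat \<bar>N\<bar> * M) (upconv N c u)"
proof (rule supp_inI)
  fix k assume "upconv N c u k \<noteq> 0"
  then obtain l where l: "u l \<noteq> 0" "c (k - N * l) \<noteq> 0"
    unfolding upconv_def by (rule sum.not_neutral_contains_not_neutral) auto
  have "\<bar>l\<bar> \<le> int M" "\<bar>k - N * l\<bar> \<le> int K"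
    using supp_inD[OF u l(1)] supp_inD[OF c l(2)] by auto
  moreover from this have "\<bar>N * l\<bar> \<le> \<bar>N\<bar> * int M"
    unfolding abs_mult by (intro mult_left_mono) auto
  ultimately show "\<bar>k\<bar> \<le> int (K + nat \<bar>N\<bar> * M)" by simp
qed

lemma finsupp_upconv:
  assumes "finsupp c" "finsupp u"
  shows "finsupp (upconv N c u)"
proof -
  obtain K where "supp_in K c" using finsupp_supp_in assms(1) by metis
  moreover obtain M where "supp_in M u" using finsupp_supp_in assms(2) by metis
  ultimately show ?thesis using supp_in_upconv supp_in_finsupp by metis
qed

lemma trig_upconv:
  assumes "finsupp c" "finsupp u"
  shows "trig (upconv N c u) \<xi> = trig c \<xi> * trig u (of_int N * \<xi>)"
proof -
  obtain K where K: "supp_in K c" using finsupp_supp_in assms(1) by metis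
  obtain M where M: "supp_in M u" using finsupp_supp_in assms(2) by metis
  let ?X = "K + nat \<bar>N\<bar> * M"
  let ?A = "{- int ?X..int ?X}"
  have "trig (upconv N c u) \<xi> = (\<Sum>k\<in>?A. of_real (upconv N c u k) * cis (of_int k * \<xi>))"
    by (rule trig_box[OF supp_in_upconv[OF K M]])
  also have "\<dots> = (\<Sum>l | u l \<noteq> 0. \<Sum>k\<in>?A. of_real (c (k - N * l) * u l) * cis (of_int k * \<xi>))"
    unfolding upconv_def of_real_sum sum_distrib_right by (rule sum.swap)
  also have "\<dots> = (\<Sum>l | u l \<noteq> 0. trig c \<xi> * (of_real (u l) * cis (of_int l * (of_int N * \<xi>))))"
  proof (intro sum.cong refl)
    fix l assume "l \<in> {l. u l \<noteq> 0}"
    then have "\<bar>l\<bar> \<le> int M" using supp_inD[OF M] by auto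
    then have Nl: "\<bar>N * l\<bar> \<le> \<bar>N\<bar> * int M"
      unfolding abs_mult by (intro mult_left_mono) auto
    let ?A' = "(\<lambda>k. k - N * l) ` ?A"
    have "{k. c k \<noteq> 0} \<subseteq> ?A'"
    proof
      fix k assume "k \<in> {k. c k \<noteq> 0}"
      then have "\<bar>k\<bar> \<le> int K" using supp_inD[OF K] by auto
      then have "k + N * l \<in> ?A" using Nl by (auto simp: abs_le_iff)
      then show "k \<in> ?A'" by (rule rev_image_eqI) simp
    qed
    then have "trig c \<xi> = (\<Sum>k\<in>?A'. of_real (c k) * cis (of_int k * \<xi>))"
      by (intro trig_superset) auto
    also have "\<dots> = (\<Sum>k\<in>?A. of_real (c (k - N * l)) * cis (of_int (k - N * l) * \<xi>))"
      by (subst sum.reindex) (auto simp: inj_on_def)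
    finally have "trig c \<xi> * (of_real (u l) * cis (of_int l * (of_int N * \<xi>)))
        = (\<Sum>k\<in>?A. of_real (c (k - N * l) * u l)
             * (cis (of_int (k - N * l) * \<xi>) * cis (of_int l * (of_int N * \<xi>))))"
      by (simp add: sum_distrib_left sum_distrib_right mult_ac)
    also have "\<dots> = (\<Sum>k\<in>?A. of_real (c (k - N * l) * u l) * cis (of_int k * \<xi>))"
      by (simp add: cis_mult algebra_simps)
    finally show "(\<Sum>k\<in>?A. of_real (c (k - N * l) * u l) * cis (of_int k * \<xi>))
        = trig c \<xi> * (of_real (u l) * cis (of_int l * (of_int N * \<xi>)))" ..
  qed
  also have "\<dots> = trig c \<xi> * trig u (of_int N * \<xi>)"
    by (simp add: trig_def sum_distrib_left)
  finally show ?thesis .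
qed

text \<open>Indexed by the stencil of the mask, so that it also acts on data of infinite support
  such as constants, where \<open>upconv\<close> is not meaningful.\<close>

definition subdiv_step :: "(int \<Rightarrow> real) \<Rightarrow> (int \<Rightarrow> real) \<Rightarrow> int \<Rightarrow> real" where
  "subdiv_step c u k = (\<Sum>l | c (k - 2 * l) \<noteq> 0. c (k - 2 * l) * u l)"

lemma subdiv_Suc: "subdiv a f (Suc n) = subdiv_step a (subdiv a f n)"
  by (simp add: subdiv_step_def fun_eq_iff)

declare subdiv.simps(2) [simp del]

lemma finite_stencil:
  assumes "finsupp c"
  shows "finite {l. c (k - 2 * l) \<noteq> (0::real)}"
proof (rule finite_subset)
  show "{l. c (k - 2 * l) \<noteq> 0} \<subseteq> (\<lambda>i. (k - i) div 2) ` {i. c i \<noteq> 0}"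
    by (auto intro!: image_eqI)
qed (use assms in \<open>simp add: finsupp_def\<close>)

lemma subdiv_step_superset:
  assumes "finite L" "{l. c (k - 2 * l) \<noteq> 0} \<subseteq> L"
  shows "subdiv_step c u k = (\<Sum>l\<in>L. c (k - 2 * l) * u l)"
  unfolding subdiv_step_def using assms by (intro sum.mono_neutral_left) auto

lemma subdiv_step_eq_upconv:
  assumes "finsupp c" "finsupp u"
  shows "subdiv_step c u = upconv 2 c u"
proof
  fix k
  let ?L = "{l. c (k - 2 * l) \<noteq> 0}" and ?U = "{l. u l \<noteq> 0}"
  have "subdiv_step c u k = (\<Sum>l\<in>?L \<union> ?U. c (k - 2 * l) * u l)"
    using assms finite_stencil[OF assms(1)] by (intro subdiv_step_superset) (auto simp: finsupp_def)
  also have "\<dots> = upconv 2 c u k"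
    unfolding upconv_def using assms finite_stencil[OF assms(1)]
    by (intro sum.mono_neutral_right) (auto simp: finsupp_def)
  finally show "subdiv_step c u k = upconv 2 c u k" .
qed

lemma finsupp_subdiv: "finsupp a \<Longrightarrow> finsupp f \<Longrightarrow> finsupp (subdiv a f n)"
  by (induction n) (simp_all add: subdiv_Suc subdiv_step_eq_upconv finsupp_upconv)

lemma trig_subdiv_Suc:
  "finsupp a \<Longrightarrow> finsupp f \<Longrightarrow> trig (subdiv a f (Suc n)) \<xi> = trig a \<xi> * trig (subdiv a f n) (2 * \<xi>)"
  by (simp add: subdiv_Suc subdiv_step_eq_upconv finsupp_subdiv trig_upconv)

lemma subdiv_add: "subdiv a f (m + n) = subdiv a (subdiv a f m) n"
  by (induction n) (simp_all add: subdiv_Suc)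

lemma subdiv_sum:
  "subdiv a (\<lambda>k. \<Sum>x\<in>X. w x * f x k) n k = (\<Sum>x\<in>X. w x * subdiv a (f x) n k)"
proof (induction n arbitrary: k)
  case (Suc n)
  show ?case
    unfolding subdiv_Suc subdiv_step_def Suc.IH sum_distrib_left
    by (subst sum.swap) (simp add: mult_ac)
qed simp

lemma subdiv_shift: "subdiv a (\<lambda>k. f (k - l)) n k = subdiv a f n (k - 2 ^ n * l)"
proof (induction n arbitrary: k)
  case (Suc n)
  show ?case
    unfolding subdiv_Suc subdiv_step_def Suc.IH
    by (rule sum.reindex_bij_witness[of _ "\<lambda>i. i + 2 ^ n * l" "\<lambda>i. i - 2 ^ n * l"])
       (auto simp: algebra_simps)
qed simp

text \<open>The domain of dependence. One more step turns the radius K (2^n - 1) into K + 2 K (2^n -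
  1) = K (2^(n + 1) - 1).\<close>

lemma subdiv_local:
  assumes a: "supp_in K a"
    and eq: "\<And>l. \<bar>k - 2 ^ n * l\<bar> \<le> int K * (2 ^ n - 1) \<Longrightarrow> f l = g l"
  shows "subdiv a f n k = subdiv a g n k"
  using eq
proof (induction n arbitrary: k)
  case (Suc n)
  show ?case
    unfolding subdiv_Suc subdiv_step_def
  proof (intro sum.cong refl arg_cong2[where f = "(*)"] Suc.IH)
    fix i l assume "i \<in> {i. a (k - 2 * i) \<noteq> 0}" and l: "\<bar>i - 2 ^ n * l\<bar> \<le> int K * (2 ^ n - 1)"
    then have "\<bar>k - 2 * i\<bar> \<le> int K" using supp_inD[OF a] by auto
    then have "\<bar>k - 2 ^ Suc n * l\<bar> \<le> int K * (2 ^ Suc n - 1)"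
      using l by (simp add: algebra_simps)
    then show "f l = g l" by (rule Suc.prems)
  qed
qed simp

section \<open>The impulse response of a scheme and the sum rules\<close>

definition delta :: "int \<Rightarrow> real" where "delta k = (if k = 0 then 1 else 0)"

lemma finsupp_delta [simp]: "finsupp delta"
  by (simp add: finsupp_def delta_def)

lemma trig_delta [simp]: "trig delta \<xi> = 1"
proof -
  have "{k. delta k \<noteq> 0} = {0}" by (auto simp: delta_def)
  then show ?thesis by (simp add: trig_def delta_def)
qed

lemma subdiv_superposition:
  assumes "finsupp f"
  shows "subdiv a f n k = upconv (2 ^ n) (subdiv a delta n) f k"
proof -
  have "f = (\<lambda>k. \<Sum>l | f l \<noteq> 0. f l * delta (k - l))"
  proof
    fix k
    have "(\<Sum>l | f l \<noteq> 0. f l * delta (k - l)) = (\<Sum>l | f l \<noteq> 0. if l = k then f l else 0)"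
      by (intro sum.cong) (auto simp: delta_def)
    then show "f k = (\<Sum>l | f l \<noteq> 0. f l * delta (k - l))"
      using assms by (simp add: finsupp_def)
  qed
  then have "subdiv a f n k = subdiv a (\<lambda>k. \<Sum>l | f l \<noteq> 0. f l * delta (k - l)) n k"
    by (rule arg_cong)
  also have "\<dots> = upconv (2 ^ n) (subdiv a delta n) f k"
    unfolding subdiv_sum subdiv_shift upconv_def by (simp add: mult.commute)
  finally show ?thesis .
qed

lemma supp_in_subdiv_delta:
  assumes "supp_in K a"
  shows "subdiv a delta n k \<noteq> 0 \<Longrightarrow> \<bar>k\<bar> \<le> int K * (2 ^ n - 1)"
proof (rule ccontr)
  assume "subdiv a delta n k \<noteq> 0" and k: "\<not> \<bar>k\<bar> \<le> int K * (2 ^ n - 1)"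
  have "subdiv a delta n k = subdiv a (\<lambda>_. 0) n k"
    by (rule subdiv_local[OF assms]) (use k in \<open>auto simp: delta_def\<close>)
  also have "\<dots> = 0"
    using subdiv_sum[of a "\<lambda>_. 0" "\<lambda>_ _. 0" "{}"] by simp
  finally show False using \<open>subdiv a delta n k \<noteq> 0\<close> by simp
qed

text \<open>The sum rules: \<open>a(1) = 2\<close> and \<open>a(- 1) = 0\<close> say that the even and the odd coefficients of the
  mask both sum to one.\<close>

lemma subdiv_step_const:
  assumes c: "finsupp c" "trig c 0 = 2" "trig c pi = 0"
  shows "subdiv_step c (\<lambda>_. x) k = x"
proof -
  let ?C = "{i. c i \<noteq> 0}"
  have cis_pi: "cis (of_int i * pi) = of_real (if even i then 1 else - 1)" for i
  proof (cases "even i")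
    case True
    then obtain j where "i = 2 * j" by blast
    then show ?thesis using cis_multiple_2pi[of "of_int j"] by (simp add: mult_ac)
  next
    case False
    then obtain j where "i = 2 * j + 1" by (rule oddE)
    then have "of_int i * pi = 2 * pi * of_int j + pi"
      by (simp add: algebra_simps)
    then have "cis (of_int i * pi) = cis (2 * pi * of_int j) * cis pi"
      by (simp only: cis_mult)
    then show ?thesis using cis_multiple_2pi[of "of_int j"] False by simp
  qed
  have s0: "(\<Sum>i\<in>?C. c i) = 2"
  proof -
    have "of_real (\<Sum>i\<in>?C. c i) = (of_real 2 :: complex)" using c(2) by (simp add: trig_def)
    then show ?thesis by (simp only: of_real_eq_iff)
  qed
  have s1: "(\<Sum>i\<in>?C. c i * (if even i then 1 else - 1)) = 0"
  proof -
    have "of_real (\<Sum>i\<in>?C. c i * (if even i then 1 else - 1)) = (of_real 0 :: complex)"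
      using c(3) unfolding trig_def cis_pi by simp
    then show ?thesis by (simp only: of_real_eq_iff)
  qed
  \<comment> \<open>The stencil at \<open>k\<close> picks the mask indices i of the parity of
    \<open>k\<close>, that is, it has the weight (1 + e (-1)^i) / 2, which combines
    \<open>s0\<close> and \<open>s1\<close>.\<close>
  define e where "e = (if even k then 1 else - 1 :: real)"
  have "(\<Sum>l | c (k - 2 * l) \<noteq> 0. c (k - 2 * l)) = (\<Sum>i\<in>{i \<in> ?C. even (k - i)}. c i)"
    by (rule sum.reindex_bij_witness[of _ "\<lambda>i. (k - i) div 2" "\<lambda>l. k - 2 * l"]) auto
  also have "\<dots> = (\<Sum>i\<in>?C. if even (k - i) then c i else 0)"
    using c(1) by (intro sum.inter_filter) (simp add: finsupp_def)
  also have "\<dots> = (\<Sum>i\<in>?C. c i / 2 + e / 2 * (c i * (if even i then 1 else - 1)))"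
    by (intro sum.cong) (auto simp: e_def)
  also have "\<dots> = 1"
    unfolding sum.distrib sum_distrib_left[symmetric] s1 sum_divide_distrib[symmetric] s0 by simp
  finally show ?thesis by (simp add: subdiv_step_def flip: sum_distrib_right)
qed

lemma subdiv_const:
  "finsupp a \<Longrightarrow> trig a 0 = 2 \<Longrightarrow> trig a pi = 0 \<Longrightarrow> subdiv a (\<lambda>_. x) n = (\<lambda>_. x)"
  by (induction n) (auto simp: subdiv_Suc subdiv_step_const)

section \<open>Differences and the distance between consecutive levels\<close>

definition dif :: "(int \<Rightarrow> real) \<Rightarrow> int \<Rightarrow> real" where
  "dif u k = u k - u (k - 1)"

lemma dif_bound_abs_diff:
  assumes "\<And>k. \<bar>dif u k\<bar> \<le> G"
  shows "\<bar>u k - u l\<bar> \<le> G * of_int \<bar>k - l\<bar>"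
proof -
  have *: "\<bar>u k - u l\<bar> \<le> G * of_int (k - l)" if "l \<le> k" for k l
    using that
  proof (induction k rule: int_ge_induct)
    case (step i)
    have "\<bar>u (i + 1) - u i\<bar> \<le> G" using assms[of "i + 1"] by (simp add: dif_def)
    then have "\<bar>u (i + 1) - u l\<bar> \<le> G * of_int (i - l) + G" using step by linarith
    then show ?case by (simp add: algebra_simps)
  qed simp
  show ?thesis
  proof (cases "l \<le> k")
    case True
    then show ?thesis using *[of l k] by simp
  next
    case False
    then have "\<bar>u l - u k\<bar> \<le> G * of_int (l - k)" by (intro *) simp
    then show ?thesis using False by (simp add: abs_minus_commute)
  qed
qed

text \<open>Constants are reproduced, so \<open>u (k div 2)\<close> can be subtracted from the data
  before the step is applied. The stencil at \<open>k\<close> stays within K + 1 of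
  \<open>k div 2\<close>, so only that many differences accumulate.\<close>

lemma subdiv_step_close:
  assumes c: "finsupp c" "trig c 0 = 2" "trig c pi = 0"
  obtains C where "C \<ge> 0"
    and "\<And>u G k. (\<And>k. \<bar>dif u k\<bar> \<le> G) \<Longrightarrow> \<bar>subdiv_step c u k - u (k div 2)\<bar> \<le> C * G"
proof -
  obtain K where K: "supp_in K c" using finsupp_supp_in c(1) by metis
  define W where "W = (\<Sum>i | c i \<noteq> 0. \<bar>c i\<bar>)"
  define C where "C = W * (real K + 1)"
  have "W \<ge> 0" unfolding W_def by (intro sum_nonneg) auto
  have bound: "\<bar>subdiv_step c u k - u (k div 2)\<bar> \<le> C * G" if G: "\<And>k. \<bar>dif u k\<bar> \<le> G" for u G k
  proof -
    let ?L = "{l. c (k - 2 * l) \<noteq> 0}"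
    have "G \<ge> 0" using G[of 0] by linarith
    have "subdiv_step c u k - u (k div 2) = subdiv_step c u k - subdiv_step c (\<lambda>_. u (k div 2)) k"
      by (simp add: subdiv_step_const[OF c])
    also have "\<dots> = (\<Sum>l\<in>?L. c (k - 2 * l) * (u l - u (k div 2)))"
      by (simp add: subdiv_step_def sum_subtractf right_diff_distrib)
    also have "\<bar>\<dots>\<bar> \<le> (\<Sum>l\<in>?L. \<bar>c (k - 2 * l) * (u l - u (k div 2))\<bar>)"
      by (rule sum_abs)
    also have "\<dots> \<le> (\<Sum>l\<in>?L. \<bar>c (k - 2 * l)\<bar> * (G * (real K + 1)))"
      unfolding abs_mult
    proof (intro sum_mono mult_left_mono)
      fix l assume "l \<in> ?L"
      then have "\<bar>k - 2 * l\<bar> \<le> int K" using supp_inD[OF K] by auto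
      then have "\<bar>l - k div 2\<bar> \<le> int K + 1" by linarith
      then have "real_of_int \<bar>l - k div 2\<bar> \<le> real K + 1" by linarith
      then have "G * of_int \<bar>l - k div 2\<bar> \<le> G * (real K + 1)"
        using \<open>G \<ge> 0\<close> by (rule mult_left_mono)
      then show "\<bar>u l - u (k div 2)\<bar> \<le> G * (real K + 1)"
        using dif_bound_abs_diff[of u G l "k div 2", OF G] by linarith
    qed auto
    also have "\<dots> = (\<Sum>l\<in>?L. \<bar>c (k - 2 * l)\<bar>) * (G * (real K + 1))"
      by (simp add: sum_distrib_right)
    also have "\<dots> \<le> W * (G * (real K + 1))"
    proof (rule mult_right_mono)
      have "(\<Sum>l\<in>?L. \<bar>c (k - 2 * l)\<bar>) = (\<Sum>i\<in>(\<lambda>l. k - 2 * l) ` ?L. \<bar>c i\<bar>)"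
        by (subst sum.reindex) (auto simp: inj_on_def)
      also have "\<dots> \<le> W"
        unfolding W_def using c(1) by (intro sum_mono2) (auto simp: finsupp_def)
      finally show "(\<Sum>l\<in>?L. \<bar>c (k - 2 * l)\<bar>) \<le> W" .
    qed (use \<open>G \<ge> 0\<close> in simp)
    finally show ?thesis by (simp add: C_def mult_ac)
  qed
  have "C \<ge> 0" using \<open>W \<ge> 0\<close> by (simp add: C_def)
  then show thesis using that bound by blast
qed

section \<open>Powers of the subdivision matrix\<close>

text \<open>Column j of the matrix is one step applied to a shifted impulse. Cutting off to the
  window -p+1, ..., p-1 loses nothing: for \<bar>k\<bar> < p the response after m steps at k - 2^m l
  is zero as soon as \<bar>l\<bar> \<ge> p.\<close>

lemma subdiv_matrix_pow:
  assumes b: "supp_in p b" and p: "p \<ge> 1"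
    and ij: "i < 2 * p - 1" "j < 2 * p - 1"
  shows "(subdiv_matrix p b ^\<^sub>m m) $$ (i, j)
       = of_real (subdiv b delta m ((int i - int p + 1) - 2 ^ m * (int j - int p + 1)))"
  using ij
proof (induction m arbitrary: i j)
  case 0
  have "(subdiv_matrix p b ^\<^sub>m 0) $$ (i, j) = (if i = j then 1 else 0)"
    using 0 by (simp add: subdiv_matrix_def)
  then show ?case by (auto simp: delta_def)
next
  case (Suc m)
  let ?n = "2 * p - 1" and ?M = "subdiv_matrix p b"
  define k where "k = int i - int p + 1"
  define j' where "j' = int j - int p + 1"
  have M: "?M \<in> carrier_mat ?n ?n" by (simp add: subdiv_matrix_def)
  have fb: "finsupp b" using b by (rule supp_in_finsupp)
  have dj: "subdiv_step b (\<lambda>k. delta (k - j')) = (\<lambda>k. b (k - 2 * j'))"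
  proof
    fix k
    have "subdiv_step b (\<lambda>k. delta (k - j')) k
        = (\<Sum>l\<in>insert j' {l. b (k - 2 * l) \<noteq> 0}. b (k - 2 * l) * delta (l - j'))"
      using finite_stencil[OF fb] by (intro subdiv_step_superset) auto
    also have "\<dots> = (\<Sum>l\<in>insert j' {l. b (k - 2 * l) \<noteq> 0}. if l = j' then b (k - 2 * l) else 0)"
      by (intro sum.cong) (auto simp: delta_def)
    also have "\<dots> = b (k - 2 * j')"
      using finite_stencil[OF fb] by simp
    finally show "subdiv_step b (\<lambda>k. delta (k - j')) k = b (k - 2 * j')" .
  qed
  have fj: "finsupp (\<lambda>k. b (k - 2 * j'))"
  proof -
    have "finsupp (\<lambda>k. delta (k - j'))" by (simp add: finsupp_def delta_def)
    then show ?thesis unfolding dj[symmetric] using fb by (simp add: subdiv_step_eq_upconv finsupp_upconv)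
  qed
  have fin: "finite {l. b (l - 2 * j') \<noteq> 0}" using fj by (simp add: finsupp_def)
  let ?g = "\<lambda>l. subdiv b delta m (k - 2 ^ m * l) * b (l - 2 * j')"
  \<comment> \<open>The first step is split off, not the last one, to match the factorization of the
    next power as \<open>?M ^\<^sub>m m * ?M\<close>.\<close>
  have "subdiv b delta (Suc m) (k - 2 ^ Suc m * j') = subdiv b (\<lambda>k. delta (k - j')) (1 + m) k"
    by (simp add: subdiv_shift)
  also have "\<dots> = subdiv b (\<lambda>k. b (k - 2 * j')) m k"
    unfolding subdiv_add One_nat_def subdiv_Suc by (simp add: dj)
  also have "\<dots> = sum ?g {l. b (l - 2 * j') \<noteq> 0}"
    unfolding subdiv_superposition[OF fj] upconv_def ..
  also have "\<dots> = sum ?g ({l. b (l - 2 * j') \<noteq> 0} \<union> {- int p + 1..int p - 1})"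
    using fin by (intro sum.mono_neutral_left) auto
  also have "\<dots> = sum ?g {- int p + 1..int p - 1}"
  proof (intro sum.mono_neutral_right ballI)
    fix l assume "l \<in> ({l. b (l - 2 * j') \<noteq> 0} \<union> {- int p + 1..int p - 1}) - {- int p + 1..int p - 1}"
    then have l: "\<bar>l\<bar> \<ge> int p" by auto
    have "subdiv b delta m (k - 2 ^ m * l) = 0"
    proof (rule ccontr)
      assume "subdiv b delta m (k - 2 ^ m * l) \<noteq> 0"
      from supp_in_subdiv_delta[OF b this]
      have "\<bar>k - 2 ^ m * l\<bar> \<le> int p * (2 ^ m - 1)" .
      moreover have "\<bar>k\<bar> < int p" using Suc.prems p by (auto simp: k_def)
      moreover have "\<bar>2 ^ m * l\<bar> \<ge> 2 ^ m * int p"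
        unfolding abs_mult using l by simp
      ultimately show False by (simp add: algebra_simps)
    qed
    then show "?g l = 0" by simp
  qed (use fin in auto)
  also have "\<dots> = (\<Sum>t<?n. ?g (int t - int p + 1))"
    by (rule sum.reindex_bij_witness[of _ "\<lambda>t. int t - int p + 1" "\<lambda>l. nat (l + int p - 1)"])
       (use p in auto)
  finally have rec: "subdiv b delta (Suc m) (k - 2 ^ Suc m * j') = (\<Sum>t<?n. ?g (int t - int p + 1))" .
  have "(?M ^\<^sub>m Suc m) $$ (i, j) = (\<Sum>t<?n. (?M ^\<^sub>m m) $$ (i, t) * ?M $$ (t, j))"
    using Suc.prems pow_carrier_mat[OF M, of m] M
    by (simp add: scalar_prod_def atLeast0LessThan)
  also have "\<dots> = (\<Sum>t<?n. of_real (?g (int t - int p + 1)))"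
    using Suc.prems
    by (intro sum.cong refl)
       (subst Suc.IH, auto simp: subdiv_matrix_def k_def j'_def)
  finally show ?case unfolding k_def[symmetric] j'_def[symmetric] rec of_real_sum .
qed

text \<open>Scaling by 1 / \<gamma> brings the spectral radius strictly below 1, where powers stay
  bounded. The gap between the spectral radius and \<gamma> absorbs the polynomial factors of Jordan
  blocks.\<close>

lemma spectral_radius_power_bound:
  fixes A :: "complex mat"
  assumes A: "A \<in> carrier_mat n n" and n: "n > 0" and \<gamma>: "spectral_radius A < \<gamma>" "\<gamma> > 0"
  obtains C where "\<And>m i j. i < n \<Longrightarrow> j < n \<Longrightarrow> norm ((A ^\<^sub>m m) $$ (i, j)) \<le> C * \<gamma> ^ m"
proof -
  define c where "c = complex_of_real (1 / \<gamma>)"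
  let ?B = "c \<cdot>\<^sub>m A"
  have B: "?B \<in> carrier_mat n n" using A by simp
  have "c \<noteq> 0" using \<gamma> by (simp add: c_def)
  have "spectral_radius ?B < 1"
  proof -
    obtain ev where ev: "ev \<in> spectrum ?B" and sr: "spectral_radius ?B = norm ev"
      using spectral_radius_mem_max(1)[OF B n] by auto
    then obtain v where v: "eigenvector ?B v ev" by (auto simp: spectrum_def eigenvalue_def)
    then have v': "v \<in> carrier_vec n" "v \<noteq> 0\<^sub>v n" "?B *\<^sub>v v = ev \<cdot>\<^sub>v v"
      using B A by (auto simp: eigenvector_def)
    have "A *\<^sub>v v = (ev / c) \<cdot>\<^sub>v v"
    proof -
      have "c \<cdot>\<^sub>v (A *\<^sub>v v) = ev \<cdot>\<^sub>v v"
        unfolding v'(3)[symmetric] using v'(1) A by (intro eq_vecI) auto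
      then have "(1 / c) \<cdot>\<^sub>v (c \<cdot>\<^sub>v (A *\<^sub>v v)) = (1 / c) \<cdot>\<^sub>v (ev \<cdot>\<^sub>v v)" by simp
      then show ?thesis using \<open>c \<noteq> 0\<close> by (simp add: smult_smult_assoc)
    qed
    then have "eigenvector A v (ev / c)" using v' A by (simp add: eigenvector_def)
    then have "ev / c \<in> spectrum A" by (auto simp: spectrum_def eigenvalue_def)
    then have "norm (ev / c) \<le> spectral_radius A"
      by (intro spectral_radius_mem_max(2)[OF A n] imageI)
    moreover have "norm (ev / c) = norm ev * \<gamma>"
      using \<gamma>(2) by (simp add: c_def norm_mult)
    ultimately have "norm ev * \<gamma> < 1 * \<gamma>" using \<gamma>(1) by linarith
    then show ?thesis unfolding sr using \<gamma>(2) mult_less_cancel_right_pos by blast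
  qed
  then obtain C where C: "\<And>m. norm_bound (?B ^\<^sub>m m) C"
    using spectral_radius_jnf_norm_bound_less_1_upper_triangular[OF B] by blast
  have pow: "?B ^\<^sub>m m = c ^ m \<cdot>\<^sub>m (A ^\<^sub>m m)" for m
  proof (induction m)
    case 0
    then show ?case by (auto simp: smult_mat_def)
  next
    case (Suc m)
    have Am: "A ^\<^sub>m m \<in> carrier_mat n n" using A by simp
    have "?B ^\<^sub>m Suc m = c ^ m \<cdot>\<^sub>m (A ^\<^sub>m m * ?B)"
      using mult_smult_assoc_mat[OF Am B] by (simp add: Suc)
    also have "A ^\<^sub>m m * ?B = c \<cdot>\<^sub>m (A ^\<^sub>m m * A)"
      by (rule mult_smult_distrib[OF Am A])
    finally show ?case using A by (intro eq_matI) (auto simp: mult_ac)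
  qed
  have "norm ((A ^\<^sub>m m) $$ (i, j)) \<le> C * \<gamma> ^ m" if ij: "i < n" "j < n" for m i j
  proof -
    have Am: "A ^\<^sub>m m \<in> carrier_mat n n" using A by simp
    note dim = carrier_matD[OF Am]
    have "norm ((?B ^\<^sub>m m) $$ (i, j)) \<le> C"
      using C[of m] ij unfolding pow norm_bound_def index_smult_mat dim by blast
    then have "norm ((A ^\<^sub>m m) $$ (i, j)) / \<gamma> ^ m \<le> C"
      unfolding pow using ij \<gamma>(2)
      by (subst (asm) index_smult_mat)
         (simp_all add: dim carrier_matD[OF A] c_def norm_mult norm_divide norm_power power_one_over)
    then show ?thesis using \<gamma>(2) by (simp add: field_simps)
  qed
  then show thesis by (rule that)
qed

text \<open>Apply the power to an eigenvector whose eigenvalue has maximal modulus and read off its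
  largest component: the row sum there is at most n X times that component.\<close>

lemma spectral_radius_pow_le:
  fixes A :: "complex mat"
  assumes A: "A \<in> carrier_mat n n" and n: "n > 0"
    and X: "\<And>i j. i < n \<Longrightarrow> j < n \<Longrightarrow> norm ((A ^\<^sub>m m) $$ (i, j)) \<le> X"
  shows "spectral_radius A ^ m \<le> real n * X"
proof -
  obtain ev where ev: "ev \<in> spectrum A" and sr: "spectral_radius A = norm ev"
    using spectral_radius_mem_max(1)[OF A n] by auto
  then obtain v where v: "eigenvector A v ev" by (auto simp: spectrum_def eigenvalue_def)
  then have v': "v \<in> carrier_vec n" "v \<noteq> 0\<^sub>v n" using A by (auto simp: eigenvector_def)
  have pow: "A ^\<^sub>m m *\<^sub>v v = ev ^ m \<cdot>\<^sub>v v" by (rule eigenvector_pow[OF A v])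
  have Am: "A ^\<^sub>m m \<in> carrier_mat n n" using A by simp
  define V where "V = Max ((\<lambda>i. norm (v $ i)) ` {..<n})"
  have "V \<in> (\<lambda>i. norm (v $ i)) ` {..<n}"
    unfolding V_def using n by (intro Max_in) auto
  then obtain i where i: "i < n" "V = norm (v $ i)" by auto
  have le: "norm (v $ j) \<le> V" if "j < n" for j
    unfolding V_def using that by (intro Max_ge) auto
  have "V > 0"
  proof (rule ccontr)
    assume "\<not> V > 0"
    have "v $ j = 0" if "j < n" for j
    proof -
      have "norm (v $ j) \<le> 0" using le[OF that] \<open>\<not> V > 0\<close> by linarith
      then show ?thesis by simp
    qed
    then have "v = 0\<^sub>v n" using v'(1) by (intro eq_vecI) auto
    then show False using v'(2) by simp
  qed
  have X0: "X \<ge> 0" using X[OF n n] norm_ge_zero order_trans by blast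
  have "norm ev ^ m * V = norm ((A ^\<^sub>m m *\<^sub>v v) $ i)"
    unfolding pow using i v' by (simp add: norm_mult norm_power)
  also have "(A ^\<^sub>m m *\<^sub>v v) $ i = (\<Sum>j<n. (A ^\<^sub>m m) $$ (i, j) * v $ j)"
    using i(1) v'(1) carrier_matD[OF Am]
    by (subst index_mult_mat_vec) (auto simp: scalar_prod_def atLeast0LessThan)
  also have "norm \<dots> \<le> (\<Sum>j<n. X * V)"
    unfolding norm_mult
    by (rule sum_norm_le) (use X i le X0 in \<open>auto simp: norm_mult intro!: mult_mono\<close>)
  also have "\<dots> = real n * X * V" by simp
  finally show ?thesis unfolding sr using \<open>V > 0\<close> by (simp add: mult_le_cancel_right)
qed

section \<open>Smoothness of limits of grid functions\<close>

text \<open>With \<open>y\<close> = 2^j x: the dyadic cell of x at level j is the parent, under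
  \<open>k div 2\<close>, of its cell at level j + 1.\<close>

lemma floor_double_div: "\<lfloor>2 * y\<rfloor> div 2 = \<lfloor>y :: real\<rfloor>"
proof (rule int_div_pos_eq)
  define r where "r = \<lfloor>2 * y\<rfloor> - 2 * \<lfloor>y\<rfloor>"
  show "\<lfloor>2 * y\<rfloor> = 2 * \<lfloor>y\<rfloor> + r" by (simp add: r_def)
  show "0 \<le> r" "r < 2" unfolding r_def by linarith+
qed

text \<open>Read \<open>d j\<close> as a function constant on the dyadic cells of level j. At a
  fixed point the levels form a telescoping series dominated by a geometric one, whose tail accounts
  for 1 / (1 - \<tau>).\<close>

lemma grid_limit:
  fixes d :: "nat \<Rightarrow> int \<Rightarrow> real"
  assumes \<tau>: "0 < \<tau>" "\<tau> < 1"
    and refine: "\<And>j k. \<bar>d (Suc j) k - d j (k div 2)\<bar> \<le> C * \<tau> ^ j"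
  obtains F :: "real \<Rightarrow> real" where "\<And>x j. \<bar>F x - d j \<lfloor>2 ^ j * x\<rfloor>\<bar> \<le> C / (1 - \<tau>) * \<tau> ^ j"
proof -
  define e where "e x j = d j \<lfloor>2 ^ j * x\<rfloor>" for x :: real and j
  define h where "h x j = e x (Suc j) - e x j" for x j
  define F where "F x = e x 0 + suminf (h x)" for x
  have h: "\<bar>h x j\<bar> \<le> C * \<tau> ^ j" for x j
    using refine[of j "\<lfloor>2 ^ Suc j * x\<rfloor>"] floor_double_div[of "2 ^ j * x"]
    by (simp add: h_def e_def mult.assoc)
  have sg: "summable (\<lambda>j. C * \<tau> ^ j)" using \<tau> by (intro summable_mult summable_geometric) auto
  have sh: "summable (h x)" for x
    using h by (intro summable_comparison_test'[OF sg]) auto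
  have "\<bar>F x - e x j\<bar> \<le> C / (1 - \<tau>) * \<tau> ^ j" for x j
  proof -
    have "(\<Sum>i<j. h x i) = e x j - e x 0"
      unfolding h_def by (rule sum_lessThan_telescope)
    then have "F x - e x j = (\<Sum>i. h x (i + j))"
      unfolding F_def using suminf_split_initial_segment[OF sh[of x], of j] by simp
    also have "\<bar>\<dots>\<bar> \<le> (\<Sum>i. C * \<tau> ^ j * \<tau> ^ i)"
      unfolding real_norm_def[symmetric]
    proof (rule norm_suminf_le)
      show "norm (h x (i + j)) \<le> C * \<tau> ^ j * \<tau> ^ i" for i
        using h[of x "i + j"] by (simp add: power_add mult_ac)
      show "summable (\<lambda>i. C * \<tau> ^ j * \<tau> ^ i)"
        using \<tau> by (intro summable_mult summable_geometric) auto
    qed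
    also have "\<dots> = C / (1 - \<tau>) * \<tau> ^ j"
      using \<tau> by (subst suminf_mult) (auto simp: suminf_geometric summable_geometric)
    finally show ?thesis .
  qed
  then show thesis unfolding e_def by (rule that)
qed

lemma holder_frac_continuous:
  assumes "g \<in> holder_frac \<alpha>" "\<alpha> > 0"
  shows "continuous_on S g"
proof -
  obtain C where C: "\<And>x y. \<bar>g x - g y\<bar> \<le> C * \<bar>x - y\<bar> powr \<alpha>"
    using assms(1) by (auto simp: holder_frac_def)
  have "isCont g x" for x
  proof -
    have "((\<lambda>y. \<bar>y - x\<bar>) \<longlongrightarrow> \<bar>x - x\<bar>) (at x)" by (intro tendsto_intros)
    then have "((\<lambda>y. \<bar>y - x\<bar> powr \<alpha>) \<longlongrightarrow> 0 powr \<alpha>) (at x)"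
      using assms(2) by (intro tendsto_powr') auto
    then have "((\<lambda>y. C * \<bar>y - x\<bar> powr \<alpha>) \<longlongrightarrow> 0) (at x)"
      by (intro tendsto_mult_right_zero) simp
    moreover have "\<forall>\<^sub>F y in at x. norm (g y - g x) \<le> C * \<bar>y - x\<bar> powr \<alpha>"
      unfolding real_norm_def by (rule always_eventually) (rule allI, rule C)
    ultimately have "((\<lambda>y. g y - g x) \<longlongrightarrow> 0) (at x)"
      by (rule Lim_null_comparison[rotated])
    then have "(g \<longlongrightarrow> g x) (at x)" by (rule LIM_zero_cancel)
    then show ?thesis unfolding isCont_def .
  qed
  then show ?thesis by (intro continuous_at_imp_continuous_on ballI)
qed

text \<open>Compare two points at the level j with 1/2 < 2^j \<bar>x - y\<bar> \<le> 1. There they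
  lie in equal or adjacent cells, while the error of that level is comparable to \<bar>x - y\<bar>
  powr \<alpha>.\<close>

lemma holder_frac_grid_limit:
  fixes d :: "nat \<Rightarrow> int \<Rightarrow> real"
  assumes \<alpha>: "0 < \<alpha>" "\<alpha> < 1"
    and F: "\<And>x j. \<bar>F x - d j \<lfloor>2 ^ j * x\<rfloor>\<bar> \<le> C * (2 powr - \<alpha>) ^ j"
    and dif: "\<And>j k. \<bar>dif (d j) k\<bar> \<le> C * (2 powr - \<alpha>) ^ j"
    and bd: "\<And>k. \<bar>d 0 k\<bar> \<le> C"
  shows "F \<in> holder_frac \<alpha>"
proof -
  have "C \<ge> 0" using bd[of 0] by linarith
  \<comment> \<open>Three errors of level j (two for replacing \<open>F\<close> by
    \<open>d j\<close>, one for the adjacent cell), times 2 for rounding j. Points more than 1 apart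
    are handled by the uniform bound 4 C.\<close>
  have main: "\<bar>F x - F y\<bar> \<le> 6 * C * \<bar>x - y\<bar> powr \<alpha>" for x y
  proof (cases "x = y")
    case False
    define s where "s = \<bar>x - y\<bar>"
    have s: "s > 0" using False by (simp add: s_def)
    show ?thesis
    proof (cases "s \<le> 1")
      case True
      define j where "j = nat \<lfloor>- log 2 s\<rfloor>"
      have "log 2 s \<le> 0" using s True by simp
      then have "real j = of_int \<lfloor>- log 2 s\<rfloor>" by (simp add: j_def)
      then have j: "real j \<le> - log 2 s" "- log 2 s < real j + 1" by linarith+
      have s_le: "2 ^ j * s \<le> 1"
      proof -
        have "2 ^ j * s = 2 powr (real j + log 2 s)"
          using s by (simp add: powr_add powr_realpow)
        also have "\<dots> \<le> 2 powr 0" using j by (intro powr_mono) auto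
        finally show ?thesis by simp
      qed
      have "(2 powr - \<alpha>) ^ j = 2 powr (- \<alpha> * real j)"
        by (simp add: powr_powr flip: powr_realpow)
      also have "\<dots> \<le> 2 powr (1 + \<alpha> * log 2 s)"
      proof (rule powr_mono)
        have "\<alpha> * (- log 2 s) \<le> \<alpha> * (real j + 1)" using j \<alpha> by (intro mult_left_mono) auto
        then show "- \<alpha> * real j \<le> 1 + \<alpha> * log 2 s" using \<alpha> by (simp add: algebra_simps)
      qed simp
      also have "\<dots> = 2 * s powr \<alpha>"
        using s by (simp add: powr_add powr_powr[symmetric] mult.commute[of \<alpha>])
      finally have \<tau>: "(2 powr - \<alpha>) ^ j \<le> 2 * s powr \<alpha>" .
      have "\<bar>2 ^ j * x - 2 ^ j * y\<bar> \<le> 1"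
        using s_le by (simp add: s_def abs_mult flip: right_diff_distrib)
      then have "\<bar>\<lfloor>2 ^ j * x\<rfloor> - \<lfloor>2 ^ j * y\<rfloor>\<bar> \<le> 1" by linarith
      then have fl: "real_of_int \<bar>\<lfloor>2 ^ j * x\<rfloor> - \<lfloor>2 ^ j * y\<rfloor>\<bar> \<le> 1" by linarith
      have "\<bar>d j \<lfloor>2 ^ j * x\<rfloor> - d j \<lfloor>2 ^ j * y\<rfloor>\<bar>
          \<le> C * (2 powr - \<alpha>) ^ j * of_int \<bar>\<lfloor>2 ^ j * x\<rfloor> - \<lfloor>2 ^ j * y\<rfloor>\<bar>"
        by (rule dif_bound_abs_diff[OF dif])
      also have "\<dots> \<le> C * (2 powr - \<alpha>) ^ j * 1"
        using fl \<open>C \<ge> 0\<close> by (intro mult_left_mono) auto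
      finally have "\<bar>F x - F y\<bar> \<le> 3 * C * (2 powr - \<alpha>) ^ j"
        using F[of x j] F[of y j] by linarith
      also have "\<dots> \<le> 3 * C * (2 * s powr \<alpha>)"
        using \<tau> \<open>C \<ge> 0\<close> by (intro mult_left_mono) auto
      finally show ?thesis by (simp add: s_def)
    next
      case False
      have "\<bar>F x - F y\<bar> \<le> 4 * C"
        using F[of x 0] F[of y 0] bd[of "\<lfloor>2 ^ 0 * x\<rfloor>"] bd[of "\<lfloor>2 ^ 0 * y\<rfloor>"] by simp
      also have "\<dots> \<le> 6 * C * 1" using \<open>C \<ge> 0\<close> by simp
      also have "\<dots> \<le> 6 * C * s powr \<alpha>"
        using False \<alpha> \<open>C \<ge> 0\<close> by (intro mult_left_mono ge_one_powr_ge_zero) auto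
      finally show ?thesis by (simp add: s_def)
    qed
  qed simp
  then show ?thesis by (auto simp: holder_frac_def)
qed

lemma sum_dif_close:
  assumes "k \<le> k'" "\<And>i. k < i \<Longrightarrow> i \<le> k' \<Longrightarrow> \<bar>N * dif u i - c\<bar> \<le> e"
  shows "\<bar>N * (u k' - u k) - of_int (k' - k) * c\<bar> \<le> of_int (k' - k) * e"
  using assms
proof (induction k' rule: int_ge_induct)
  case (step i)
  have "\<bar>N * (u i - u k) - of_int (i - k) * c\<bar> \<le> of_int (i - k) * e"
    using step by auto
  moreover have "\<bar>N * (u (i + 1) - u i) - c\<bar> \<le> e"
    using step(1) step(3)[of "i + 1"] by (simp add: dif_def)
  moreover have "N * (u (i + 1) - u k) - of_int (i + 1 - k) * c
    = (N * (u i - u k) - of_int (i - k) * c) + (N * (u (i + 1) - u i) - c)"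
    by (simp add: algebra_simps)
  moreover have "of_int (i + 1 - k) * e = of_int (i - k) * e + e"
    by (simp add: algebra_simps)
  ultimately show ?case by linarith
qed simp

lemma floor_scaled_tendsto: "(\<lambda>j. of_int \<lfloor>2 ^ j * x\<rfloor> / 2 ^ j) \<longlonglongrightarrow> (x :: real)"
proof (rule LIM_zero_cancel, rule Lim_null_comparison)
  show "\<forall>\<^sub>F j in sequentially. norm (of_int \<lfloor>2 ^ j * x\<rfloor> / 2 ^ j - x) \<le> (1 / 2) ^ j"
  proof (intro always_eventually allI)
    fix j :: nat
    have "\<bar>of_int \<lfloor>2 ^ j * x\<rfloor> - 2 ^ j * x\<bar> \<le> 1" by linarith
    moreover have "of_int \<lfloor>2 ^ j * x\<rfloor> / 2 ^ j - x = (of_int \<lfloor>2 ^ j * x\<rfloor> - 2 ^ j * x) / 2 ^ j"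
      by (simp add: field_simps)
    ultimately show "norm (of_int \<lfloor>2 ^ j * x\<rfloor> / 2 ^ j - x) \<le> (1 / 2) ^ j"
      by (simp add: power_one_over divide_right_mono)
  qed
qed (auto intro: LIMSEQ_power_zero)

text \<open>A mean value inequality obtained without integration: the increment of \<open>F\<close>
  is a limit of sums of differences of \<open>u j\<close>, and each such difference is the mesh
  width times a value of \<open>G\<close> up to a vanishing error.\<close>

lemma grid_limit_increment:
  fixes u :: "nat \<Rightarrow> int \<Rightarrow> real"
  assumes \<tau>: "0 < \<tau>" "\<tau> < 1"
    and F: "\<And>x j. \<bar>F x - u j \<lfloor>2 ^ j * x\<rfloor>\<bar> \<le> C * \<tau> ^ j"
    and G: "\<And>x j. \<bar>G x - 2 ^ j * dif (u j) \<lfloor>2 ^ j * x\<rfloor>\<bar> \<le> C * \<tau> ^ j"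
    and xy: "x \<le> y" and c: "\<And>t. x \<le> t \<Longrightarrow> t \<le> y \<Longrightarrow> \<bar>G t - c\<bar> \<le> e"
  shows "\<bar>F y - F x - (y - x) * c\<bar> \<le> (y - x) * e"
proof -
  define X where "X j = \<lfloor>2 ^ j * x\<rfloor>" for j :: nat
  define Y where "Y j = \<lfloor>2 ^ j * y\<rfloor>" for j :: nat
  define L where "L j = of_int (Y j) / 2 ^ j - of_int (X j) / (2 ^ j :: real)" for j
  have XY: "X j \<le> Y j" for j
    unfolding X_def Y_def using xy by (intro floor_mono) simp
  have step: "\<bar>u j (Y j) - u j (X j) - L j * c\<bar> \<le> L j * (e + C * \<tau> ^ j)" for j
  proof -
    have "\<bar>2 ^ j * dif (u j) i - c\<bar> \<le> e + C * \<tau> ^ j" if i: "X j < i" "i \<le> Y j" for i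
    proof -
      define t :: real where "t = of_int i / 2 ^ j"
      have t: "2 ^ j * t = of_int i" by (simp add: t_def)
      \<comment> \<open>An integer above the floor of 2^j x is at least 2^j x. Hence the backward
        differences with indices in (X j, Y j] evaluate \<open>G\<close> only inside [x, y].\<close>
      have "2 ^ j * x \<le> of_int i" "of_int i \<le> 2 ^ j * y"
        using i unfolding X_def Y_def by linarith+
      then have "x \<le> t" "t \<le> y" by (simp_all add: t_def field_simps)
      then have "\<bar>G t - c\<bar> \<le> e" by (rule c)
      moreover have "\<bar>G t - 2 ^ j * dif (u j) i\<bar> \<le> C * \<tau> ^ j" using G[of t j] t by simp
      ultimately show ?thesis by linarith
    qed
    then have "\<bar>2 ^ j * (u j (Y j) - u j (X j)) - of_int (Y j - X j) * c\<bar> \<le> of_int (Y j - X j) * (e + C * \<tau> ^ j)"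
      by (rule sum_dif_close[OF XY])
    then have "\<bar>2 ^ j * (u j (Y j) - u j (X j)) - of_int (Y j - X j) * c\<bar> / 2 ^ j
        \<le> of_int (Y j - X j) * (e + C * \<tau> ^ j) / 2 ^ j"
      by (intro divide_right_mono) auto
    moreover have "\<bar>2 ^ j * (u j (Y j) - u j (X j)) - of_int (Y j - X j) * c\<bar> / 2 ^ j
        = \<bar>u j (Y j) - u j (X j) - L j * c\<bar>"
    proof -
      have "(2 ^ j * (u j (Y j) - u j (X j)) - of_int (Y j - X j) * c) / 2 ^ j
        = u j (Y j) - u j (X j) - L j * c"
        by (simp add: L_def field_simps)
      then show ?thesis by (metis abs_divide abs_numeral power_abs)
    qed
    moreover have "of_int (Y j - X j) * (e + C * \<tau> ^ j) / 2 ^ j = L j * (e + C * \<tau> ^ j)"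
      by (simp add: L_def diff_divide_distrib[symmetric])
    ultimately show ?thesis by simp
  qed
  have \<tau>0: "(\<lambda>j. C * \<tau> ^ j) \<longlonglongrightarrow> 0"
    using \<tau> by (intro tendsto_mult_right_zero LIMSEQ_power_zero) simp
  have ux: "(\<lambda>j. u j \<lfloor>2 ^ j * x\<rfloor>) \<longlonglongrightarrow> F x" for x
  proof (rule LIM_zero_cancel, rule Lim_null_comparison[OF _ \<tau>0])
    show "\<forall>\<^sub>F j in sequentially. norm (u j \<lfloor>2 ^ j * x\<rfloor> - F x) \<le> C * \<tau> ^ j"
      using F[of x] by (intro always_eventually allI) (simp add: abs_minus_commute)
  qed
  from ux[of y] ux[of x] have u: "(\<lambda>j. u j (Y j)) \<longlonglongrightarrow> F y" "(\<lambda>j. u j (X j)) \<longlonglongrightarrow> F x"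
    by (simp_all add: X_def Y_def)
  have L: "L \<longlonglongrightarrow> y - x"
    unfolding L_def X_def Y_def by (intro tendsto_diff floor_scaled_tendsto)
  have "(\<lambda>j. \<bar>u j (Y j) - u j (X j) - L j * c\<bar>) \<longlonglongrightarrow> \<bar>F y - F x - (y - x) * c\<bar>"
    by (intro tendsto_intros u L)
  moreover have "(\<lambda>j. L j * (e + C * \<tau> ^ j)) \<longlonglongrightarrow> (y - x) * (e + 0)"
    by (intro tendsto_intros L \<tau>0)
  ultimately have "\<bar>F y - F x - (y - x) * c\<bar> \<le> (y - x) * (e + 0)"
    by (rule LIMSEQ_le) (use step in blast)
  then show ?thesis by simp
qed

lemma grid_limit_deriv:
  fixes u :: "nat \<Rightarrow> int \<Rightarrow> real"
  assumes \<tau>: "0 < \<tau>" "\<tau> < 1"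
    and F: "\<And>x j. \<bar>F x - u j \<lfloor>2 ^ j * x\<rfloor>\<bar> \<le> C * \<tau> ^ j"
    and G: "\<And>x j. \<bar>G x - 2 ^ j * dif (u j) \<lfloor>2 ^ j * x\<rfloor>\<bar> \<le> C * \<tau> ^ j"
    and cont: "continuous_on UNIV G"
  shows "(F has_real_derivative G x) (at x)"
  unfolding has_field_derivative_def has_derivative_at_alt
proof (intro conjI allI impI)
  show "bounded_linear ((*) (G x))" by (rule bounded_linear_mult_right)
  fix e :: real assume "e > 0"
  have "isCont G x" using cont by (simp add: continuous_on_eq_continuous_at)
  then obtain \<delta> where \<delta>: "\<delta> > 0" "\<And>t. \<bar>t - x\<bar> < \<delta> \<Longrightarrow> \<bar>G t - G x\<bar> < e"
    using \<open>e > 0\<close> unfolding continuous_at_eps_delta by (auto simp: dist_real_def)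
  have "norm (F y - F x - G x * (y - x)) \<le> e * norm (y - x)" if "norm (y - x) < \<delta>" for y
  proof (cases "x \<le> y")
    case True
    have "\<bar>F y - F x - (y - x) * G x\<bar> \<le> (y - x) * e"
      by (rule grid_limit_increment[OF \<tau> F G True])
         (use \<delta>(2) that in \<open>auto intro!: less_imp_le\<close>)
    then show ?thesis using True by (simp add: mult.commute)
  next
    case False
    then have "\<bar>F x - F y - (x - y) * G x\<bar> \<le> (x - y) * e"
      by (intro grid_limit_increment[OF \<tau> F G])
         (use \<delta>(2) that in \<open>auto intro!: less_imp_le\<close>)
    moreover have "\<bar>F x - F y - (x - y) * G x\<bar> = \<bar>F y - F x - G x * (y - x)\<bar>"
      by (simp add: algebra_simps abs_minus_commute)
    ultimately show ?thesis using False by (simp add: mult.commute)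
  qed
  then show "\<exists>d>0. \<forall>y. norm (y - x) < d \<longrightarrow> norm (F y - F x - G x * (y - x)) \<le> e * norm (y - x)"
    using \<delta>(1) by blast
qed

lemma deriv_funpow_eq:
  assumes "\<And>i x. i < q \<Longrightarrow> (F i has_real_derivative F (Suc i) x) (at x)" "n \<le> q"
  shows "(deriv ^^ n) (F 0) = F n"
  using assms(2)
proof (induction n)
  case (Suc n)
  then have "deriv (F n) x = F (Suc n) x" for x
    using assms(1)[of n x] by (intro DERIV_imp_deriv) simp
  then show ?case using Suc by auto
qed simp

text \<open>\<open>d n j\<close> stands for the divided differences of order \<open>n\<close> at
  level \<open>j\<close>; their limit will be the derivative of order \<open>n\<close> of the limit
  of \<open>d 0\<close>.\<close>

lemma holder_class_grid_limit:
  fixes d :: "nat \<Rightarrow> nat \<Rightarrow> int \<Rightarrow> real"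
  assumes \<alpha>: "0 < \<alpha>" "\<alpha> < 1"
    and refine: "\<And>n j k. n \<le> q \<Longrightarrow> \<bar>d n (Suc j) k - d n j (k div 2)\<bar> \<le> C * (2 powr - \<alpha>) ^ j"
    and dif: "\<And>n j k. n \<le> q \<Longrightarrow> \<bar>dif (d n j) k\<bar> \<le> C * (2 powr - \<alpha>) ^ j"
    and bd: "\<And>n k. n \<le> q \<Longrightarrow> \<bar>d n 0 k\<bar> \<le> C"
    and Suc: "\<And>n j k. n < q \<Longrightarrow> d (Suc n) j k = 2 ^ j * dif (d n j) k"
  obtains f where "f \<in> holder_class (real q + \<alpha>)"
    and "\<And>x. (\<lambda>j. pl_interp j (d 0 j) x) \<longlonglongrightarrow> f x"
proof -
  define \<tau> where "\<tau> = 2 powr - \<alpha>"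
  have \<tau>: "0 < \<tau>" "\<tau> < 1" using \<alpha> by (auto simp: \<tau>_def powr_less_one)
  have C0: "C \<ge> 0" using bd[of 0 0] by linarith
  define C' where "C' = C / (1 - \<tau>)"
  have CC': "C \<le> C'"
    unfolding C'_def using C0 \<tau> by (simp add: field_simps mult_left_le)
  have "\<exists>F :: real \<Rightarrow> real. \<forall>x j. \<bar>F x - d n j \<lfloor>2 ^ j * x\<rfloor>\<bar> \<le> C' * \<tau> ^ j" if n: "n \<le> q" for n
  proof -
    obtain F :: "real \<Rightarrow> real" where "\<And>x j. \<bar>F x - d n j \<lfloor>2 ^ j * x\<rfloor>\<bar> \<le> C' * \<tau> ^ j"
      using grid_limit[of _ "d n", OF \<tau> refine[OF n, folded \<tau>_def]] unfolding C'_def by metis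
    then show ?thesis by (intro exI allI)
  qed
  then obtain F :: "nat \<Rightarrow> real \<Rightarrow> real" where F: "\<And>n x j. n \<le> q \<Longrightarrow> \<bar>F n x - d n j \<lfloor>2 ^ j * x\<rfloor>\<bar> \<le> C' * \<tau> ^ j"
    by metis
  have dif': "\<bar>dif (d n j) k\<bar> \<le> C' * \<tau> ^ j" if "n \<le> q" for n j k
  proof -
    have "C * \<tau> ^ j \<le> C' * \<tau> ^ j" using CC' \<tau> by (intro mult_right_mono) auto
    then show ?thesis using dif[OF that, of j k] unfolding \<tau>_def[symmetric] by linarith
  qed
  have hf: "F n \<in> holder_frac \<alpha>" if "n \<le> q" for n
  proof (rule holder_frac_grid_limit[OF \<alpha>, folded \<tau>_def])
    show "\<bar>F n x - d n j \<lfloor>2 ^ j * x\<rfloor>\<bar> \<le> C' * \<tau> ^ j" for x j by (rule F[OF that])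
    show "\<bar>dif (d n j) k\<bar> \<le> C' * \<tau> ^ j" for j k by (rule dif'[OF that])
    show "\<bar>d n 0 k\<bar> \<le> C'" for k using bd[OF that, of k] CC' by linarith
  qed
  have cont: "continuous_on UNIV (F n)" if "n \<le> q" for n
    using hf[OF that] \<alpha>(1) by (rule holder_frac_continuous)
  have der: "(F n has_real_derivative F (Suc n) x) (at x)" if "n < q" for n x
  proof (rule grid_limit_deriv[OF \<tau>])
    show "\<bar>F n x - d n j \<lfloor>2 ^ j * x\<rfloor>\<bar> \<le> C' * \<tau> ^ j" for x j using that by (intro F) simp
    show "\<bar>F (Suc n) x - 2 ^ j * dif (d n j) \<lfloor>2 ^ j * x\<rfloor>\<bar> \<le> C' * \<tau> ^ j" for x j
      unfolding Suc[OF that, symmetric] using that by (intro F) simp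
    show "continuous_on UNIV (F (Suc n))" using that by (intro cont) simp
  qed
  note Fn = deriv_funpow_eq[of q F, OF der]
  have "F 0 \<in> cont_diff q"
    unfolding cont_diff_def
  proof (intro CollectI conjI allI impI)
    fix i assume "i < q"
    then show "(deriv ^^ i) (F 0) differentiable_on UNIV"
      using Fn[of i] der[of i] by (auto simp: differentiable_on_def real_differentiable_def)
  qed (use Fn[of q] cont[of q] in simp)
  then have "F 0 \<in> holder_class (real q + \<alpha>)"
    using holder_class_add[OF \<alpha>] Fn[of q] hf[of q] by simp
  moreover have "(\<lambda>j. pl_interp j (d 0 j) x) \<longlonglongrightarrow> F 0 x" for x
  proof (rule LIM_zero_cancel, rule Lim_null_comparison)
    show "\<forall>\<^sub>F j in sequentially. norm (pl_interp j (d 0 j) x - F 0 x) \<le> 2 * C' * \<tau> ^ j"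
    proof (intro always_eventually allI)
      fix j
      define k where "k = \<lfloor>2 ^ j * x\<rfloor>"
      define t where "t = frac (2 ^ j * x)"
      have t: "0 \<le> t" "t \<le> 1" by (simp_all add: t_def frac_ge_0 frac_lt_1 less_imp_le)
      have "pl_interp j (d 0 j) x = d 0 j k + t * dif (d 0 j) (k + 1)"
        by (simp add: pl_interp_def k_def t_def Let_def dif_def algebra_simps)
      moreover have "\<bar>t * dif (d 0 j) (k + 1)\<bar> \<le> 1 * (C' * \<tau> ^ j)"
        unfolding abs_mult using t dif' by (intro mult_mono) auto
      moreover have "\<bar>F 0 x - d 0 j k\<bar> \<le> C' * \<tau> ^ j" unfolding k_def by (intro F) simp
      ultimately show "norm (pl_interp j (d 0 j) x - F 0 x) \<le> 2 * C' * \<tau> ^ j"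
        by (simp add: algebra_simps)
    qed
    show "(\<lambda>j. 2 * C' * \<tau> ^ j) \<longlonglongrightarrow> 0"
      using \<tau> by (intro tendsto_mult_right_zero LIMSEQ_power_zero) simp
  qed
  ultimately show thesis by (rule that)
qed

section \<open>The lower bound for the regularity\<close>

lemma supp_in_two_term:
  assumes "supp_in K c"
  shows "supp_in (K + 1) (\<lambda>k. x * c k + y * c (k - 1))"
proof (rule supp_inI)
  fix k assume "x * c k + y * c (k - 1) \<noteq> 0"
  then have "c k \<noteq> 0 \<or> c (k - 1) \<noteq> 0" by auto
  then show "\<bar>k\<bar> \<le> int (K + 1)"
    using supp_inD[OF assms, of k] supp_inD[OF assms, of "k - 1"] by auto
qed

text \<open>Differences, averages, scalar multiples and the shift by one all have this form, so a
  single computation gives the symbols of all of them.\<close>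

lemma trig_two_term:
  assumes "finsupp c"
  shows "trig (\<lambda>k. x * c k + y * c (k - 1)) \<xi> = (of_real x + of_real y * cis \<xi>) * trig c \<xi>"
proof -
  obtain K where K: "supp_in K c" using finsupp_supp_in assms by metis
  let ?A = "{- int (K + 1)..int (K + 1)}"
  have 0: "trig c \<xi> = (\<Sum>k\<in>?A. of_real (c k) * cis (of_int k * \<xi>))"
    using K by (intro trig_superset) (auto simp: supp_in_def)
  have 1: "trig c \<xi> = (\<Sum>k\<in>(\<lambda>k. k - 1) ` ?A. of_real (c k) * cis (of_int k * \<xi>))"
  proof (intro trig_superset subsetI)
    fix k assume "k \<in> {k. c k \<noteq> 0}"
    then have "\<bar>k\<bar> \<le> int K" using supp_inD[OF K] by auto
    then have "k + 1 \<in> ?A" by auto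
    then show "k \<in> (\<lambda>k. k - 1) ` ?A" by (rule rev_image_eqI) simp
  qed simp
  have "trig (\<lambda>k. x * c k + y * c (k - 1)) \<xi>
      = (\<Sum>k\<in>?A. of_real (x * c k + y * c (k - 1)) * cis (of_int k * \<xi>))"
    by (rule trig_box[OF supp_in_two_term[OF K]])
  also have "\<dots> = of_real x * (\<Sum>k\<in>?A. of_real (c k) * cis (of_int k * \<xi>))
      + of_real y * (\<Sum>k\<in>?A. of_real (c (k - 1)) * cis (of_int k * \<xi>))"
    unfolding sum_distrib_left sum.distrib[symmetric]
    by (intro sum.cong refl) (simp add: algebra_simps)
  also have "(\<Sum>k\<in>?A. of_real (c (k - 1)) * cis (of_int k * \<xi>))
      = (\<Sum>k\<in>?A. cis \<xi> * (of_real (c (k - 1)) * cis (of_int (k - 1) * \<xi>)))"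
  proof (intro sum.cong refl)
    fix k
    have "of_int k * \<xi> = \<xi> + of_int (k - 1) * \<xi>" by (simp add: algebra_simps)
    then have "cis (of_int k * \<xi>) = cis \<xi> * cis (of_int (k - 1) * \<xi>)" by (simp only: cis_mult)
    then show "of_real (c (k - 1)) * cis (of_int k * \<xi>)
      = cis \<xi> * (of_real (c (k - 1)) * cis (of_int (k - 1) * \<xi>))" by simp
  qed
  also have "\<dots> = cis \<xi> * trig c \<xi>"
    unfolding 1 by (subst sum.reindex) (auto simp: inj_on_def sum_distrib_left)
  finally show ?thesis using 0 by (simp add: distrib_right)
qed

section \<open>Difference and averaging operators\<close>

definition avg :: "(int \<Rightarrow> real) \<Rightarrow> int \<Rightarrow> real" where
  "avg u k = (u k + u (k - 1)) / 2"

lemma finsupp_two_term: "finsupp c \<Longrightarrow> finsupp (\<lambda>k. x * c k + y * c (k - 1))"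
  by (metis finsupp_supp_in supp_in_finsupp supp_in_two_term)

lemma dif_two_term: "dif u = (\<lambda>k. 1 * u k + (- 1) * u (k - 1))"
  by (simp add: dif_def fun_eq_iff)

lemma avg_two_term: "avg u = (\<lambda>k. (1 / 2) * u k + (1 / 2) * u (k - 1))"
  by (simp add: avg_def fun_eq_iff add_divide_distrib)

lemma trig_cmult: "finsupp c \<Longrightarrow> trig (\<lambda>k. x * c k) \<xi> = of_real x * trig c \<xi>"
  using trig_two_term[of c x 0] by simp

lemma finsupp_cmult: "finsupp c \<Longrightarrow> finsupp (\<lambda>k. x * c k)"
  using finsupp_two_term[of c x 0] by simp

lemma finsupp_dif_funpow: "finsupp u \<Longrightarrow> finsupp ((dif ^^ n) u)"
proof (induction n)
  case (Suc n)
  then have "finsupp (dif ((dif ^^ n) u))"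
    unfolding dif_two_term[of "(dif ^^ n) u"] by (intro finsupp_two_term)
  then show ?case by simp
qed simp

lemma finsupp_avg_funpow: "finsupp u \<Longrightarrow> finsupp ((avg ^^ n) u)"
proof (induction n)
  case (Suc n)
  then have "finsupp (avg ((avg ^^ n) u))"
    unfolding avg_two_term[of "(avg ^^ n) u"] by (intro finsupp_two_term)
  then show ?case by simp
qed simp

lemma trig_dif_funpow: "finsupp u \<Longrightarrow> trig ((dif ^^ n) u) \<xi> = (1 - cis \<xi>) ^ n * trig u \<xi>"
proof (induction n)
  case (Suc n)
  have "trig (dif ((dif ^^ n) u)) \<xi> = (1 - cis \<xi>) * trig ((dif ^^ n) u) \<xi>"
    unfolding dif_two_term[of "(dif ^^ n) u"] trig_two_term[OF finsupp_dif_funpow[OF Suc.prems]]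
    by simp
  then show ?case using Suc by simp
qed simp

lemma trig_avg_funpow: "finsupp u \<Longrightarrow> trig ((avg ^^ n) u) \<xi> = ((1 + cis \<xi>) / 2) ^ n * trig u \<xi>"
proof (induction n)
  case (Suc n)
  have "trig (avg ((avg ^^ n) u)) \<xi> = (1 + cis \<xi>) / 2 * trig ((avg ^^ n) u) \<xi>"
    unfolding avg_two_term[of "(avg ^^ n) u"] trig_two_term[OF finsupp_avg_funpow[OF Suc.prems]]
    by (simp add: field_simps)
  then show ?case using Suc by simp
qed simp

lemma finsupp_bounded:
  assumes "finsupp u"
  obtains C where "\<And>k. \<bar>u k\<bar> \<le> C"
proof
  fix k
  show "\<bar>u k\<bar> \<le> (\<Sum>l | u l \<noteq> 0. \<bar>u l\<bar>)"
  proof (cases "u k = 0")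
    case False
    then show ?thesis using assms by (intro member_le_sum) (auto simp: finsupp_def)
  qed (auto intro: sum_nonneg)
qed

text \<open>The sum is either bounded or comparable to its last term. At \<sigma> = 1 it would be j,
  which is why integer exponents are reached by a detour in
  \<open>regularity_lower_bound\<close>.\<close>

lemma geometric_partial_sum_le:
  fixes \<sigma> :: real
  assumes "\<sigma> \<ge> 0" "\<sigma> \<noteq> 1"
  shows "(\<Sum>i<j. \<sigma> ^ i) \<le> max 1 \<sigma> ^ j / \<bar>\<sigma> - 1\<bar>"
proof (cases "\<sigma> < 1")
  case True
  have "(\<Sum>i<j. \<sigma> ^ i) = (1 - \<sigma> ^ j) / (1 - \<sigma>)"
    using assms(2) by (simp add: sum_gp_strict)
  also have "\<dots> \<le> 1 / (1 - \<sigma>)" using True assms(1) by (intro divide_right_mono) auto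
  finally show ?thesis using True by simp
next
  case False
  have "(\<Sum>i<j. \<sigma> ^ i) = (\<sigma> ^ j - 1) / (\<sigma> - 1)"
    using assms(2) by (simp add: geometric_sum)
  also have "\<dots> \<le> \<sigma> ^ j / (\<sigma> - 1)" using False by (intro divide_right_mono) auto
  finally show ?thesis using False by (simp add: max_def)
qed

text \<open>The hypotheses on the unit circle z = \<open>cis \<xi>\<close>. The symmetry of
  \<open>b\<close> survives as the reality of its symbol \<open>B\<close>, and positivity as the
  uniform bound \<mu>, whose value enters the constant in \<open>energy_lower\<close>.\<close>

locale positive_scheme =
  fixes a b :: "int \<Rightarrow> real" and r p :: nat and B :: "real \<Rightarrow> real" and \<mu> :: real
  assumes fa: "finsupp a" and sb: "supp_in p b" and p: "p \<ge> 1"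
    and fac: "trig a \<xi> = (1 + cis \<xi>) ^ (r + 1) * trig b \<xi> / 2 ^ r"
    and a0: "trig a 0 = 2" and api: "trig a pi = 0"
    and B: "trig b \<xi> = of_real (B \<xi>)" and \<mu>: "\<mu> > 0" "\<mu> \<le> B \<xi>"
begin

lemma Bpos: "B \<xi> > 0"
  using \<mu> by (rule less_le_trans)

lemma fb: "finsupp b"
  using sb by (rule supp_in_finsupp)

lemma trig_b0: "trig b 0 = 1"
  using fac[of 0] a0 by (simp add: field_simps)

abbreviation b_iter :: "nat \<Rightarrow> int \<Rightarrow> real" where
  "b_iter m \<equiv> subdiv b delta m"

lemma trig_b_iter: "trig (b_iter m) \<xi> = of_real (\<Prod>t<m. B (2 ^ t * \<xi>))"
proof (induction m arbitrary: \<xi>)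
  case (Suc m)
  have "(\<Prod>t<Suc m. B (2 ^ t * \<xi>)) = B \<xi> * (\<Prod>t<m. B (2 ^ t * (2 * \<xi>)))"
    unfolding prod.lessThan_Suc_shift by (simp add: mult_ac)
  then show ?case using trig_subdiv_Suc[OF fb finsupp_delta] Suc B by simp
qed simp

lemma abs_b_iter_le: "\<bar>b_iter m k\<bar> \<le> b_iter m 0"
  by (rule nonneg_trig_coeff_le[OF finsupp_subdiv[OF fb finsupp_delta] trig_b_iter])
     (simp add: prod_nonneg Bpos less_imp_le)

abbreviation \<rho> :: real where "\<rho> \<equiv> spectral_radius (subdiv_matrix p b)"

lemma subdiv_matrix_carrier: "subdiv_matrix p b \<in> carrier_mat (2 * p - 1) (2 * p - 1)"
  by (simp add: subdiv_matrix_def)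

lemma b_iter_lower: "\<rho> ^ m \<le> real (2 * p - 1) * b_iter m 0"
  by (rule spectral_radius_pow_le[OF subdiv_matrix_carrier])
     (use p abs_b_iter_le in \<open>simp_all add: subdiv_matrix_pow[OF sb p] del: of_nat_diff\<close>)

lemma b_iter_upper:
  assumes "\<rho> < \<gamma>" "\<gamma> > 0"
  obtains C where "\<And>m. b_iter m 0 \<le> C * \<gamma> ^ m"
proof -
  have n: "0 < 2 * p - 1" using p by simp
  obtain C where C: "\<And>m i j. i < 2 * p - 1 \<Longrightarrow> j < 2 * p - 1 \<Longrightarrow>
      norm ((subdiv_matrix p b ^\<^sub>m m) $$ (i, j)) \<le> C * \<gamma> ^ m"
    using spectral_radius_power_bound[OF subdiv_matrix_carrier n assms] by blast
  have "b_iter m 0 \<le> C * \<gamma> ^ m" for m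
  proof -
    \<comment> \<open>The matrix index \<open>p - 1\<close> stands for 0, so this diagonal entry is
      \<open>b_iter m 0\<close>.\<close>
    have i: "p - 1 < 2 * p - 1" "int (p - 1) - int p + 1 = 0" using p by auto
    show ?thesis using C[OF i(1) i(1), of m] subdiv_matrix_pow[OF sb p i(1) i(1), of m] i(2) by simp
  qed
  then show thesis by (rule that)
qed

lemma subdiv_bound:
  assumes "finsupp g"
  shows "\<bar>subdiv b g m k\<bar> \<le> (\<Sum>l | g l \<noteq> 0. \<bar>g l\<bar>) * b_iter m 0"
proof -
  have "\<bar>subdiv b g m k\<bar> \<le> (\<Sum>l | g l \<noteq> 0. \<bar>b_iter m (k - 2 ^ m * l) * g l\<bar>)"
    unfolding subdiv_superposition[OF assms] upconv_def by (rule sum_abs)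
  also have "\<dots> \<le> (\<Sum>l | g l \<noteq> 0. b_iter m 0 * \<bar>g l\<bar>)"
    unfolding abs_mult by (intro sum_mono mult_right_mono abs_b_iter_le) auto
  finally show ?thesis by (simp add: sum_distrib_left mult_ac)
qed

text \<open>On symbols: 1 - z^2 = (1 - z)(1 + z), so moving the differences through one step uses up
  the factor (1 + z)^(r + 1) of the mask and leaves b(z) / 2^r.\<close>

lemma dif_subdiv:
  assumes f: "finsupp f"
  shows "2 ^ (r * j) * (dif ^^ (r + 1)) (subdiv a f j) k = subdiv b ((dif ^^ (r + 1)) f) j k"
proof -
  have "(\<lambda>k. 2 ^ (r * j) * (dif ^^ (r + 1)) (subdiv a f j) k) = subdiv b ((dif ^^ (r + 1)) f) j"
  proof (rule trig_inject)
    show "finsupp (\<lambda>k. 2 ^ (r * j) * (dif ^^ (r + 1)) (subdiv a f j) k)"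
      by (intro finsupp_cmult finsupp_dif_funpow finsupp_subdiv fa f)
    show "finsupp (subdiv b ((dif ^^ (r + 1)) f) j)"
      by (intro finsupp_subdiv finsupp_dif_funpow fb f)
    fix \<xi>
    have "2 ^ (r * j) * (1 - cis \<xi>) ^ (r + 1) * trig (subdiv a f j) \<xi>
       = trig (subdiv b ((dif ^^ (r + 1)) f) j) \<xi>" for \<xi>
    proof (induction j arbitrary: \<xi>)
      case 0
      then show ?case using trig_dif_funpow[OF f, of "r + 1"] by simp
    next
      case (Suc j)
      have cis2: "cis (2 * \<xi>) = cis \<xi> * cis \<xi>" by (simp add: cis_mult)
      have split: "(1 - cis (2 * \<xi>)) ^ (r + 1) = (1 - cis \<xi>) ^ (r + 1) * (1 + cis \<xi>) ^ (r + 1)"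
        unfolding power_mult_distrib[symmetric] cis2 by (simp add: algebra_simps)
      have "trig (subdiv b ((dif ^^ (r + 1)) f) (Suc j)) \<xi>
        = trig b \<xi> * (2 ^ (r * j) * (1 - cis (2 * \<xi>)) ^ (r + 1) * trig (subdiv a f j) (2 * \<xi>))"
        by (simp only: Suc trig_subdiv_Suc[OF fb finsupp_dif_funpow[OF f]])
      also have "\<dots> = 2 ^ (r * Suc j) * (1 - cis \<xi>) ^ (r + 1) * (trig a \<xi> * trig (subdiv a f j) (2 * \<xi>))"
        unfolding split fac by (simp add: power_add mult_ac del: power_Suc)
      finally show ?case by (simp only: trig_subdiv_Suc[OF fa f])
    qed
    then show "trig (\<lambda>k. 2 ^ (r * j) * (dif ^^ (r + 1)) (subdiv a f j) k) \<xi>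
        = trig (subdiv b ((dif ^^ (r + 1)) f) j) \<xi>"
      by (simp add: trig_cmult finsupp_dif_funpow finsupp_subdiv fa f trig_dif_funpow mult_ac
          del: funpow.simps power_Suc)
  qed
  then show ?thesis by (rule fun_cong)
qed

text \<open>The difference quotient of order \<open>n\<close> at mesh width 2^(-j), a discrete
  derivative of the data of level \<open>j\<close>.\<close>

definition divided_dif :: "(int \<Rightarrow> real) \<Rightarrow> nat \<Rightarrow> nat \<Rightarrow> int \<Rightarrow> real" where
  "divided_dif f n j k = 2 ^ (n * j) * (dif ^^ n) (subdiv a f j) k"

text \<open>The mask of the derived scheme of order \<open>n\<close>. As a(z) = 2 ((1 + z) / 2)^(r +
  1) b(z), every order removes one factor (1 + z) / 2, down to 2 b(z) at order r + 1.\<close>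

definition divided_mask :: "nat \<Rightarrow> int \<Rightarrow> real" where
  "divided_mask n k = 2 * (avg ^^ (r + 1 - n)) b k"

lemma divided_mask: "finsupp (divided_mask n)" "trig (divided_mask n) \<xi> = 2 * ((1 + cis \<xi>) / 2) ^ (r + 1 - n) * trig b \<xi>"
  unfolding divided_mask_def
  by (simp_all add: finsupp_cmult trig_cmult finsupp_avg_funpow fb trig_avg_funpow)

lemma finsupp_divided_dif: "finsupp f \<Longrightarrow> finsupp (divided_dif f n j)"
  unfolding divided_dif_def by (intro finsupp_cmult finsupp_dif_funpow finsupp_subdiv fa)

lemma trig_divided_dif: "finsupp f \<Longrightarrow> trig (divided_dif f n j) \<xi> = 2 ^ (n * j) * (1 - cis \<xi>) ^ n * trig (subdiv a f j) \<xi>"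
  unfolding divided_dif_def by (simp add: trig_cmult finsupp_dif_funpow finsupp_subdiv fa trig_dif_funpow)

lemma divided_dif_Suc_level:
  assumes f: "finsupp f" and n: "n \<le> r + 1"
  shows "divided_dif f n (Suc j) = subdiv_step (divided_mask n) (divided_dif f n j)"
proof (rule trig_inject)
  show "finsupp (divided_dif f n (Suc j))" by (rule finsupp_divided_dif[OF f])
  show "finsupp (subdiv_step (divided_mask n) (divided_dif f n j))"
    by (simp add: subdiv_step_eq_upconv finsupp_upconv divided_mask finsupp_divided_dif f)
  fix \<xi>
  have cis2: "cis (2 * \<xi>) = cis \<xi> * cis \<xi>" by (simp add: cis_mult)
  have split: "(1 - cis (2 * \<xi>)) ^ n = (1 - cis \<xi>) ^ n * (1 + cis \<xi>) ^ n"
    unfolding power_mult_distrib[symmetric] cis2 by (simp add: algebra_simps)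
  have e: "(1 + cis \<xi>) ^ (r + 1) = (1 + cis \<xi>) ^ (r + 1 - n) * (1 + cis \<xi>) ^ n"
    "(2::complex) ^ (r + 1) = 2 ^ (r + 1 - n) * 2 ^ n"
    unfolding power_add[symmetric] using n by simp_all
  have A: "trig a \<xi> = 2 * ((1 + cis \<xi>) ^ (r + 1 - n) * (1 + cis \<xi>) ^ n / (2 ^ (r + 1 - n) * 2 ^ n)) * trig b \<xi>"
    unfolding fac e[symmetric] by simp
  show "trig (divided_dif f n (Suc j)) \<xi> = trig (subdiv_step (divided_mask n) (divided_dif f n j)) \<xi>"
    unfolding subdiv_step_eq_upconv[OF divided_mask(1) finsupp_divided_dif[OF f]] trig_upconv[OF divided_mask(1) finsupp_divided_dif[OF f]]
      trig_divided_dif[OF f] divided_mask(2) trig_subdiv_Suc[OF fa f] A of_int_numeral split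
    by (simp add: power_divide power_add field_simps)
qed

lemma dif_divided_dif: "dif (divided_dif f n j) k = divided_dif f (Suc n) j k / 2 ^ j"
  by (simp add: divided_dif_def dif_def power_add diff_divide_distrib right_diff_distrib)

text \<open>Up to order r the derived mask retains a factor 1 + z and has the value 2 at z = 1, so
  it obeys the sum rules and \<open>subdiv_step_close\<close> applies. The differences of these
  quotients are those of the next order times the mesh width.\<close>

lemma divided_dif_close:
  assumes f: "finsupp f" and n: "n \<le> r"
  obtains C where "C \<ge> 0" and "\<And>j G k. (\<And>k. \<bar>divided_dif f (Suc n) j k\<bar> \<le> G) \<Longrightarrow>
      \<bar>divided_dif f n (Suc j) k - divided_dif f n j (k div 2)\<bar> \<le> C * (G / 2 ^ j)"
proof -
  have m: "trig (divided_mask n) 0 = 2" "trig (divided_mask n) pi = 0"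
    using n by (simp_all add: divided_mask trig_b0)
  obtain C where C: "C \<ge> 0" "\<And>u G k. (\<And>k. \<bar>dif u k\<bar> \<le> G) \<Longrightarrow>
      \<bar>subdiv_step (divided_mask n) u k - u (k div 2)\<bar> \<le> C * G"
    using subdiv_step_close[OF divided_mask(1) m] by metis
  have "\<bar>divided_dif f n (Suc j) k - divided_dif f n j (k div 2)\<bar> \<le> C * (G / 2 ^ j)"
    if "\<And>k. \<bar>divided_dif f (Suc n) j k\<bar> \<le> G" for j G k
  proof -
    have "\<bar>dif (divided_dif f n j) k\<bar> \<le> G / 2 ^ j" for k
      using that[of k] by (simp add: dif_divided_dif divide_right_mono)
    from C(2)[OF this] show ?thesis using n by (simp add: divided_dif_Suc_level[OF f])
  qed
  with C(1) show thesis by (rule that)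
qed

text \<open>Descending induction on the order \<open>n\<close>: the recursion for the differences of order \<open>n\<close> has
  ratio \<open>2 powr (n - \<beta>)\<close>, which never hits the resonant value 1 because \<open>\<beta>\<close> is not an integer.\<close>

lemma divided_dif_bound:
  assumes f: "finsupp f" and \<beta>: "\<rho> < 2 powr (real r - \<beta>)" "\<beta> \<notin> \<int>" and n: "n \<le> r + 1"
    and \<beta>r: "\<beta> < real r + 1"
  shows "\<exists>C. \<forall>j k. \<bar>divided_dif f n j k\<bar> \<le> C * (2 powr max 0 (real n - \<beta>)) ^ j"
  using n
proof (induction n rule: inc_induct)
  case base
  let ?g = "(dif ^^ (r + 1)) f"
  obtain C where C: "\<And>m. b_iter m 0 \<le> C * (2 powr (real r - \<beta>)) ^ m"
    using b_iter_upper[OF \<beta>(1)] by auto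
  let ?S = "\<Sum>l | ?g l \<noteq> 0. \<bar>?g l\<bar>"
  have "\<bar>divided_dif f (r + 1) j k\<bar> \<le> (?S * C) * (2 powr max 0 (real (r + 1) - \<beta>)) ^ j" for j k
  proof -
    have "divided_dif f (r + 1) j k = 2 ^ j * subdiv b ?g j k"
      unfolding dif_subdiv[OF f, symmetric] divided_dif_def by (simp add: power_add)
    then have "\<bar>divided_dif f (r + 1) j k\<bar> = 2 ^ j * \<bar>subdiv b ?g j k\<bar>" by (simp add: abs_mult)
    also have "\<dots> \<le> 2 ^ j * (?S * (C * (2 powr (real r - \<beta>)) ^ j))"
      by (intro mult_left_mono order_trans[OF subdiv_bound[OF finsupp_dif_funpow[OF f]]] C sum_nonneg) auto
    also have "\<dots> = (?S * C) * (2 * 2 powr (real r - \<beta>)) ^ j"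
      by (simp add: power_mult_distrib)
    also have "2 * 2 powr (real r - \<beta>) = 2 powr max 0 (real (r + 1) - \<beta>)"
      using \<beta>r by (simp add: powr_add[symmetric] powr_mult_base max_def algebra_simps)
    finally show ?thesis .
  qed
  then show ?case by blast
next
  case (step n)
  then obtain C where C: "\<And>j k. \<bar>divided_dif f (Suc n) j k\<bar> \<le> C * (2 powr max 0 (real (Suc n) - \<beta>)) ^ j"
    by blast
  have "n \<le> r" using step by simp
  then obtain D where D: "D \<ge> 0" "\<And>j G k. (\<And>k. \<bar>divided_dif f (Suc n) j k\<bar> \<le> G) \<Longrightarrow>
      \<bar>divided_dif f n (Suc j) k - divided_dif f n j (k div 2)\<bar> \<le> D * (G / 2 ^ j)"
    using divided_dif_close[OF f] by metis
  obtain C0 where C0: "\<And>k. \<bar>divided_dif f n 0 k\<bar> \<le> C0" using finsupp_bounded finsupp_divided_dif[OF f] by metis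
  \<comment> \<open>The ratio of the increments from level to level: the growth factor of order n +
    1, halved by the mesh width.\<close>
  define \<sigma> where "\<sigma> = 2 powr max (- 1) (real n - \<beta>)"
  have \<sigma>: "(2 powr max 0 (real (Suc n) - \<beta>)) ^ j / 2 ^ j = \<sigma> ^ j" for j
  proof -
    have "2 powr max 0 (real (Suc n) - \<beta>) / 2 = 2 powr (max 0 (real (Suc n) - \<beta>) - 1)"
      by (simp add: powr_diff)
    also have "max 0 (real (Suc n) - \<beta>) - 1 = max (- 1) (real n - \<beta>)" by (simp add: max_def)
    finally show ?thesis unfolding \<sigma>_def by (simp add: power_divide[symmetric])
  qed
  have "\<beta> \<noteq> real n" using \<beta>(2) by auto
  then have "\<sigma> \<noteq> 1" unfolding \<sigma>_def by (auto simp: powr_def max_def)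
  have "\<sigma> \<ge> 0" by (simp add: \<sigma>_def)
  have T: "max 1 \<sigma> = 2 powr max 0 (real n - \<beta>)"
  proof (cases "real n - \<beta> \<ge> 0")
    case True
    then show ?thesis by (simp add: \<sigma>_def max_def ge_one_powr_ge_zero)
  next
    case False
    then have "\<sigma> \<le> 2 powr 0" unfolding \<sigma>_def by (intro powr_mono) auto
    then show ?thesis using False by (simp add: max_def)
  qed
  have "C \<ge> 0" using C[of 0 0] by simp
  have "C0 \<ge> 0" using C0[of 0] by linarith
  have sum: "\<bar>divided_dif f n j k\<bar> \<le> C0 + D * C * (\<Sum>i<j. \<sigma> ^ i)" for j k
  proof (induction j arbitrary: k)
    case (Suc j)
    have "\<bar>divided_dif f n (Suc j) k - divided_dif f n j (k div 2)\<bar> \<le> D * (C * (2 powr max 0 (real (Suc n) - \<beta>)) ^ j / 2 ^ j)"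
      by (rule D(2)[OF C])
    also have "\<dots> = D * C * \<sigma> ^ j" by (simp flip: \<sigma>)
    finally show ?case using Suc[of "k div 2"] by (simp add: algebra_simps)
  qed (use C0 in simp)
  let ?E = "C0 + D * C / \<bar>\<sigma> - 1\<bar>"
  have "\<bar>divided_dif f n j k\<bar> \<le> ?E * max 1 \<sigma> ^ j" for j k
  proof -
    have "D * C * (\<Sum>i<j. \<sigma> ^ i) \<le> D * C * (max 1 \<sigma> ^ j / \<bar>\<sigma> - 1\<bar>)"
      using D(1) \<open>C \<ge> 0\<close> \<open>\<sigma> \<ge> 0\<close> \<open>\<sigma> \<noteq> 1\<close> by (intro mult_left_mono geometric_partial_sum_le) auto
    moreover have "C0 * 1 \<le> C0 * max 1 \<sigma> ^ j"
      using \<open>C0 \<ge> 0\<close> by (intro mult_left_mono one_le_power) auto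
    ultimately show ?thesis using sum[of j k] by (simp add: algebra_simps)
  qed
  then show ?case unfolding T by blast
qed

lemma regularity_lower_bound_nonint:
  assumes \<beta>: "real q < \<beta>" "\<beta> < real q + 1" and q: "q \<le> r"
    and \<rho>\<beta>: "\<rho> < 2 powr (real r - \<beta>)" and f: "finsupp f"
  shows "\<exists>g. is_limit_function a f g \<and> g \<in> holder_class \<beta>"
proof -
  define \<alpha> where "\<alpha> = \<beta> - real q"
  have \<alpha>: "0 < \<alpha>" "\<alpha> < 1" using \<beta> by (auto simp: \<alpha>_def)
  have "\<beta> \<notin> \<int>"
  proof
    assume "\<beta> \<in> \<int>"
    then obtain i where "\<beta> = of_int i" by (rule Ints_cases)
    then have "int q < i" "i < int q + 1" using \<beta> by linarith+
    then show False by simp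
  qed
  have \<beta>r: "\<beta> < real r + 1" using \<beta> q by linarith
  define \<tau> where "\<tau> = 2 powr - \<alpha>"
  have "\<exists>C. \<forall>j k. \<bar>divided_dif f n 0 k\<bar> \<le> C \<and> \<bar>dif (divided_dif f n j) k\<bar> \<le> C * \<tau> ^ j \<and>
      \<bar>divided_dif f n (Suc j) k - divided_dif f n j (k div 2)\<bar> \<le> C * \<tau> ^ j" if n: "n \<le> q" for n
  proof -
    have nr: "n \<le> r" "Suc n \<le> r + 1" using n q by auto
    obtain C where C: "\<And>j k. \<bar>divided_dif f (Suc n) j k\<bar> \<le> C * (2 powr max 0 (real (Suc n) - \<beta>)) ^ j"
      using divided_dif_bound[OF f \<rho>\<beta> \<open>\<beta> \<notin> \<int>\<close> nr(2) \<beta>r] by blast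
    obtain D where D: "D \<ge> 0" "\<And>j G k. (\<And>k. \<bar>divided_dif f (Suc n) j k\<bar> \<le> G) \<Longrightarrow>
        \<bar>divided_dif f n (Suc j) k - divided_dif f n j (k div 2)\<bar> \<le> D * (G / 2 ^ j)"
      using divided_dif_close[OF f nr(1)] by metis
    obtain C0 where C0: "\<And>k. \<bar>divided_dif f n 0 k\<bar> \<le> C0" using finsupp_bounded finsupp_divided_dif[OF f] by metis
    have "C \<ge> 0" using C[of 0 0] by simp
    \<comment> \<open>For n < q the order n + 1 is bounded and the ratio is 1/2. For n = q it is 2
      powr (q - \<beta>) = \<tau>, the slower decay, which therefore serves for all orders.\<close>
    have \<sigma>: "(2 powr max 0 (real (Suc n) - \<beta>)) ^ j / 2 ^ j \<le> \<tau> ^ j" for j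
    proof -
      have "2 powr max 0 (real (Suc n) - \<beta>) / 2 = 2 powr (max 0 (real (Suc n) - \<beta>) - 1)"
        by (simp add: powr_diff)
      also have "\<dots> \<le> \<tau>"
        unfolding \<tau>_def using n \<alpha> by (intro powr_mono) (auto simp: \<alpha>_def max_def)
      finally show ?thesis unfolding power_divide[symmetric] by (intro power_mono) auto
    qed
    have G: "C * (2 powr max 0 (real (Suc n) - \<beta>)) ^ j / 2 ^ j \<le> C * \<tau> ^ j" for j
      using mult_left_mono[OF \<sigma>[of j] \<open>C \<ge> 0\<close>] by simp
    have 1: "\<bar>dif (divided_dif f n j) k\<bar> \<le> C * \<tau> ^ j" for j k
    proof -
      have "\<bar>dif (divided_dif f n j) k\<bar> \<le> C * (2 powr max 0 (real (Suc n) - \<beta>)) ^ j / 2 ^ j"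
        using C[of j k] by (simp add: dif_divided_dif divide_right_mono)
      then show ?thesis using G[of j] by linarith
    qed
    have 2: "\<bar>divided_dif f n (Suc j) k - divided_dif f n j (k div 2)\<bar> \<le> D * C * \<tau> ^ j" for j k
      using D(2)[of j _ k, OF C] mult_left_mono[OF G[of j] D(1)] by (simp add: mult.assoc)
    have t: "\<tau> ^ j \<ge> 0" for j by (simp add: \<tau>_def)
    define M where "M = max C0 (max C (D * C))"
    have "C * \<tau> ^ j \<le> M * \<tau> ^ j" "D * C * \<tau> ^ j \<le> M * \<tau> ^ j" "C0 \<le> M" for j
      unfolding M_def using t[of j] by (auto intro!: mult_right_mono)
    then show ?thesis using 1 2 C0 by (meson order_trans)
  qed
  then obtain c where c: "\<And>n j k. n \<le> q \<Longrightarrow> \<bar>divided_dif f n 0 k\<bar> \<le> c n \<and> \<bar>dif (divided_dif f n j) k\<bar> \<le> c n * \<tau> ^ j \<and>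
      \<bar>divided_dif f n (Suc j) k - divided_dif f n j (k div 2)\<bar> \<le> c n * \<tau> ^ j" by metis
  define C where "C = Max (c ` {..q})"
  have cC: "c n \<le> C" if "n \<le> q" for n unfolding C_def using that by (intro Max_ge) auto
  have t: "c n * \<tau> ^ j \<le> C * \<tau> ^ j" if "n \<le> q" for n j
    using cC[OF that] by (intro mult_right_mono) (auto simp: \<tau>_def)
  obtain g where g: "g \<in> holder_class (real q + \<alpha>)" "\<And>x. (\<lambda>j. pl_interp j (divided_dif f 0 j) x) \<longlonglongrightarrow> g x"
  proof (rule holder_class_grid_limit[OF \<alpha>, folded \<tau>_def])
    show "\<bar>divided_dif f n (Suc j) k - divided_dif f n j (k div 2)\<bar> \<le> C * \<tau> ^ j" if "n \<le> q" for n j k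
      using c[OF that, of k j] t[OF that, of j] by linarith
    show "\<bar>dif (divided_dif f n j) k\<bar> \<le> C * \<tau> ^ j" if "n \<le> q" for n j k
      using c[OF that, of k j] t[OF that, of j] by linarith
    show "\<bar>divided_dif f n 0 k\<bar> \<le> C" if "n \<le> q" for n k
      using c[OF that, of k 0] cC[OF that] by linarith
    show "divided_dif f (Suc n) j k = 2 ^ j * dif (divided_dif f n j) k" for n j k
      by (simp add: dif_divided_dif)
  qed blast
  have "divided_dif f 0 j = subdiv a f j" for j by (simp add: divided_dif_def fun_eq_iff)
  then have "is_limit_function a f g" using g(2) by (simp add: is_limit_function_def)
  then show ?thesis using g(1) by (auto simp: \<alpha>_def)
qed

lemma regularity_lower_bound:
  assumes \<beta>: "0 \<le> \<beta>" "\<beta> < real r - log 2 \<rho>" and \<rho>: "\<rho> \<ge> 1 / 2" and f: "finsupp f"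
  shows "\<exists>g. is_limit_function a f g \<and> g \<in> holder_class \<beta>"
proof -
  define q where "q = nat \<lfloor>\<beta>\<rfloor>"
  have q: "real q \<le> \<beta>" "\<beta> < real q + 1" using \<beta>(1) unfolding q_def by linarith+
  \<comment> \<open>From \<rho> \<ge> 1/2 the critical exponent is at most r + 1. Hence q \<le> r,
    and the derived schemes of all orders up to q obey the sum rules.\<close>
  have "log 2 (1 / 2) \<le> log 2 \<rho>" using \<rho> by (subst log_le_cancel_iff) auto
  then have "\<beta> < real r + 1" using \<beta>(2) by (simp add: log_divide)
  then have "q \<le> r" using q by linarith
  have lt: "\<rho> < 2 powr (real r - x)" if "x < real r - log 2 \<rho>" for x
  proof -
    have "\<rho> = 2 powr log 2 \<rho>" using \<rho> by simp
    also have "\<dots> < 2 powr (real r - x)" using that by (intro powr_less_mono) auto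
    finally show ?thesis .
  qed
  show ?thesis
  proof (cases "\<beta> = real q")
    case False
    then show ?thesis
      using q \<open>q \<le> r\<close> lt[OF \<beta>(2)] f by (intro regularity_lower_bound_nonint) auto
  next
    case True
    \<comment> \<open>An integer exponent is the resonant case. A slightly larger one, still below
      the critical value, lies strictly between q and q + 1 and gives more than is asked.\<close>
    define \<beta>' where "\<beta>' = \<beta> + min (1 / 2) ((real r - log 2 \<rho> - \<beta>) / 2)"
    have \<beta>': "real q < \<beta>'" "\<beta>' < real q + 1" "\<beta>' < real r - log 2 \<rho>"
      using \<beta>(2) True by (auto simp: \<beta>'_def min_def field_simps)
    obtain g where g: "is_limit_function a f g" "g \<in> holder_class \<beta>'"
      using regularity_lower_bound_nonint[OF \<beta>'(1,2) \<open>q \<le> r\<close> lt[OF \<beta>'(3)] f] by blast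
    have "\<lfloor>\<beta>'\<rfloor> = int q" using \<beta>' by (simp add: floor_eq_iff)
    then have "g \<in> cont_diff q" using g(2) by (simp add: holder_class_def)
    then show ?thesis using g(1) True by (auto simp: holder_class_of_nat)
  qed
qed

end

section \<open>Optimality\<close>

text \<open>At level J + n the point i / 2^J is the grid point with index 2^n i, where the
  interpolant takes the value of the data.\<close>

lemma limit_function_dyadic:
  assumes "is_limit_function a f g"
  shows "(\<lambda>n. subdiv a f (J + n) (2 ^ n * i)) \<longlonglongrightarrow> g (of_int i / 2 ^ J)"
proof -
  have "pl_interp (n + J) h (of_int i / 2 ^ J) = h (2 ^ n * i)" for n h
  proof -
    have "of_int i / 2 ^ J = (of_int (2 ^ n * i) + 0) / (2 ^ (n + J) :: real)"
      by (simp add: power_add)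
    then show ?thesis using pl_interp_affine[of 0 "n + J" h "2 ^ n * i"] by simp
  qed
  moreover have "(\<lambda>n. pl_interp (n + J) (subdiv a f (n + J)) (of_int i / 2 ^ J)) \<longlonglongrightarrow> g (of_int i / 2 ^ J)"
    using assms unfolding is_limit_function_def by (intro LIMSEQ_ignore_initial_segment) blast
  ultimately show ?thesis by (simp add: add.commute)
qed

definition samples :: "(real \<Rightarrow> real) \<Rightarrow> nat \<Rightarrow> int \<Rightarrow> real" where
  "samples g J i = g (of_int i / 2 ^ J)"

lemma upconv_superset:
  assumes "finite A" "{l. u l \<noteq> 0} \<subseteq> A"
  shows "upconv N c u k = (\<Sum>l\<in>A. c (k - N * l) * u l)"
  unfolding upconv_def using assms by (intro sum.mono_neutral_left) auto

text \<open>The representation g(x) = \<Sum>l. u l * \<phi>(2^m x - l) with u the data of level m,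
  restricted to the grid of mesh 2^(-(m + J)).\<close>

lemma samples_refine:
  assumes \<phi>: "is_limit_function a delta \<phi>" and g: "is_limit_function a f g"
    and f: "finsupp f" and a: "finsupp a"
  shows "samples g (m + J) = upconv (2 ^ J) (samples \<phi> J) (subdiv a f m)"
proof
  fix i
  let ?f = "subdiv a f m"
  have "subdiv a f (m + J + n) (2 ^ n * i)
      = (\<Sum>l | ?f l \<noteq> 0. subdiv a delta (J + n) (2 ^ n * (i - 2 ^ J * l)) * ?f l)" for n
    unfolding add.assoc subdiv_add[of a f m] subdiv_superposition[OF finsupp_subdiv[OF a f]] upconv_def
    by (simp add: power_add algebra_simps)
  then have "(\<lambda>n. subdiv a f (m + J + n) (2 ^ n * i))
      \<longlonglongrightarrow> (\<Sum>l | ?f l \<noteq> 0. samples \<phi> J (i - 2 ^ J * l) * ?f l)"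
    unfolding samples_def by (simp only:) (intro tendsto_sum tendsto_mult tendsto_const limit_function_dyadic[OF \<phi>])
  moreover have "(\<lambda>n. subdiv a f (m + J + n) (2 ^ n * i)) \<longlonglongrightarrow> samples g (m + J) i"
    unfolding samples_def by (rule limit_function_dyadic[OF g])
  ultimately show "samples g (m + J) i = upconv (2 ^ J) (samples \<phi> J) ?f i"
    unfolding upconv_def by (rule LIMSEQ_unique[rotated])
qed

lemma supp_in_samples:
  assumes \<phi>: "is_limit_function a delta \<phi>" and a: "supp_in K a"
  shows "supp_in (K * 2 ^ J) (samples \<phi> J)"
proof (rule supp_inI, rule ccontr)
  fix i assume "samples \<phi> J i \<noteq> 0" and i: "\<not> \<bar>i\<bar> \<le> int (K * 2 ^ J)"
  have "subdiv a delta (J + n) (2 ^ n * i) = 0" for n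
  proof (rule ccontr)
    assume "subdiv a delta (J + n) (2 ^ n * i) \<noteq> 0"
    from supp_in_subdiv_delta[OF a this]
    have "2 ^ n * \<bar>i\<bar> \<le> int K * (2 ^ (J + n) - 1)" by (simp add: abs_mult)
    also have "\<dots> \<le> 2 ^ n * int (K * 2 ^ J)" by (simp add: power_add algebra_simps)
    finally show False using i by simp
  qed
  then have "(\<lambda>n. 0) \<longlonglongrightarrow> samples \<phi> J i"
    using limit_function_dyadic[OF \<phi>, of J i] by (simp add: samples_def)
  then show False using \<open>samples \<phi> J i \<noteq> 0\<close> LIMSEQ_const_iff by metis
qed

text \<open>The values of \<phi> at the integers sum to 1: constants are reproduced, and by locality
  the impulses at \<bar>l\<bar> \<le> K already act like the constant 1 at index 0.\<close>

lemma trig_samples_0: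
  assumes \<phi>: "is_limit_function a delta \<phi>" and a: "finsupp a" "trig a 0 = 2" "trig a pi = 0"
  shows "trig (samples \<phi> 0) 0 = 1"
proof -
  obtain K where K: "supp_in K a" using finsupp_supp_in a(1) by metis
  let ?A = "{- int K..int K}"
  have "(\<Sum>l\<in>?A. subdiv a delta n (2 ^ n * l)) = 1" for n
  proof -
    let ?box = "\<lambda>k. \<Sum>l\<in>?A. 1 * delta (k - l)"
    have "(\<Sum>l\<in>?A. subdiv a delta n (2 ^ n * l)) = (\<Sum>l\<in>?A. subdiv a delta n (0 - 2 ^ n * l))"
      by (rule sum.reindex_bij_witness[of _ uminus uminus]) auto
    also have "\<dots> = subdiv a ?box n 0"
      unfolding subdiv_sum subdiv_shift by simp
    also have "\<dots> = subdiv a (\<lambda>_. 1) n 0"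
    proof (rule subdiv_local[OF K])
      fix l assume "\<bar>0 - 2 ^ n * l\<bar> \<le> int K * (2 ^ n - 1)"
      then have "2 ^ n * \<bar>l\<bar> \<le> int K * (2 ^ n - 1)" by (simp add: abs_mult)
      also have "\<dots> \<le> 2 ^ n * int K" by (simp add: algebra_simps)
      finally have "\<bar>l\<bar> \<le> int K" by simp
      then have l: "l \<in> ?A" by auto
      have "?box l = (\<Sum>i\<in>?A. if i = l then 1 else 0)"
        by (intro sum.cong) (auto simp: delta_def)
      then show "?box l = 1" using l by simp
    qed
    also have "\<dots> = 1" by (simp add: subdiv_const a)
    finally show ?thesis .
  qed
  moreover have "(\<lambda>n. \<Sum>l\<in>?A. subdiv a delta (0 + n) (2 ^ n * l)) \<longlonglongrightarrow> (\<Sum>l\<in>?A. samples \<phi> 0 l)"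
    unfolding samples_def by (intro tendsto_sum limit_function_dyadic[OF \<phi>])
  ultimately have "(\<Sum>l\<in>?A. samples \<phi> 0 l) = 1"
    by (simp add: LIMSEQ_const_iff)
  moreover have "trig (samples \<phi> 0) 0 = of_real (\<Sum>l\<in>?A. samples \<phi> 0 l)"
    using trig_box[of K "samples \<phi> 0" 0] supp_in_samples[OF \<phi> K, of 0] by simp
  ultimately show ?thesis by simp
qed

section \<open>Backward differences of smooth functions and of samples\<close>

definition rdif :: "real \<Rightarrow> (real \<Rightarrow> real) \<Rightarrow> real \<Rightarrow> real" where
  "rdif h g x = g x - g (x - h)"

lemma rdif_mvt:
  assumes "h > 0" and D: "\<And>i x. i < q \<Longrightarrow> (D i has_real_derivative D (Suc i) x) (at x)"
  shows "\<exists>\<xi>. x - real q * h \<le> \<xi> \<and> \<xi> \<le> x \<and> (rdif h ^^ q) (D 0) x = h ^ q * D q \<xi>"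
  using D
proof (induction q arbitrary: D)
  case (Suc q)
  define D' where "D' i = rdif h (D i)" for i
  have "(D' i has_real_derivative D' (Suc i) x) (at x)" if "i < q" for i x
  proof -
    have "((\<lambda>z. D i (z - h)) has_real_derivative D (Suc i) (x - h)) (at x)"
      using DERIV_shift[of "D i" _ x "- h"] Suc.prems[of i "x - h"] that by simp
    then show ?thesis
      unfolding D'_def rdif_def[abs_def] using that by (intro DERIV_diff Suc.prems) auto
  qed
  from Suc.IH[of D', OF this] obtain \<xi> where \<xi>: "x - real q * h \<le> \<xi>" "\<xi> \<le> x"
    "(rdif h ^^ q) (D' 0) x = h ^ q * D' q \<xi>" by auto
  have "\<exists>z. \<xi> - h < z \<and> z < \<xi> \<and> D q \<xi> - D q (\<xi> - h) = (\<xi> - (\<xi> - h)) * D (Suc q) z"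
    using \<open>h > 0\<close> by (intro MVT2 Suc.prems) auto
  then obtain z where z: "\<xi> - h < z" "z < \<xi>" "D q \<xi> - D q (\<xi> - h) = h * D (Suc q) z"
    by auto
  have "(rdif h ^^ Suc q) (D 0) x = h ^ Suc q * D (Suc q) z"
    using \<xi>(3) z(3) unfolding D'_def funpow_Suc_right by (simp add: rdif_def)
  moreover have "x - real (Suc q) * h \<le> z" "z \<le> x"
    using \<xi> z by (simp_all add: algebra_simps)
  ultimately show ?case by blast
qed auto

text \<open>At order q + 1 the difference is h^q times a difference of two values of
  \<open>D q\<close>; each of the s further differences at most doubles the bound. A bound by
  oscillation serves Hoelder continuous and merely continuous derivatives alike.\<close>

lemma rdif_oscillation:
  assumes "h > 0" and D: "\<And>i x. i < q \<Longrightarrow> (D i has_real_derivative D (Suc i) x) (at x)"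
    and osc: "\<And>s t. \<bar>s\<bar> \<le> R \<Longrightarrow> \<bar>t\<bar> \<le> R \<Longrightarrow> \<bar>D q s - D q t\<bar> \<le> \<omega>"
    and x: "- R \<le> x - real (q + 1 + s) * h" "x \<le> R"
  shows "\<bar>(rdif h ^^ (q + 1 + s)) (D 0) x\<bar> \<le> 2 ^ s * (h ^ q * \<omega>)"
  using x
proof (induction s arbitrary: x)
  case 0
  obtain \<xi> where \<xi>: "x - real q * h \<le> \<xi>" "\<xi> \<le> x" "(rdif h ^^ q) (D 0) x = h ^ q * D q \<xi>"
    using rdif_mvt[of h q D, OF assms(1) D] by blast
  obtain \<eta> where \<eta>: "x - h - real q * h \<le> \<eta>" "\<eta> \<le> x - h" "(rdif h ^^ q) (D 0) (x - h) = h ^ q * D q \<eta>"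
    using rdif_mvt[of h q D, OF assms(1) D] by blast
  have "\<bar>\<xi>\<bar> \<le> R" "\<bar>\<eta>\<bar> \<le> R" using 0 \<xi>(1,2) \<eta>(1,2) \<open>h > 0\<close> by (auto simp: abs_le_iff algebra_simps)
  then have "\<bar>D q \<xi> - D q \<eta>\<bar> \<le> \<omega>" by (rule osc)
  moreover have "(rdif h ^^ (q + 1 + 0)) (D 0) x = h ^ q * (D q \<xi> - D q \<eta>)"
    by (simp add: rdif_def[of h "(rdif h ^^ q) (D 0)"] \<xi>(3) \<eta>(3) right_diff_distrib)
  ultimately show ?case using \<open>h > 0\<close> by (simp add: abs_mult)
next
  case (Suc s)
  let ?G = "(rdif h ^^ (q + 1 + s)) (D 0)"
  have "\<bar>?G x\<bar> \<le> 2 ^ s * (h ^ q * \<omega>)"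
    using Suc.prems \<open>h > 0\<close> by (intro Suc.IH) (auto simp: algebra_simps)
  moreover have "\<bar>?G (x - h)\<bar> \<le> 2 ^ s * (h ^ q * \<omega>)"
    using Suc.prems \<open>h > 0\<close> by (intro Suc.IH) (auto simp: algebra_simps)
  moreover have "(rdif h ^^ (q + 1 + Suc s)) (D 0) x = ?G x - ?G (x - h)"
    unfolding rdif_def[of h ?G x, symmetric] by simp
  ultimately show ?case by simp
qed

lemma upconv_dif:
  assumes u: "finsupp u"
  shows "upconv N c (dif u) i = upconv N c u i - upconv N c u (i - N)"
proof -
  obtain K where K: "supp_in K u" using finsupp_supp_in u by metis
  let ?A = "{- int K - 1..int K + 1}"
  have du: "{l. dif u l \<noteq> 0} \<subseteq> ?A" and u': "{l. u l \<noteq> 0} \<subseteq> ?A"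
    and us: "{l. u l \<noteq> 0} \<subseteq> (\<lambda>l. l - 1) ` ?A"
  proof -
    show "{l. dif u l \<noteq> 0} \<subseteq> ?A"
    proof
      fix l assume "l \<in> {l. dif u l \<noteq> 0}"
      then have "u l \<noteq> 0 \<or> u (l - 1) \<noteq> 0" by (auto simp: dif_def)
      then show "l \<in> ?A" using supp_inD[OF K, of l] supp_inD[OF K, of "l - 1"] by auto
    qed
    show "{l. u l \<noteq> 0} \<subseteq> ?A" using K by (auto simp: supp_in_def)
    show "{l. u l \<noteq> 0} \<subseteq> (\<lambda>l. l - 1) ` ?A"
    proof
      fix l assume "l \<in> {l. u l \<noteq> 0}"
      then have "l + 1 \<in> ?A" using supp_inD[OF K, of l] by auto
      then show "l \<in> (\<lambda>l. l - 1) ` ?A" by (rule rev_image_eqI) simp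
    qed
  qed
  have "upconv N c u (i - N) = (\<Sum>l\<in>(\<lambda>l. l - 1) ` ?A. c (i - N - N * l) * u l)"
    by (rule upconv_superset[OF _ us]) simp
  also have "\<dots> = (\<Sum>l\<in>?A. c (i - N * l) * u (l - 1))"
    by (subst sum.reindex) (auto simp: inj_on_def algebra_simps)
  finally show ?thesis
    unfolding upconv_superset[OF _ du, simplified] upconv_superset[OF _ u', simplified]
    by (simp add: dif_def right_diff_distrib sum_subtractf)
qed

lemma upconv_shift: "upconv N c u (k + N) = upconv N c (\<lambda>l. u (l + 1)) k"
  unfolding upconv_def
  by (rule sum.reindex_bij_witness[of _ "\<lambda>l. l + 1" "\<lambda>l. l - 1"]) (auto simp: algebra_simps)

text \<open>On the grid of mesh 2^(-(m + J)) a step of 2^(-m) moves the index by 2^J, which is a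
  step of one index in the data of level \<open>m\<close>.\<close>

lemma rdif_samples:
  assumes \<phi>: "is_limit_function a delta \<phi>" and g: "is_limit_function a f g"
    and f: "finsupp f" and a: "finsupp a"
  shows "(rdif (1 / 2 ^ m) ^^ n) g (of_int i / 2 ^ (m + J))
      = upconv (2 ^ J) (samples \<phi> J) ((dif ^^ n) (subdiv a f m)) i"
proof (induction n arbitrary: i)
  case 0
  show ?case
    using fun_cong[OF samples_refine[OF assms, of m J], of i] samples_def[of g "m + J" i] by simp
next
  case (Suc n)
  have "of_int i / 2 ^ (m + J) - 1 / 2 ^ m = (of_int (i - 2 ^ J) / 2 ^ (m + J) :: real)"
    by (simp add: power_add field_simps)
  then show ?case
    using Suc[of i] Suc[of "i - 2 ^ J"]
    by (simp add: rdif_def[of _ "(rdif _ ^^ n) g"]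
        upconv_dif[OF finsupp_dif_funpow[OF finsupp_subdiv[OF a f]]])
qed

section \<open>Data whose differences begin with an impulse\<close>

lemma dif_funpow_shift_diff:
  "(dif ^^ n) (\<lambda>k. u k - u (k - L)) k = (dif ^^ n) u k - (dif ^^ n) u (k - L)"
  by (induction n arbitrary: k) (simp_all add: dif_def Groups.diff_right_commute[of _ 1 L])

lemma dif_funpow_causal:
  "(\<And>k. k < 0 \<Longrightarrow> u k = 0) \<Longrightarrow> k < 0 \<Longrightarrow> (dif ^^ n) u k = 0"
  by (induction n arbitrary: k) (simp_all add: dif_def)

text \<open>A finitely supported sequence cannot have \<open>delta\<close> as its \<open>n\<close>-th difference, but iterated
  box sums of length \<open>L\<close> postpone the defect to indices \<open>\<ge> L\<close>.\<close>

lemma exists_local_antidifference: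
  fixes L :: nat
  shows "\<exists>u. finsupp u \<and> (\<forall>k<0. u k = 0) \<and> (\<forall>k<int L. (dif ^^ n) u k = delta k)"
proof (induction n)
  case 0
  show ?case by (intro exI[of _ delta] conjI finsupp_delta) (simp_all add: delta_def)
next
  case (Suc n)
  then obtain u where u: "finsupp u" "\<And>k. k < 0 \<Longrightarrow> u k = 0" "\<And>k. k < int L \<Longrightarrow> (dif ^^ n) u k = delta k"
    by blast
  define v where "v k = (\<Sum>i<L. u (k - int i))" for k
  have "dif v = (\<lambda>k. u k - u (k - int L))"
  proof
    fix k
    have "dif v k = (\<Sum>i<L. u (k - int i) - u (k - int (Suc i)))"
      by (simp add: dif_def v_def sum_subtractf algebra_simps)
    also have "\<dots> = u k - u (k - int L)"
      using sum_lessThan_telescope'[of "\<lambda>i. u (k - int i)" L] by simp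
    finally show "dif v k = u k - u (k - int L)" .
  qed
  then have "(dif ^^ Suc n) v k = delta k" if "k < int L" for k
    unfolding funpow_Suc_right using u(3)[OF that] dif_funpow_causal[of u "k - int L" n] u(2) that
    by (simp add: dif_funpow_shift_diff)
  moreover have "finsupp v"
  proof -
    obtain K where K: "supp_in K u" using finsupp_supp_in u(1) by metis
    have "supp_in (K + L) v"
    proof (rule supp_inI)
      fix k assume "v k \<noteq> 0"
      then obtain i where "i < L" "u (k - int i) \<noteq> 0"
        unfolding v_def by (meson lessThan_iff sum.not_neutral_contains_not_neutral)
      then show "\<bar>k\<bar> \<le> int (K + L)" using supp_inD[OF K, of "k - int i"] by auto
    qed
    then show ?thesis by (rule supp_in_finsupp)
  qed
  moreover have "v k = 0" if "k < 0" for k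
    using u(2) that by (simp add: v_def)
  ultimately show ?case by blast
qed

section \<open>Means of nonnegative functions\<close>

definition rmean :: "nat \<Rightarrow> (real \<Rightarrow> real) \<Rightarrow> real" where
  "rmean n P = (\<Sum>t\<in>{- int n..<int n}. P (pi * of_int t / of_nat n)) / of_nat (2 * n)"

lemma mean_of_real: "mean n (\<lambda>\<xi>. of_real (P \<xi>)) = of_real (rmean n P)"
  by (simp add: mean_def rmean_def)

lemma rmean_mono: "(\<And>\<xi>. P \<xi> \<le> Q \<xi>) \<Longrightarrow> rmean n P \<le> rmean n Q"
  unfolding rmean_def by (intro divide_right_mono sum_mono) auto

lemma rmean_cmult: "rmean n (\<lambda>\<xi>. c * P \<xi>) = c * rmean n P"
  by (simp add: rmean_def sum_distrib_left)

text \<open>The grid points with - H \<le> t < H of the finer grid are mapped by \<xi> \<mapsto> N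
  \<xi> exactly onto the coarser grid. All other terms are nonnegative and dropped; 1 / N is the
  ratio of the numbers of points.\<close>

lemma rmean_localize:
  assumes H: "H > 0" and N: "N > 0" and c: "c \<ge> 0" and P: "\<And>\<xi>. P \<xi> \<ge> 0" and Q: "\<And>\<xi>. Q \<xi> \<ge> 0"
    and ge: "\<And>\<xi>. \<bar>\<xi>\<bar> \<le> pi / real N \<Longrightarrow> c \<le> P \<xi>"
  shows "c / real N * rmean H Q \<le> rmean (N * H) (\<lambda>\<xi>. P \<xi> * Q (real N * \<xi>))"
proof -
  define n where "n = N * H"
  define x where "x t = pi * of_int t / real n" for t :: int
  have Nx: "real N * x t = pi * of_int t / real H" for t
    using N by (simp add: x_def n_def)
  have HN: "int H \<le> int n" unfolding n_def using N by (cases N) auto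
  have "c * (\<Sum>t\<in>{- int H..<int H}. Q (pi * of_int t / real H))
      = (\<Sum>t\<in>{- int H..<int H}. c * Q (real N * x t))"
    unfolding Nx by (simp add: sum_distrib_left)
  also have "\<dots> \<le> (\<Sum>t\<in>{- int H..<int H}. P (x t) * Q (real N * x t))"
  proof (intro sum_mono mult_right_mono ge Q)
    fix t assume "t \<in> {- int H..<int H}"
    then have "\<bar>t\<bar> \<le> int H" by auto
    then have "\<bar>real_of_int t\<bar> \<le> real H" by linarith
    then have "pi * \<bar>real_of_int t\<bar> / real n \<le> pi * real H / real n"
      by (intro divide_right_mono mult_left_mono) auto
    also have "\<dots> = pi / real N" using H by (simp add: n_def)
    finally show "\<bar>x t\<bar> \<le> pi / real N" by (simp add: x_def abs_mult)
  qed
  also have "\<dots> \<le> (\<Sum>t\<in>{- int n..<int n}. P (x t) * Q (real N * x t))"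
    using HN by (intro sum_mono2) (auto intro!: mult_nonneg_nonneg P Q)
  finally have "c * (\<Sum>t\<in>{- int H..<int H}. Q (pi * of_int t / real H)) / (2 * real n)
      \<le> (\<Sum>t\<in>{- int n..<int n}. P (x t) * Q (real N * x t)) / (2 * real n)"
    by (intro divide_right_mono) auto
  then show ?thesis unfolding rmean_def n_def[symmetric] x_def[symmetric]
    using N by (simp add: n_def mult_ac)
qed

text \<open>Multiplication by \<open>cos \<xi>\<close> moves even frequencies to odd ones, which
  never contribute to the mean, so only the 1 does.\<close>

lemma mean_one_minus_cos_double:
  assumes c: "supp_in K c" and n: "2 * K + 1 < 2 * n"
  shows "mean n (\<lambda>\<xi>. of_real (1 - cos \<xi>) * trig c (2 * \<xi>)) = of_real (c 0)"
proof -
  let ?A = "{- int K..int K}"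
  have n0: "n > 0" using n by simp
  have "of_real (1 - cos \<xi>) * trig c (2 * \<xi>)
      = (\<Sum>k\<in>?A. of_real (c k) * (cis (of_int (2 * k) * \<xi>) - 1 / 2 * cis (of_int (2 * k + 1) * \<xi>)
          - 1 / 2 * cis (of_int (2 * k - 1) * \<xi>)))" for \<xi>
  proof -
    have e: "cis (of_int (2 * k) * \<xi>) - 1 / 2 * cis (of_int (2 * k + 1) * \<xi>)
          - 1 / 2 * cis (of_int (2 * k - 1) * \<xi>) = of_real (1 - cos \<xi>) * cis (of_int k * (2 * \<xi>))" for k
    proof -
      have 1: "cis (of_int (2 * k + 1) * \<xi>) = cis (of_int (2 * k) * \<xi>) * cis \<xi>"
        by (simp add: cis_mult algebra_simps)
      have 2: "cis (of_int (2 * k - 1) * \<xi>) = cis (of_int (2 * k) * \<xi>) * cis (- \<xi>)"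
        by (simp add: cis_mult algebra_simps)
      have 3: "cis \<xi> + cis (- \<xi>) = of_real (2 * cos \<xi>)" by (simp add: complex_eq_iff)
      have "cis (of_int (2 * k) * \<xi>) - 1 / 2 * cis (of_int (2 * k + 1) * \<xi>) - 1 / 2 * cis (of_int (2 * k - 1) * \<xi>)
        = cis (of_int (2 * k) * \<xi>) * (1 - (cis \<xi> + cis (- \<xi>)) / 2)"
        unfolding 1 2 by (simp add: field_simps)
      also have "\<dots> = of_real (1 - cos \<xi>) * cis (of_int k * (2 * \<xi>))"
        unfolding 3 by (simp add: mult_ac)
      finally show ?thesis .
    qed
    show ?thesis unfolding e trig_box[OF c] sum_distrib_left by (simp add: mult_ac)
  qed
  then have "mean n (\<lambda>\<xi>. of_real (1 - cos \<xi>) * trig c (2 * \<xi>))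
      = (\<Sum>k\<in>?A. of_real (c k) * (mean n (\<lambda>\<xi>. cis (of_int (2 * k) * \<xi>))
         - 1 / 2 * mean n (\<lambda>\<xi>. cis (of_int (2 * k + 1) * \<xi>))
         - 1 / 2 * mean n (\<lambda>\<xi>. cis (of_int (2 * k - 1) * \<xi>))))"
    by (simp only: mean_sum mean_cmult mean_diff)
  also have "\<dots> = (\<Sum>k\<in>?A. if k = 0 then of_real (c k) else 0)"
  proof (intro sum.cong refl)
    fix k assume "k \<in> ?A"
    then have "\<bar>2 * k\<bar> < 2 * int n" "\<bar>2 * k + 1\<bar> < 2 * int n" "\<bar>2 * k - 1\<bar> < 2 * int n"
      using n by auto
    moreover have "2 * k + 1 \<noteq> 0" "2 * k - 1 \<noteq> 0" by presburger+
    ultimately show "of_real (c k) * (mean n (\<lambda>\<xi>. cis (of_int (2 * k) * \<xi>))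
         - 1 / 2 * mean n (\<lambda>\<xi>. cis (of_int (2 * k + 1) * \<xi>))
         - 1 / 2 * mean n (\<lambda>\<xi>. cis (of_int (2 * k - 1) * \<xi>))) = (if k = 0 then of_real (c k) else 0)"
      by (simp only: mean_cis[OF n0]) simp
  qed
  also have "\<dots> = of_real (c 0)" by simp
  finally show ?thesis .
qed

section \<open>The energy estimate\<close>

context positive_scheme
begin

lemma trig_a_nonzero: "\<bar>\<xi>\<bar> < pi \<Longrightarrow> trig a \<xi> \<noteq> 0"
proof -
  assume "\<bar>\<xi>\<bar> < pi"
  have "1 + cis \<xi> \<noteq> 0"
  proof
    assume "1 + cis \<xi> = 0"
    then have "cis \<xi> = - 1" by (simp add: add_eq_0_iff)
    then have "cos \<bar>\<xi>\<bar> = cos pi" by (simp add: complex_eq_iff)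
    moreover have "cos pi < cos \<bar>\<xi>\<bar>"
      using \<open>\<bar>\<xi>\<bar> < pi\<close> by (intro cos_monotone_0_pi) auto
    ultimately show False by simp
  qed
  then show ?thesis using Bpos[of \<xi>] by (simp add: fac B)
qed

text \<open>The symbol of \<open>samples \<phi> J\<close> is that of \<open>samples \<phi> 0\<close>
  times the product of trig a (2^i \<xi>) over i < J. The former is 1 at 0, hence nonzero on the
  small interval that a large J leaves; there all 2^i \<xi> stay within pi / 2, away from the zero
  of the symbol of \<open>a\<close> at pi. Compactness yields the constant.\<close>

lemma trig_samples_nonzero:
  assumes \<phi>: "is_limit_function a delta \<phi>"
  obtains J c where "c > 0" and "\<And>\<xi>. \<bar>\<xi>\<bar> \<le> pi / 2 ^ J \<Longrightarrow> c \<le> norm (trig (samples \<phi> J) \<xi>)"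
proof -
  obtain K where K: "supp_in K a" using finsupp_supp_in fa by metis
  have fs: "finsupp (samples \<phi> J)" for J
    using supp_in_samples[OF \<phi> K] by (rule supp_in_finsupp)
  have step: "trig (samples \<phi> (Suc J)) \<xi> = trig (samples \<phi> J) \<xi> * trig a (2 ^ J * \<xi>)" for J \<xi>
  proof -
    have "samples \<phi> (Suc 0 + J) = upconv (2 ^ J) (samples \<phi> J) (subdiv a delta (Suc 0))"
      by (rule samples_refine[OF \<phi> \<phi> finsupp_delta fa])
    then have "trig (samples \<phi> (Suc J)) \<xi>
        = trig (samples \<phi> J) \<xi> * trig (subdiv a delta (Suc 0)) (of_int (2 ^ J) * \<xi>)"
      using trig_upconv[OF fs finsupp_subdiv[OF fa finsupp_delta]] by simp
    then show ?thesis by (simp add: trig_subdiv_Suc fa)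
  qed
  have "isCont (\<lambda>\<xi>. norm (trig (samples \<phi> 0) \<xi>)) 0"
    by (intro continuous_norm continuous_on_interior[OF continuous_trig[of UNIV]]) simp
  moreover have "norm (trig (samples \<phi> 0) 0) > 1 / 2"
    using trig_samples_0[OF \<phi> fa a0 api] by simp
  ultimately have "\<forall>\<^sub>F \<xi> in at 0. norm (trig (samples \<phi> 0) \<xi>) > 1 / 2"
    unfolding isCont_def by (rule order_tendstoD)
  then obtain \<delta> where \<delta>: "\<delta> > 0" "\<And>\<xi>. \<xi> \<noteq> 0 \<Longrightarrow> \<bar>\<xi>\<bar> < \<delta> \<Longrightarrow> norm (trig (samples \<phi> 0) \<xi>) > 1 / 2"
    unfolding eventually_at by (auto simp: dist_real_def)
  have nz0: "trig (samples \<phi> 0) \<xi> \<noteq> 0" if "\<bar>\<xi>\<bar> < \<delta>" for \<xi>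
  proof (cases "\<xi> = 0")
    case True
    then show ?thesis using trig_samples_0[OF \<phi> fa a0 api] by simp
  next
    case False
    from \<delta>(2)[OF this that] show ?thesis by auto
  qed
  obtain J where J: "(1 / 2) ^ J < \<delta> / pi"
    using real_arch_pow_inv[of "\<delta> / pi" "1 / 2"] \<delta>(1) by auto
  have J': "pi / 2 ^ J < \<delta>" using J by (simp add: power_one_over field_simps)
  have nz: "trig (samples \<phi> J) \<xi> \<noteq> 0" if \<xi>: "\<bar>\<xi>\<bar> \<le> pi / 2 ^ J" for \<xi>
  proof -
    have "trig (samples \<phi> i) \<xi> \<noteq> 0" if "i \<le> J" for i
      using that
    proof (induction i)
      case 0
      show ?case using \<xi> J' by (intro nz0) linarith
    next
      case (Suc i)
      have "\<bar>2 ^ i * \<xi>\<bar> < pi"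
      proof -
        have "2 * (2 ^ i * \<bar>\<xi>\<bar>) = 2 ^ Suc i * \<bar>\<xi>\<bar>" by simp
        also have "\<dots> \<le> 2 ^ J * \<bar>\<xi>\<bar>"
          using Suc.prems by (intro mult_right_mono power_increasing) auto
        also have "\<dots> \<le> pi" using \<xi> by (simp add: field_simps)
        finally have "2 ^ i * \<bar>\<xi>\<bar> < pi" using pi_gt_zero by linarith
        then show ?thesis by (simp add: abs_mult)
      qed
      then show ?case using Suc trig_a_nonzero by (simp add: step)
    qed
    then show ?thesis by simp
  qed
  let ?I = "{- (pi / 2 ^ J)..pi / 2 ^ J}"
  have "\<exists>x\<in>?I. \<forall>y\<in>?I. norm (trig (samples \<phi> J) x) \<le> norm (trig (samples \<phi> J) y)"
    by (intro continuous_attains_inf continuous_on_norm continuous_trig) auto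
  then obtain x where x: "x \<in> ?I" "\<And>y. y \<in> ?I \<Longrightarrow> norm (trig (samples \<phi> J) x) \<le> norm (trig (samples \<phi> J) y)"
    by blast
  show thesis
  proof (rule that)
    show "norm (trig (samples \<phi> J) x) > 0" using nz[of x] x(1) by (auto simp: abs_le_iff)
    show "norm (trig (samples \<phi> J) x) \<le> norm (trig (samples \<phi> J) \<xi>)" if "\<bar>\<xi>\<bar> \<le> pi / 2 ^ J" for \<xi>
      using that by (intro x(2)) (auto simp: abs_le_iff)
  qed
qed

text \<open>The shift by one centres the second difference, so that its symbol is real.\<close>

definition b_iter_dif2 :: "nat \<Rightarrow> int \<Rightarrow> real" where
  "b_iter_dif2 m l = (dif ^^ 2) (b_iter m) (l + 1)"

lemma finsupp_b_iter: "finsupp (b_iter m)"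
  by (intro finsupp_subdiv fb finsupp_delta)

lemma finsupp_b_iter_dif2: "finsupp (b_iter_dif2 m)"
proof -
  have "(\<lambda>l. l - 1) ` {l. (dif ^^ 2) (b_iter m) l \<noteq> 0} = {l. b_iter_dif2 m l \<noteq> 0}"
    by (auto simp: b_iter_dif2_def intro!: image_eqI[of _ _ "_ + 1"])
  then show ?thesis
    using finsupp_dif_funpow[OF finsupp_b_iter, of 2 m] unfolding finsupp_def by (metis finite_imageI)
qed

lemma trig_b_iter_dif2: "trig (b_iter_dif2 m) \<xi> = - of_real (2 * (1 - cos \<xi>)) * trig (b_iter m) \<xi>"
proof -
  have "trig ((dif ^^ 2) (b_iter m)) \<xi> = cis \<xi> * trig (b_iter_dif2 m) \<xi>"
    using trig_two_term[OF finsupp_b_iter_dif2[of m], of 0 1 \<xi>] by (simp add: b_iter_dif2_def)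
  then have "cis (- \<xi>) * (1 - cis \<xi>) ^ 2 * trig (b_iter m) \<xi> = cis (- \<xi>) * cis \<xi> * trig (b_iter_dif2 m) \<xi>"
    using trig_dif_funpow[OF finsupp_b_iter, of 2 m \<xi>] by simp
  moreover have "cis (- \<xi>) * cis \<xi> = 1" by (simp add: cis_mult)
  moreover have "cis (- \<xi>) * (1 - cis \<xi>) ^ 2 = cis (- \<xi>) - 2 * (cis (- \<xi>) * cis \<xi>) + (cis (- \<xi>) * cis \<xi>) * cis \<xi>"
    by (simp add: power2_eq_square algebra_simps)
  moreover have "cis (- \<xi>) - 2 + cis \<xi> = - of_real (2 * (1 - cos \<xi>))"
    by (simp add: complex_eq_iff)
  ultimately show ?thesis by simp
qed

text \<open>Since \<open>B \<ge> \<mu>\<close>, the last factor of the product \<open>trig (b_iter (Suc m))\<close> may be replaced by \<open>\<mu>\<close>;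
  what remains is \<open>(1 - cos \<xi>)\<close> times a polynomial in even frequencies, whose mean is \<open>b_iter m 0\<close>.\<close>

lemma energy_lower:
  assumes \<theta>: "supp_in K \<theta>" and c: "c > 0" "\<And>\<xi>. \<bar>\<xi>\<bar> \<le> pi / 2 ^ J \<Longrightarrow> c \<le> norm (trig \<theta> \<xi>)"
  shows "2 * c\<^sup>2 * \<mu> / 2 ^ J * b_iter m 0
    \<le> - (\<Sum>i\<in>{- int K..int K}. \<theta> i * upconv (2 ^ J) \<theta> (b_iter_dif2 (Suc m)) i)"
proof -
  define y where "y = b_iter_dif2 (Suc m)"
  define Y where "Y \<xi> = 2 * (1 - cos \<xi>) * (\<Prod>t<Suc m. B (2 ^ t * \<xi>))" for \<xi>
  have trigy: "trig y \<xi> = - of_real (Y \<xi>)" for \<xi>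
    unfolding y_def trig_b_iter_dif2 trig_b_iter Y_def by (simp only: of_real_mult mult_minus_left)
  have Y0: "Y \<xi> \<ge> 0" for \<xi>
    unfolding Y_def using Bpos by (intro mult_nonneg_nonneg prod_nonneg) (auto intro: less_imp_le)
  have f\<theta>: "finsupp \<theta>" using \<theta> by (rule supp_in_finsupp)
  have fy: "finsupp y" unfolding y_def by (rule finsupp_b_iter_dif2)
  obtain L where L: "supp_in L (upconv (2 ^ J) \<theta> y)"
    using finsupp_supp_in finsupp_upconv[OF f\<theta> fy] by metis
  obtain M where M: "supp_in M (b_iter m)" using finsupp_supp_in finsupp_b_iter by metis
  \<comment> \<open>Large enough for both exact means: K + L serves \<open>mean_parseval\<close>
    with 2^J H, and 2 M + 1 serves \<open>mean_one_minus_cos_double\<close> with H.\<close>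
  define H where "H = K + L + 2 * M + 1"
  let ?n = "2 ^ J * H"
  have Hn: "H \<le> ?n" by simp
  have n: "K + L < 2 * ?n" using Hn unfolding H_def by linarith
  have "(\<lambda>\<xi>. cnj (trig \<theta> \<xi>) * trig (upconv (2 ^ J) \<theta> y) \<xi>)
      = (\<lambda>\<xi>. of_real (- 1 * ((norm (trig \<theta> \<xi>))\<^sup>2 * Y (real (2 ^ J) * \<xi>))))"
  proof
    fix \<xi>
    have "cnj (trig \<theta> \<xi>) * trig (upconv (2 ^ J) \<theta> y) \<xi>
        = (trig \<theta> \<xi> * cnj (trig \<theta> \<xi>)) * trig y (of_int (2 ^ J) * \<xi>)"
      by (simp add: trig_upconv[OF f\<theta> fy] mult_ac)
    then show "cnj (trig \<theta> \<xi>) * trig (upconv (2 ^ J) \<theta> y) \<xi>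
      = of_real (- 1 * ((norm (trig \<theta> \<xi>))\<^sup>2 * Y (real (2 ^ J) * \<xi>)))"
      by (simp add: trigy complex_norm_square[symmetric])
  qed
  then have "complex_of_real (\<Sum>i\<in>{- int K..int K}. \<theta> i * upconv (2 ^ J) \<theta> y i)
      = of_real (- 1 * rmean ?n (\<lambda>\<xi>. (norm (trig \<theta> \<xi>))\<^sup>2 * Y (real (2 ^ J) * \<xi>)))"
    unfolding mean_parseval[OF \<theta> L n, symmetric] by (simp only: mean_of_real rmean_cmult)
  then have E: "- (\<Sum>i\<in>{- int K..int K}. \<theta> i * upconv (2 ^ J) \<theta> y i)
      = rmean ?n (\<lambda>\<xi>. (norm (trig \<theta> \<xi>))\<^sup>2 * Y (real (2 ^ J) * \<xi>))"
    by (simp only: of_real_eq_iff)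
  have "c\<^sup>2 / real (2 ^ J) * rmean H Y \<le> rmean ?n (\<lambda>\<xi>. (norm (trig \<theta> \<xi>))\<^sup>2 * Y (real (2 ^ J) * \<xi>))"
    by (rule rmean_localize) (use c Y0 in \<open>auto simp: H_def intro!: power_mono\<close>)
  moreover have "2 * \<mu> * b_iter m 0 \<le> rmean H Y"
  proof -
    define Z where "Z \<xi> = (1 - cos \<xi>) * (\<Prod>t<m. B (2 ^ t * (2 * \<xi>)))" for \<xi>
    have "(\<lambda>\<xi>. of_real (1 - cos \<xi>) * trig (b_iter m) (2 * \<xi>)) = (\<lambda>\<xi>. complex_of_real (Z \<xi>))"
      by (simp add: Z_def trig_b_iter)
    then have "complex_of_real (rmean H Z) = of_real (b_iter m 0)"
      unfolding mean_of_real[symmetric]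
      using mean_one_minus_cos_double[OF M, of H] by (simp add: H_def)
    then have Z: "rmean H Z = b_iter m 0" by (simp only: of_real_eq_iff)
    have "2 * \<mu> * Z \<xi> \<le> Y \<xi>" for \<xi>
    proof -
      have "(\<Prod>t<Suc m. B (2 ^ t * \<xi>)) = B \<xi> * (\<Prod>t<m. B (2 ^ t * (2 * \<xi>)))"
        unfolding prod.lessThan_Suc_shift by (simp add: mult_ac)
      then have "Y \<xi> = 2 * B \<xi> * Z \<xi>" by (simp add: Y_def Z_def)
      moreover have "Z \<xi> \<ge> 0"
        unfolding Z_def using Bpos by (intro mult_nonneg_nonneg prod_nonneg) (auto intro: less_imp_le)
      ultimately show ?thesis using \<mu>(2)[of \<xi>] by (simp add: mult_right_mono)
    qed
    then have "rmean H (\<lambda>\<xi>. 2 * \<mu> * Z \<xi>) \<le> rmean H Y" by (rule rmean_mono)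
    then show ?thesis by (simp add: rmean_cmult Z)
  qed
  then have "c\<^sup>2 / 2 ^ J * (2 * \<mu> * b_iter m 0) \<le> c\<^sup>2 / 2 ^ J * rmean H Y"
    by (intro mult_left_mono) auto
  ultimately show ?thesis using E unfolding y_def by (simp add: mult_ac)
qed

end

section \<open>From the energy estimate to the oscillation of derivatives\<close>

lemma cont_diff_has_derivs:
  assumes "g \<in> cont_diff n" "i < n"
  shows "((deriv ^^ i) g has_real_derivative (deriv ^^ Suc i) g x) (at x)"
proof -
  have "(deriv ^^ i) g differentiable (at x)"
    using assms by (auto simp: cont_diff_def differentiable_on_def)
  then show ?thesis
    by (simp add: real_differentiable_def DERIV_deriv_iff_real_differentiable)
qed

lemma cont_diff_continuous:
  assumes "g \<in> cont_diff n" "q \<le> n"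
  shows "continuous_on UNIV ((deriv ^^ q) g)"
proof (cases "q = n")
  case False
  then have "(deriv ^^ q) g differentiable_on UNIV" using assms by (auto simp: cont_diff_def)
  then show ?thesis by (rule differentiable_imp_continuous_on)
qed (use assms in \<open>auto simp: cont_diff_def\<close>)

context positive_scheme
begin

text \<open>The pairing of \<theta> with the differences of order r + 3 is bounded below by
  \<open>energy_lower\<close> and above by the oscillation of \<open>D q\<close> near 0. The
  hypothesis is applied to \<open>delta\<close>, giving \<phi>, and to \<open>u\<close>, giving
  \<open>g\<close>; leaving \<open>q\<close>, \<open>D\<close> and \<open>m\<close> open lets one
  estimate treat every exponent.\<close>

lemma oscillation_lower:
  assumes lim: "\<And>f. finsupp f \<Longrightarrow> \<exists>g. is_limit_function a f g \<and> g \<in> G"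
  obtains g R C where "g \<in> G" and "R > 0" and "C > 0"
    and "\<And>q D m \<omega>. q \<le> r + 1 \<Longrightarrow> D 0 = g \<Longrightarrow>
      (\<And>i x. i < q \<Longrightarrow> (D i has_real_derivative D (Suc i) x) (at x)) \<Longrightarrow>
      (\<And>s t. \<bar>s\<bar> \<le> R / 2 ^ Suc m \<Longrightarrow> \<bar>t\<bar> \<le> R / 2 ^ Suc m \<Longrightarrow> \<bar>D q s - D q t\<bar> \<le> \<omega>) \<Longrightarrow>
      C * \<rho> ^ m * 2 ^ (q * Suc m) \<le> 2 ^ (r * Suc m) * \<omega>"
proof -
  obtain K where K: "supp_in K a" using finsupp_supp_in fa by metis
  obtain \<phi> where \<phi>: "is_limit_function a delta \<phi>" using lim[OF finsupp_delta] by blast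
  obtain J c where c: "c > 0" "\<And>\<xi>. \<bar>\<xi>\<bar> \<le> pi / 2 ^ J \<Longrightarrow> c \<le> norm (trig (samples \<phi> J) \<xi>)"
    using trig_samples_nonzero[OF \<phi>] by blast
  define \<theta> where "\<theta> = samples \<phi> J"
  define K' where "K' = K * 2 ^ J"
  have \<theta>: "supp_in K' \<theta>" unfolding \<theta>_def K'_def by (rule supp_in_samples[OF \<phi> K])
  \<comment> \<open>The pairing reads indices l \<le> 2 K, the centred second difference reaches l +
    1, and subdivision with \<open>b\<close> looks at most p further. So the defect of the data to
    the right is never seen.\<close>
  obtain u where u: "finsupp u" "\<And>k. k < int (2 * K + p + 2) \<Longrightarrow> (dif ^^ (r + 1)) u k = delta k"
    using exists_local_antidifference[of "2 * K + p + 2" "r + 1"] by blast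
  obtain g where g: "is_limit_function a u g" "g \<in> G" using lim[OF u(1)] by blast
  \<comment> \<open>In units of the step h the evaluation points are i / 2^J + 1 with \<bar>i /
    2^J\<bar> \<le> K, and the differences extend r + 3 steps to the left.\<close>
  define R where "R = real (K + r + 3)"
  define S where "S = (\<Sum>i\<in>{- int K'..int K'}. \<bar>\<theta> i\<bar>) * 2 ^ (r + 2)"
  define P where "P = real (2 * p - 1)"
  \<comment> \<open>The constant of \<open>energy_lower\<close>, the matrix size \<open>P\<close>
    from \<open>b_iter_lower\<close>, and the total weight \<open>S\<close> of the pairing, raised
    by 1 to be positive.\<close>
  define C where "C = 2 * c\<^sup>2 * \<mu> / 2 ^ J / P / (S + 1)"
  have S0: "S \<ge> 0" unfolding S_def by (intro mult_nonneg_nonneg sum_nonneg) auto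
  have p0: "P > 0" using p by (simp add: P_def)
  have C0: "C > 0" unfolding C_def using c(1) \<mu>(1) p0 S0 by (intro divide_pos_pos mult_pos_pos) auto
  have local: "2 ^ (r * m) * (dif ^^ (r + 1)) (subdiv a u m) k = b_iter m k" if k: "k \<le> int (2 * K + 1)" for m k
  proof -
    have "subdiv b ((dif ^^ (r + 1)) u) m k = b_iter m k"
    proof (rule subdiv_local[OF sb], rule u(2))
      fix l assume l: "\<bar>k - 2 ^ m * l\<bar> \<le> int p * (2 ^ m - 1)"
      have "k \<le> int (2 * K + 1) * 1" using k by simp
      also have "\<dots> \<le> int (2 * K + 1) * 2 ^ m" by (intro mult_left_mono) auto
      finally have "2 ^ m * l \<le> int (2 * K + 1) * 2 ^ m + int p * (2 ^ m - 1)" using l by linarith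
      also have "\<dots> \<le> 2 ^ m * (int (2 * K + 1) + int p)" by (simp add: algebra_simps)
      finally show "l < int (2 * K + p + 2)" by simp
    qed
    then show ?thesis by (simp only: dif_subdiv[OF u(1)])
  qed
  have rd: "2 ^ (r * m) * (rdif (1 / 2 ^ m) ^^ (r + 3)) g (of_int (i + 2 ^ J) / 2 ^ (m + J))
      = upconv (2 ^ J) \<theta> (b_iter_dif2 m) i" if i: "\<bar>i\<bar> \<le> int K'" for m i
  proof -
    define v where "v l = (dif ^^ (r + 3)) (subdiv a u m) (l + 1)" for l
    have v: "2 ^ (r * m) * v l = b_iter_dif2 m l" if "l \<le> int (2 * K)" for l
    proof -
      define w where "w = (dif ^^ (r + 1)) (subdiv a u m)"
      have "r + 3 = 2 + (r + 1)" by simp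
      then have "v l = (dif ^^ 2) w (l + 1)"
        unfolding v_def w_def by (simp only: funpow_add o_apply)
      also have "\<dots> = w (l + 1) - 2 * w l + w (l - 1)"
        by (simp add: dif_def numeral_2_eq_2)
      finally have "2 ^ (r * m) * v l
          = 2 ^ (r * m) * w (l + 1) - 2 * (2 ^ (r * m) * w l) + 2 ^ (r * m) * w (l - 1)"
        by (simp add: right_diff_distrib distrib_left)
      also have "\<dots> = b_iter m (l + 1) - 2 * b_iter m l + b_iter m (l - 1)"
        using that unfolding w_def by (simp only: local)
      also have "\<dots> = b_iter_dif2 m l" by (simp add: b_iter_dif2_def dif_def numeral_2_eq_2)
      finally show ?thesis .
    qed
    have "(rdif (1 / 2 ^ m) ^^ (r + 3)) g (of_int (i + 2 ^ J) / 2 ^ (m + J)) = upconv (2 ^ J) \<theta> v i"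
      unfolding rdif_samples[OF \<phi> g(1) u(1) fa] v_def \<theta>_def by (rule upconv_shift)
    moreover have "2 ^ (r * m) * upconv (2 ^ J) \<theta> v i = upconv (2 ^ J) \<theta> (b_iter_dif2 m) i"
    proof -
      have fv: "finite {l. v l \<noteq> 0}"
      proof -
        have "{l. v l \<noteq> 0} = (\<lambda>l. l - 1) ` {l. (dif ^^ (r + 3)) (subdiv a u m) l \<noteq> 0}"
          unfolding v_def by (auto intro!: image_eqI[of _ _ "_ + 1"])
        then show ?thesis
          using finsupp_dif_funpow[OF finsupp_subdiv[OF fa u(1)], of "r + 3" m]
          by (simp only: finsupp_def finite_imageI)
      qed
      let ?A = "{l. v l \<noteq> 0} \<union> {l. b_iter_dif2 m l \<noteq> 0}"
      have A: "finite ?A" using fv finsupp_b_iter_dif2[of m] by (simp add: finsupp_def)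
      have "2 ^ (r * m) * upconv (2 ^ J) \<theta> v i = (\<Sum>l\<in>?A. \<theta> (i - 2 ^ J * l) * (2 ^ (r * m) * v l))"
        by (subst upconv_superset[OF A]) (auto simp: sum_distrib_left mult_ac)
      also have "\<dots> = (\<Sum>l\<in>?A. \<theta> (i - 2 ^ J * l) * b_iter_dif2 m l)"
      proof (intro sum.cong refl)
        fix l
        show "\<theta> (i - 2 ^ J * l) * (2 ^ (r * m) * v l) = \<theta> (i - 2 ^ J * l) * b_iter_dif2 m l"
        proof (cases "\<theta> (i - 2 ^ J * l) = 0")
          case False
          then have "\<bar>i - 2 ^ J * l\<bar> \<le> int K'" by (rule supp_inD[OF \<theta>])
          then have "2 ^ J * l \<le> int K' + int K'" using i by linarith
          also have "\<dots> = 2 ^ J * int (2 * K)" by (simp add: K'_def)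
          finally have "2 ^ J * l \<le> 2 ^ J * int (2 * K)" .
          then have "l \<le> int (2 * K)" by simp
          then show ?thesis using v by simp
        qed simp
      qed
      also have "\<dots> = upconv (2 ^ J) \<theta> (b_iter_dif2 m) i"
        by (subst upconv_superset[OF A]) auto
      finally show ?thesis .
    qed
    ultimately show ?thesis by simp
  qed
  have "C * \<rho> ^ m * 2 ^ (q * Suc m) \<le> 2 ^ (r * Suc m) * \<omega>"
    if q: "q \<le> r + 1" and D0: "D 0 = g"
      and D: "\<And>i x. i < q \<Longrightarrow> (D i has_real_derivative D (Suc i) x) (at x)"
      and osc: "\<And>s t. \<bar>s\<bar> \<le> R / 2 ^ Suc m \<Longrightarrow> \<bar>t\<bar> \<le> R / 2 ^ Suc m \<Longrightarrow> \<bar>D q s - D q t\<bar> \<le> \<omega>"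
    for q D m \<omega>
  proof -
    define h :: real where "h = 1 / 2 ^ Suc m"
    have h0: "h > 0" by (simp add: h_def)
    have "\<omega> \<ge> 0" using osc[of 0 0] by (simp add: R_def)
    \<comment> \<open>Of the r + 3 differences, q are turned into derivatives, one measures the
      oscillation and s are left over.\<close>
    define s where "s = r + 2 - q"
    have s: "r + 3 = q + 1 + s" "s \<le> r + 2" using q by (auto simp: s_def)
    let ?x = "\<lambda>i. of_int (i + 2 ^ J) / 2 ^ (Suc m + J) :: real"
    let ?I = "{- int K'..int K'}"
    have rd_le: "\<bar>(rdif h ^^ (r + 3)) g (?x i)\<bar> \<le> 2 ^ (r + 2) * (h ^ q * \<omega>)" if i: "i \<in> ?I" for i
    proof -
      have ii: "\<bar>real_of_int i\<bar> \<le> real K * 2 ^ J"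
      proof -
        have "\<bar>i\<bar> \<le> int K'" using i by auto
        then have "\<bar>real_of_int i\<bar> \<le> real K'" by linarith
        then show ?thesis by (simp add: K'_def)
      qed
      have x: "?x i = (of_int i / 2 ^ J + 1) * h"
        by (simp add: h_def power_add field_simps)
      have "\<bar>of_int i / 2 ^ J\<bar> \<le> real K" using ii by (simp add: abs_divide field_simps)
      then have iJ: "of_int i / 2 ^ J \<le> real K" "- real K \<le> of_int i / 2 ^ J" by linarith+
      have up: "?x i \<le> R * h"
        unfolding x R_def using iJ h0 by (intro mult_right_mono) auto
      have "(- R) * h \<le> (of_int i / 2 ^ J + 1 - real (r + 3)) * h"
        using iJ h0 unfolding R_def by (intro mult_right_mono) auto
      then have lo: "- (R * h) \<le> ?x i - real (r + 3) * h"
        unfolding x by (simp add: algebra_simps)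
      have "\<bar>(rdif h ^^ (q + 1 + s)) (D 0) (?x i)\<bar> \<le> 2 ^ s * (h ^ q * \<omega>)"
      proof (rule rdif_oscillation[of h q D "R * h"])
        show "\<bar>D q s - D q t\<bar> \<le> \<omega>" if "\<bar>s\<bar> \<le> R * h" "\<bar>t\<bar> \<le> R * h" for s t
          using that by (intro osc) (simp_all add: h_def)
      qed (use h0 D up lo s(1) in auto)
      also have "\<dots> \<le> 2 ^ (r + 2) * (h ^ q * \<omega>)"
        using s(2) h0 \<open>\<omega> \<ge> 0\<close> by (intro mult_right_mono power_increasing) auto
      finally show ?thesis unfolding D0 s(1)[symmetric] .
    qed
    have "2 * c\<^sup>2 * \<mu> / 2 ^ J * b_iter m 0 \<le> - (\<Sum>i\<in>?I. \<theta> i * upconv (2 ^ J) \<theta> (b_iter_dif2 (Suc m)) i)"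
      by (rule energy_lower[OF \<theta> c(1)]) (simp add: c(2) \<theta>_def)
    also have "\<dots> = (\<Sum>i\<in>?I. - (\<theta> i * (2 ^ (r * Suc m) * (rdif h ^^ (r + 3)) g (?x i))))"
      unfolding sum_negf[symmetric] h_def
    proof (intro sum.cong refl arg_cong[of _ _ uminus] arg_cong2[of _ _ _ _ "(*)"])
      fix i assume "i \<in> ?I"
      then have "\<bar>i\<bar> \<le> int K'" by auto
      from rd[OF this, of "Suc m"] show "upconv (2 ^ J) \<theta> (b_iter_dif2 (Suc m)) i =
          2 ^ (r * Suc m) * (rdif (1 / 2 ^ Suc m) ^^ (r + 3)) g (?x i)" ..
    qed
    also have "\<dots> \<le> (\<Sum>i\<in>?I. \<bar>\<theta> i\<bar> * (2 ^ (r * Suc m) * (2 ^ (r + 2) * (h ^ q * \<omega>))))"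
    proof (intro sum_mono)
      fix i assume i: "i \<in> ?I"
      have "- (\<theta> i * (2 ^ (r * Suc m) * (rdif h ^^ (r + 3)) g (?x i)))
          \<le> \<bar>\<theta> i * (2 ^ (r * Suc m) * (rdif h ^^ (r + 3)) g (?x i))\<bar>" by linarith
      also have "\<dots> = \<bar>\<theta> i\<bar> * (2 ^ (r * Suc m) * \<bar>(rdif h ^^ (r + 3)) g (?x i)\<bar>)"
        by (simp only: abs_mult power_abs abs_numeral)
      also have "\<dots> \<le> \<bar>\<theta> i\<bar> * (2 ^ (r * Suc m) * (2 ^ (r + 2) * (h ^ q * \<omega>)))"
        using rd_le[OF i] by (intro mult_left_mono) auto
      finally show "- (\<theta> i * (2 ^ (r * Suc m) * (rdif h ^^ (r + 3)) g (?x i)))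
          \<le> \<bar>\<theta> i\<bar> * (2 ^ (r * Suc m) * (2 ^ (r + 2) * (h ^ q * \<omega>)))" .
    qed
    also have "\<dots> = S * (2 ^ (r * Suc m) * (h ^ q * \<omega>))"
      by (simp add: S_def sum_distrib_left sum_distrib_right mult_ac)
    also have "\<dots> \<le> (S + 1) * (2 ^ (r * Suc m) * (h ^ q * \<omega>))"
      using h0 \<open>\<omega> \<ge> 0\<close> by (intro mult_right_mono) auto
    finally have 1: "2 * c\<^sup>2 * \<mu> / 2 ^ J * b_iter m 0 \<le> (S + 1) * (2 ^ (r * Suc m) * (h ^ q * \<omega>))" .
    have "\<rho> ^ m / P \<le> b_iter m 0"
      using b_iter_lower[of m, folded P_def] p0 by (simp add: divide_le_eq mult.commute)
    then have "2 * c\<^sup>2 * \<mu> / 2 ^ J * (\<rho> ^ m / P) \<le> 2 * c\<^sup>2 * \<mu> / 2 ^ J * b_iter m 0"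
      using \<mu>(1) by (intro mult_left_mono) auto
    then have "2 * c\<^sup>2 * \<mu> / 2 ^ J * (\<rho> ^ m / P) \<le> (S + 1) * (2 ^ (r * Suc m) * (h ^ q * \<omega>))"
      using 1 by (rule order_trans)
    then have "2 * c\<^sup>2 * \<mu> / 2 ^ J * (\<rho> ^ m / P) / (S + 1) \<le> 2 ^ (r * Suc m) * (h ^ q * \<omega>)"
      using S0 by (subst pos_divide_le_eq) (simp_all add: mult.commute)
    then have "C * \<rho> ^ m \<le> 2 ^ (r * Suc m) * (h ^ q * \<omega>)" by (simp add: C_def)
    then have "C * \<rho> ^ m * 2 ^ (q * Suc m) \<le> 2 ^ (r * Suc m) * (h ^ q * \<omega>) * 2 ^ (q * Suc m)"
      by (intro mult_right_mono) auto
    also have "h ^ q = 1 / 2 ^ (q * Suc m)"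
      unfolding h_def power_one_over power_mult[symmetric] by (simp only: mult.commute)
    finally show ?thesis by (simp only: times_divide_eq_left times_divide_eq_right mult_1) simp
  qed
  moreover have "R > 0" by (simp add: R_def)
  ultimately show thesis using that[of g R C] g(2) C0 by blast
qed

text \<open>At scale 2^(-m) around 0 the derivative of order q oscillates by at least c \<kappa>^m.
  A Hoelder condition would force decay like 2^(-\<alpha> m), although \<kappa> 2^\<alpha> = \<rho>
  2^(\<beta> - r) > 1. In the remaining cases \<kappa> \<ge> 1, against continuity at 0.\<close>

lemma regularity_upper_bound:
  assumes \<beta>: "0 \<le> \<beta>" "\<beta> > real r - log 2 \<rho>" and \<rho>: "\<rho> \<ge> 1 / 2"
  shows "\<exists>f0. finsupp f0 \<and> \<not> (\<exists>g. is_limit_function a f0 g \<and> g \<in> holder_class \<beta>)"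
proof (rule ccontr)
  assume "\<not> ?thesis"
  then have "\<And>f. finsupp f \<Longrightarrow> \<exists>g. is_limit_function a f g \<and> g \<in> holder_class \<beta>" by blast
  then obtain g R C where g: "g \<in> holder_class \<beta>" and R: "R > 0" and C: "C > 0"
    and main: "\<And>q D m \<omega>. q \<le> r + 1 \<Longrightarrow> D 0 = g \<Longrightarrow>
      (\<And>i x. i < q \<Longrightarrow> (D i has_real_derivative D (Suc i) x) (at x)) \<Longrightarrow>
      (\<And>s t. \<bar>s\<bar> \<le> R / 2 ^ Suc m \<Longrightarrow> \<bar>t\<bar> \<le> R / 2 ^ Suc m \<Longrightarrow> \<bar>D q s - D q t\<bar> \<le> \<omega>) \<Longrightarrow>
      C * \<rho> ^ m * 2 ^ (q * Suc m) \<le> 2 ^ (r * Suc m) * \<omega>"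
    by (rule oscillation_lower) blast+
  define n where "n = nat \<lfloor>\<beta>\<rfloor>"
  define \<alpha> where "\<alpha> = frac \<beta>"
  have n: "\<beta> = real n + \<alpha>" using \<beta>(1) by (simp add: n_def \<alpha>_def frac_def)
  have \<alpha>: "0 \<le> \<alpha>" by (simp add: \<alpha>_def)
  have gn: "g \<in> cont_diff n" and gh: "\<alpha> > 0 \<Longrightarrow> (deriv ^^ n) g \<in> holder_frac \<alpha>"
    using g by (simp_all add: holder_class_def Let_def n_def \<alpha>_def)
  \<comment> \<open>Beyond r + 1 the continuity of the derivative of order r + 1 is already
    contradictory, since there \<kappa> = 2 \<rho> \<ge> 1.\<close>
  define q where "q = min n (r + 1)"
  define Dq where "Dq = (deriv ^^ q) g"
  define \<kappa> where "\<kappa> = \<rho> * 2 ^ q / 2 ^ r"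
  define c where "c = C * 2 ^ q / 2 ^ r"
  have c0: "c > 0" using C by (simp add: c_def)
  have osc: "c * \<kappa> ^ m \<le> \<omega>"
    if "\<And>s t. \<bar>s\<bar> \<le> R / 2 ^ Suc m \<Longrightarrow> \<bar>t\<bar> \<le> R / 2 ^ Suc m \<Longrightarrow> \<bar>Dq s - Dq t\<bar> \<le> \<omega>" for m \<omega>
  proof -
    have "C * \<rho> ^ m * 2 ^ (q * Suc m) \<le> 2 ^ (r * Suc m) * \<omega>"
    proof (rule main[of q "\<lambda>i. (deriv ^^ i) g"])
      show "q \<le> r + 1" by (simp add: q_def)
      show "((deriv ^^ i) g has_real_derivative (deriv ^^ Suc i) g x) (at x)" if "i < q" for i x
        using that by (intro cont_diff_has_derivs[OF gn]) (simp add: q_def)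
      show "\<bar>(deriv ^^ q) g s - (deriv ^^ q) g t\<bar> \<le> \<omega>"
        if "\<bar>s\<bar> \<le> R / 2 ^ Suc m" "\<bar>t\<bar> \<le> R / 2 ^ Suc m" for s t
        using \<open>\<And>s t. \<bar>s\<bar> \<le> R / 2 ^ Suc m \<Longrightarrow> \<bar>t\<bar> \<le> R / 2 ^ Suc m \<Longrightarrow> \<bar>Dq s - Dq t\<bar> \<le> \<omega>\<close>[OF that]
        by (simp add: Dq_def)
    qed simp
    then have "C * \<rho> ^ m * 2 ^ (q * Suc m) / 2 ^ (r * Suc m) \<le> \<omega>"
      by (simp add: divide_le_eq mult.commute)
    moreover have "C * \<rho> ^ m * 2 ^ (q * Suc m) / 2 ^ (r * Suc m) = c * \<kappa> ^ m"
      by (simp add: c_def \<kappa>_def power_mult power_add power_mult_distrib power_divide power_commutes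
          flip: power_mult)
    ultimately show ?thesis by simp
  qed
  have \<rho>\<beta>: "\<rho> * 2 powr (\<beta> - real r) > 1"
  proof -
    have "\<rho> * 2 powr (\<beta> - real r) = 2 powr (log 2 \<rho> + (\<beta> - real r))"
      using \<rho> by (simp add: powr_add)
    moreover have "2 powr 0 < 2 powr (log 2 \<rho> + (\<beta> - real r))"
      using \<beta>(2) by (intro powr_less_mono) auto
    ultimately show ?thesis by simp
  qed
  have \<kappa>: "\<kappa> * 2 powr x = \<rho> * 2 powr (real q + x - real r)" for x
    unfolding \<kappa>_def by (simp add: powr_add powr_diff powr_realpow)
  show False
  proof (cases "n \<le> r \<and> \<alpha> > 0")
    case True
    then have q: "q = n" by (simp add: q_def)
    then have "Dq \<in> holder_frac \<alpha>" using gh True by (simp add: Dq_def)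
    then obtain H where H: "\<And>x y. \<bar>Dq x - Dq y\<bar> \<le> H * \<bar>x - y\<bar> powr \<alpha>"
      by (auto simp: holder_frac_def)
    have H0: "H \<ge> 0" using H[of 1 0] by simp
    define L where "L = \<kappa> * 2 powr \<alpha>"
    have "L > 1" using \<rho>\<beta> by (simp add: L_def \<kappa> q n)
    have bound: "c * L ^ m \<le> H * R powr \<alpha>" for m
    proof -
      have "c * \<kappa> ^ m \<le> H * (R / 2 ^ m) powr \<alpha>"
      proof (rule osc)
        fix s t assume "\<bar>s\<bar> \<le> R / 2 ^ Suc m" "\<bar>t\<bar> \<le> R / 2 ^ Suc m"
        then have "\<bar>s - t\<bar> \<le> R / 2 ^ m" by (simp add: abs_le_iff)
        then have "H * \<bar>s - t\<bar> powr \<alpha> \<le> H * (R / 2 ^ m) powr \<alpha>"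
          using H0 \<alpha> by (intro mult_left_mono powr_mono2) auto
        then show "\<bar>Dq s - Dq t\<bar> \<le> H * (R / 2 ^ m) powr \<alpha>" using H[of s t] by linarith
      qed
      also have "(R / 2 ^ m) powr \<alpha> = R powr \<alpha> / (2 powr \<alpha>) ^ m"
        using R by (simp add: powr_divide powr_powr mult.commute flip: powr_realpow)
      finally show ?thesis by (simp add: L_def power_mult_distrib field_simps)
    qed
    obtain m where "H * R powr \<alpha> / c < L ^ m" using real_arch_pow[OF \<open>L > 1\<close>] by blast
    then show False using bound[of m] c0 by (simp add: field_simps)
  next
    case False
    have "\<kappa> \<ge> 1"
    proof (cases "n \<le> r")
      case True
      then have "q = n" "\<alpha> = 0" using False \<alpha> by (auto simp: q_def)
      then show ?thesis using \<rho>\<beta> \<kappa>[of 0] n by simp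
    next
      case False
      then have "q = Suc r" by (simp add: q_def)
      then show ?thesis using \<rho> by (simp add: \<kappa>_def)
    qed
    have "isCont Dq 0"
      using cont_diff_continuous[OF gn, of q] by (simp add: Dq_def q_def continuous_on_eq_continuous_at)
    then obtain \<delta> where \<delta>: "\<delta> > 0" "\<And>t. \<bar>t\<bar> < \<delta> \<Longrightarrow> \<bar>Dq t - Dq 0\<bar> < c / 4"
      using c0 unfolding continuous_at_eps_delta by (force simp: dist_real_def dest: spec[of _ "c / 4"])
    obtain m where m: "(1 / 2) ^ m < \<delta> / R"
      using real_arch_pow_inv[of "\<delta> / R" "1 / 2"] \<delta>(1) R by auto
    have "R / 2 ^ Suc m \<le> R / 2 ^ m" using R by (intro divide_left_mono) auto
    also have "\<dots> < \<delta>" using m R by (simp add: power_one_over field_simps)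
    finally have Rm: "R / 2 ^ Suc m < \<delta>" .
    have "c * 1 \<le> c * \<kappa> ^ m" using c0 \<open>\<kappa> \<ge> 1\<close> by (intro mult_left_mono one_le_power) auto
    also have "\<dots> \<le> c / 2"
    proof (rule osc)
      fix s t assume "\<bar>s\<bar> \<le> R / 2 ^ Suc m" "\<bar>t\<bar> \<le> R / 2 ^ Suc m"
      then have "\<bar>s\<bar> < \<delta>" "\<bar>t\<bar> < \<delta>" using Rm by linarith+
      then have "\<bar>Dq s - Dq 0\<bar> < c / 4" "\<bar>Dq t - Dq 0\<bar> < c / 4" by (simp_all only: \<delta>(2))
      then show "\<bar>Dq s - Dq t\<bar> \<le> c / 2" by linarith
    qed
    finally show False using c0 by simp
  qed
qed

end

section \<open>Reality and uniform positivity of the symbol\<close>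

lemma trig_symbol_eq_trig:
  assumes supp: "\<And>k. \<bar>k\<bar> > int p \<Longrightarrow> b k = 0" and sym: "\<And>k. b (- k) = b k"
  shows "trig b \<xi> = of_real (trig_symbol p b \<xi>)"
proof -
  \<comment> \<open>Evenness reconciles the two sign conventions, exp(-i \<xi>) for
    \<open>trig_symbol\<close> and exp(i \<xi>) for \<open>trig\<close>.\<close>
  have "trig_symbol p b \<xi> = trig_symbol p b (- \<xi>)"
    by (simp add: trig_symbol_def)
  moreover have "cis \<xi> = exp (- \<i> * of_real (- \<xi>))"
    by (simp add: cis_conv_exp)
  ultimately show ?thesis
    using of_real_trig_symbol[of p b "- \<xi>", OF supp sym] symbol_cis[of b \<xi>] by simp
qed

lemma trig_symbol_uniformly_positive:
  assumes pos: "\<And>\<xi>. \<xi> \<in> {- pi..pi} \<Longrightarrow> trig_symbol p b \<xi> > 0"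
  obtains \<mu> where "\<mu> > 0" "\<And>\<xi>. \<mu> \<le> trig_symbol p b \<xi>"
proof -
  have "continuous_on {- pi..pi} (trig_symbol p b)"
    unfolding trig_symbol_def by (intro continuous_intros)
  then have "\<exists>x\<in>{- pi..pi}. \<forall>y\<in>{- pi..pi}. trig_symbol p b x \<le> trig_symbol p b y"
    by (intro continuous_attains_inf) auto
  then obtain x where x: "x \<in> {- pi..pi}" "\<And>y. y \<in> {- pi..pi} \<Longrightarrow> trig_symbol p b x \<le> trig_symbol p b y"
    by blast
  have "trig_symbol p b x \<le> trig_symbol p b \<xi>" for \<xi>
  proof -
    \<comment> \<open>The number of periods that brings \<xi> back to [-pi, pi], where the minimum
      was taken.\<close>
    define n where "n = \<lfloor>(\<xi> + pi) / (2 * pi)\<rfloor>"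
    define \<eta> where "\<eta> = \<xi> - 2 * pi * of_int n"
    have "of_int n \<le> (\<xi> + pi) / (2 * pi)" "(\<xi> + pi) / (2 * pi) < of_int n + 1"
      unfolding n_def by linarith+
    then have "of_int n * (2 * pi) \<le> \<xi> + pi" "\<xi> + pi < (of_int n + 1) * (2 * pi)"
      by (simp_all add: pos_le_divide_eq pos_divide_less_eq)
    then have "\<eta> \<in> {- pi..pi}" by (simp add: \<eta>_def algebra_simps)
    moreover have "trig_symbol p b \<eta> = trig_symbol p b \<xi>"
    proof -
      have "cos (real k * \<eta>) = cos (real k * \<xi>)" for k
      proof -
        have "real k * \<eta> = real k * \<xi> + of_int (- (int k * n)) * (2 * pi)"
          by (simp add: \<eta>_def algebra_simps)
        then show ?thesis
          using cos.plus_of_int[of "real k * \<xi>" "- (int k * n)"] by simp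
      qed
      then show ?thesis by (simp add: trig_symbol_def)
    qed
    ultimately show ?thesis using x(2) by metis
  qed
  then show thesis using that pos[OF x(1)] by blast
qed

theorem theorem2:
  fixes a b :: "int \<Rightarrow> real" and r p :: nat and \<rho> :: real
  assumes "finsupp a"
    and "symbol a (- 1) = 0"
    and "symbol a 1 = 2"
    and "p \<ge> 1"
    and "b (int p) \<noteq> 0"
    and "\<And>k. \<bar>k\<bar> > int p \<Longrightarrow> b k = 0"
    and "\<And>k. b (- k) = b k"
    and "\<And>z. z \<noteq> 0 \<Longrightarrow> symbol a z = (1 + z) ^ (r + 1) * symbol b z / 2 ^ r"
    and "\<rho> = spectral_radius (subdiv_matrix p b)"
    and "\<rho> \<ge> 1 / 2"
    and "\<And>\<xi>. \<xi> \<in> {- pi..pi} \<Longrightarrow> trig_symbol p b \<xi> > 0"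
  shows "(\<forall>\<beta>. 0 \<le> \<beta> \<and> \<beta> < real r - log 2 \<rho> \<longrightarrow>
            (\<forall>f0. finsupp f0 \<longrightarrow> (\<exists>f. is_limit_function a f0 f \<and> f \<in> holder_class \<beta>))) \<and>
         (\<forall>\<beta>. 0 \<le> \<beta> \<and> \<beta> > real r - log 2 \<rho> \<longrightarrow>
            (\<exists>f0. finsupp f0 \<and> \<not> (\<exists>f. is_limit_function a f0 f \<and> f \<in> holder_class \<beta>)))"
proof -
  obtain \<mu> where \<mu>: "\<mu> > 0" "\<And>\<xi>. \<mu> \<le> trig_symbol p b \<xi>"
    using trig_symbol_uniformly_positive[OF assms(11)] by blast
  interpret positive_scheme a b r p "trig_symbol p b" \<mu>
  proof
    show "supp_in p b" using assms(6) by (intro supp_inI) (metis linorder_not_le)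
    show "trig a \<xi> = (1 + cis \<xi>) ^ (r + 1) * trig b \<xi> / 2 ^ r" for \<xi>
      using assms(8)[of "cis \<xi>"] by (simp add: symbol_cis)
    show "trig a 0 = 2" using assms(3) symbol_cis[of a 0] by simp
    show "trig a pi = 0" using assms(2) symbol_cis[of a pi] by simp
    show "trig b \<xi> = of_real (trig_symbol p b \<xi>)" for \<xi>
      using assms(6,7) by (rule trig_symbol_eq_trig)
  qed (use assms(1,4) \<mu> in auto)
  show ?thesis
    using regularity_lower_bound regularity_upper_bound assms(10) unfolding assms(9) by blast
qed

end
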